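(* Let $s>\frac12$, let $z_0\in H^s(\mathbb{T}^2)$ and $z_1\in H^{s-1}(\mathbb{T}^2)$ be real-valued, let $T>0$ be a finite time smaller than the maximal existence time, and let $z$ be the exact solution on $[0,T]$ of $$z_{tt}=\Delta z-z-z^3,\qquad z(0)=z_0,\quad z_t(0)=z_1,\qquad x\in\mathbb{T}^2 .$$ Put $u=z+i\langle\nabla\rangle^{-1}z_t$. For a time step $\tau>0$ let $t_n=n\tau$, and let $(u_n)_{n\ge0}$ and $(v_n)_{n\ge 0}$ be the sequences with $u_0=v_0=u(0)=z_0+i\langle\nabla\rangle^{-1}z_1$ defined by the Lie splitting $$u_{n+1}=e^{-i\tau\langle\nabla\rangle}u_n-i\tau\langle\nabla\rangle^{-1}e^{-i\tau\langle\nabla\rangle}(\operatorname{Re}u_n)^3$$ and by the Strang splitting $$v_{n+1}=e^{-i\tau\langle\nabla\rangle}v_n-i\tau\langle\nabla\rangle^{-1}e^{-i\tau\langle\nabla\rangle/2}\big(\operatorname{Re}(e^{-i\tau\langle\nabla\rangle/2}v_n)\big)^3 ,$$ respectively. Then there exist constants $\tau_0,C_T>0$ such that for every $\tau\in(0,\tau_0]$ and every $n$ with $0\le n\tau\le T$: (a) (Lie) if $s\in(\frac12,\frac56]$, then $\|u(t_n)-u_n\|_{H^{1/2}(\mathbb{T}^2)}\le C_T\,\tau^{3s-\frac32}$; (b) (Strang) if $s\in(1,\frac32]$, then $\|u(t_n)-v_n\|_{H^{1/2}(\mathbb{T}^2)}\le C_T\,\tau^{s+\frac12}$. Here $C_T$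 depends on $T$ and $\tau_0$ but is independent of $n$ and $\tau$.
   Context: $\mathbb{T}^2=(\mathbb{R}/2\pi\mathbb{Z})^2$. For $k\in\mathbb{Z}^2$, $\langle k\rangle=(1+|k|^2)^{1/2}$, and $\langle\nabla\rangle^\alpha$, $e^{-it\langle\nabla\rangle}$ are the Fourier multipliers with symbols $\langle k\rangle^\alpha$, $e^{-it\langle k\rangle}$. $H^s$ is the $L^2$-based Sobolev space on $\mathbb{T}^2$. The function $u=z+i\langle\nabla\rangle^{-1}z_t$ is the solution in $C([0,T],H^s(\mathbb{T}^2))$ of the equivalent equation $u_t=-i\langle\nabla\rangle u-i\langle\nabla\rangle^{-1}(\operatorname{Re}u)^3$, $u(0)=z_0+i\langle\nabla\rangle^{-1}z_1$ (understood in the mild/Duhamel sense). *)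

theory Defs
  imports "HOL-Analysis.Analysis"
begin

(* A distribution on the torus (R / 2 pi Z)^2 is represented by its family of Fourier
   coefficients.  This covers Sobolev spaces of negative order; for c in H^s with s >= 0
   the corresponding L^2 function is recovered by torus_fun below. *)
type_synonym torus_dist = "int \<times> int \<Rightarrow> complex"

definition jap :: "int \<times> int \<Rightarrow> real" where
  "jap k = sqrt (1 + (real_of_int (fst k))\<^sup>2 + (real_of_int (snd k))\<^sup>2)"

definition Sobolev :: "real \<Rightarrow> torus_dist set" where
  "Sobolev s = {c. (\<lambda>k. jap k powr (2 * s) * (cmod (c k))\<^sup>2) summable_on UNIV}"

(* Meaningful only for members of Sobolev s: infsum of a non-summable family is 0. *)
definition Sobolev_norm :: "real \<Rightarrow> torus_dist \<Rightarrow> real" where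
  "Sobolev_norm s c = sqrt (\<Sum>\<^sub>\<infinity>k. jap k powr (2 * s) * (cmod (c k))\<^sup>2)"

definition jap_pow :: "real \<Rightarrow> torus_dist \<Rightarrow> torus_dist" where
  "jap_pow \<alpha> c = (\<lambda>k. complex_of_real (jap k powr \<alpha>) * c k)"

definition flow :: "real \<Rightarrow> torus_dist \<Rightarrow> torus_dist" where
  "flow t c = (\<lambda>k. exp (- \<i> * complex_of_real (t * jap k)) * c k)"

(* A distribution is real-valued iff it pairs to real numbers with real test functions. *)
definition real_valued :: "torus_dist \<Rightarrow> bool" where
  "real_valued c \<longleftrightarrow> (\<forall>k. c (- k) = cnj (c k))"

(* Functions on the torus are given on the fundamental domain, up to null sets. *)
definition torus :: "(real \<times> real) measure" where
  "torus = restrict_space lborel ({0..<2 * pi} \<times> {0..<2 * pi})"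

definition fourier_coeff :: "(real \<times> real \<Rightarrow> complex) \<Rightarrow> torus_dist" where
  "fourier_coeff f = (\<lambda>k. (\<integral>x. f x * exp (- \<i> * complex_of_real
       (real_of_int (fst k) * fst x + real_of_int (snd k) * snd x)) \<partial>torus)
     / complex_of_real ((2 * pi)\<^sup>2))"

definition torus_L2 :: "(real \<times> real \<Rightarrow> complex) set" where
  "torus_L2 = {f \<in> borel_measurable torus. integrable torus (\<lambda>x. (cmod (f x))\<^sup>2)}"

(* The L^2 function with the given Fourier coefficients.  It exists for every square-summable
   family (Riesz-Fischer) and is unique up to a null set. *)
definition torus_fun :: "torus_dist \<Rightarrow> (real \<times> real \<Rightarrow> complex)" where
  "torus_fun c = (SOME f. f \<in> torus_L2 \<and> fourier_coeff f = c)"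

(* (Re c)^3, the cube being the pointwise one.  For c in H^s with s > 1/2 the function
   lies in L^4, so its cube is integrable and has Fourier coefficients. *)
definition Re_cubed :: "torus_dist \<Rightarrow> torus_dist" where
  "Re_cubed c = fourier_coeff (\<lambda>x. complex_of_real ((Re (torus_fun c x)) ^ 3))"

(* u = a + i <nabla>^{-1} b *)
definition first_order :: "torus_dist \<Rightarrow> torus_dist \<Rightarrow> torus_dist" where
  "first_order a b = (\<lambda>k. a k + \<i> * jap_pow (-1) b k)"

definition continuous_into_Sobolev :: "real \<Rightarrow> real \<Rightarrow> (real \<Rightarrow> torus_dist) \<Rightarrow> bool" where
  "continuous_into_Sobolev s T u \<longleftrightarrow>
     (\<forall>t\<in>{0..T}. u t \<in> Sobolev s) \<and>
     (\<forall>t\<in>{0..T}. ((\<lambda>r. Sobolev_norm s (\<lambda>k. u r k - u t k)) \<longlongrightarrow> 0) (at t within {0..T}))"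

(* u in C([0,T], H^s) solving the Duhamel formula of
     u_t = -i <nabla> u - i <nabla>^{-1} (Re u)^3,   u(0) = u0.
   The time integral of the H^s-valued integrand is taken coefficient by coefficient. *)
definition mild_solution :: "real \<Rightarrow> real \<Rightarrow> torus_dist \<Rightarrow> (real \<Rightarrow> torus_dist) \<Rightarrow> bool" where
  "mild_solution s T u0 u \<longleftrightarrow>
     continuous_into_Sobolev s T u \<and>
     (\<forall>t\<in>{0..T}. \<forall>k.
        ((\<lambda>r. jap_pow (-1) (flow (t - r) (Re_cubed (u r))) k) integrable_on {0..t}) \<and>
        u t k = flow t u0 k
          - \<i> * integral {0..t} (\<lambda>r. jap_pow (-1) (flow (t - r) (Re_cubed (u r))) k))"

definition max_existence_time :: "real \<Rightarrow> torus_dist \<Rightarrow> ereal" where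
  "max_existence_time s u0 = Sup {ereal T | T. T \<ge> 0 \<and> (\<exists>u. mild_solution s T u0 u)}"

(* z is the solution on [0,T] of z_tt = Delta z - z - z^3 with data z0, z1, and zt is its
   time derivative (in the sense of distributions on the torus, i.e. coefficient by
   coefficient; one-sided at 0 and T).  The equation is understood in the mild sense for
   u = z + i <nabla>^{-1} zt. *)
definition wave_solution ::
  "real \<Rightarrow> real \<Rightarrow> torus_dist \<Rightarrow> torus_dist \<Rightarrow> (real \<Rightarrow> torus_dist) \<Rightarrow> (real \<Rightarrow> torus_dist) \<Rightarrow> bool"
where
  "wave_solution s T z0 z1 z zt \<longleftrightarrow>
     z 0 = z0 \<and> zt 0 = z1 \<and>
     (\<forall>t\<in>{0..T}. real_valued (z t) \<and> real_valued (zt t) \<and>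
        (\<forall>k. ((\<lambda>r. z r k) has_vector_derivative zt t k) (at t within {0..T}))) \<and>
     mild_solution s T (first_order z0 z1) (\<lambda>t. first_order (z t) (zt t))"

primrec lie_splitting :: "real \<Rightarrow> torus_dist \<Rightarrow> nat \<Rightarrow> torus_dist" where
  "lie_splitting \<tau> u0 0 = u0"
| "lie_splitting \<tau> u0 (Suc n) =
     (\<lambda>k. flow \<tau> (lie_splitting \<tau> u0 n) k
        - \<i> * complex_of_real \<tau> * jap_pow (-1) (flow \<tau> (Re_cubed (lie_splitting \<tau> u0 n))) k)"

primrec strang_splitting :: "real \<Rightarrow> torus_dist \<Rightarrow> nat \<Rightarrow> torus_dist" where
  "strang_splitting \<tau> u0 0 = u0"
| "strang_splitting \<tau> u0 (Suc n) =
     (\<lambda>k. flow \<tau> (strang_splitting \<tau> u0 n) k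
        - \<i> * complex_of_real \<tau> * jap_pow (-1)
            (flow (\<tau> / 2) (Re_cubed (flow (\<tau> / 2) (strang_splitting \<tau> u0 n)))) k)"

(* The distance bound in H^s; membership is required because Sobolev_norm is only meaningful
   there. *)
definition Sobolev_dist_le :: "real \<Rightarrow> torus_dist \<Rightarrow> torus_dist \<Rightarrow> real \<Rightarrow> bool" where
  "Sobolev_dist_le s a b \<epsilon> \<longleftrightarrow>
     (\<lambda>k. a k - b k) \<in> Sobolev s \<and> Sobolev_norm s (\<lambda>k. a k - b k) \<le> \<epsilon>"

end

theory Submission
  imports Defs
begin

text \<open>
  The theorem is an error estimate in \<open>H\<^sup>1\<^sup>/\<^sup>2\<close>, and in two dimensions \<open>H\<^sup>1\<^sup>/\<^sup>2\<close> embeds into \<open>L\<^sup>4\<close>, so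
  that \<open>f \<mapsto> \<langle>\<nabla>\<rangle>\<^sup>-\<^sup>1 (Re f)\<^sup>3\<close> is locally Lipschitz on \<open>H\<^sup>1\<^sup>/\<^sup>2\<close>. Hence one step of either scheme
  is stable with a factor \<open>1 + O(\<tau>)\<close> (\<open>lie_step_stability\<close>, \<open>strang_step_stability\<close>), and by a discrete
  Gronwall argument (\<open>error_propagation\<close>) it suffices to bound the local errors by \<open>\<tau>\<close> times the
  claimed rate. These bounds follow from the Sobolev multiplication
  theorem (\<open>product_estimate\<close>), including its critical case, and from the inequality
  \<open>\<bar>exp (\<i> * \<theta>) - 1\<bar> \<le> 2 * \<bar>\<theta>\<bar>\<^sup>p\<close>, which trades \<open>p\<close> derivatives for the factor \<open>\<tau>\<^sup>p\<close>.

  For the Lie splitting (\<open>lie_local_error\<close>) the local error integrates, in \<open>H\<^sup>-\<^sup>1\<^sup>/\<^sup>2\<close>, the variation over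
  one step of \<open>exp (\<i> * r * \<langle>\<nabla>\<rangle>) g(r)\<close> with \<open>g = (Re u)\<^sup>3\<close>. Since \<open>g\<close> is bounded in \<open>H\<close> to the power
  \<open>3s - 2\<close>, the variation of the flow costs \<open>3s - 3/2\<close> derivatives and gains the same power of \<open>\<tau>\<close>;
  for the variation of \<open>g\<close> one factor \<open>u(t + r) - u(t)\<close> is measured in \<open>H\<close> to the power \<open>3/2 - 2s\<close>, again
  \<open>3s - 3/2\<close> derivatives below \<open>H\<^sup>s\<close>, and multiplied by two factors in \<open>H\<^sup>s\<close>.

  The Strang splitting (\<open>strang_local_error\<close>) is a midpoint rule. Symmetrizing the integral about the midpoint
  leaves a second difference of the integrand, which contains the second difference of \<open>Re u\<close> in
  \<open>H\<^sup>-\<^sup>1\<^sup>/\<^sup>2\<close>, products of two first differences, and second differences of the flow. Each gains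
  \<open>\<tau>\<close> to the power \<open>s + 1/2\<close>. The Duhamel term does not spoil this: its real part carries the
  kernel \<open>\<langle>\<nabla>\<rangle>\<^sup>-\<^sup>1 sin ((t - r) * \<langle>\<nabla>\<rangle>)\<close> and is therefore quadratic in the time increment without any loss of
  regularity (\<open>real_part_defect_bound\<close>).

  All estimates are made for families of Fourier coefficients. The link to the pointwise cube is that the
  coefficients of \<open>(Re f)\<^sup>3\<close> form an iterated convolution (\<open>Re_cubed_eq_cube\<close>). As \<open>f\<close> is an arbitrary square
  integrable function with the given coefficients, this rests on the Riesz-Fischer theorem and on the fact that an
  integrable function is determined by its Fourier coefficients (\<open>AE_zero_if_fourier_coeff_zero\<close>).
\<close>

section \<open>Japanese brackets and Sobolev balls\<close>

lemma jap_eq_norm: "jap k = norm (1::real, real_of_int (fst k), real_of_int (snd k))"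
  by (simp add: jap_def norm_Pair add.assoc)

lemma jap_ge_1: "1 \<le> jap k"
  by (simp add: jap_def)

lemma jap_pos [simp]: "0 < jap k"
  using jap_ge_1[of k] by linarith

lemma jap_neq_0 [simp]: "jap k \<noteq> 0"
  using jap_pos[of k] by linarith

lemma jap_nonneg [simp]: "0 \<le> jap k"
  using jap_pos[of k] by linarith

lemma jap_minus [simp]: "jap (- k) = jap k"
  by (simp add: jap_def)

lemma jap_add: "jap (k + l) \<le> jap k + jap l"
proof -
  have "jap (k + l) = norm ((1::real, real_of_int (fst k), real_of_int (snd k)) + (0, real_of_int (fst l), real_of_int (snd l)))"
    by (simp add: jap_eq_norm)
  also have "\<dots> \<le> jap k + norm (0::real, real_of_int (fst l), real_of_int (snd l))"
    unfolding jap_eq_norm by (rule norm_triangle_ineq)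
  also have "norm (0::real, real_of_int (fst l), real_of_int (snd l)) \<le> jap l"
    by (simp add: jap_eq_norm norm_Pair)
  finally show ?thesis by simp
qed

lemma jap_powr_le: "a \<le> b \<Longrightarrow> jap k powr a \<le> jap k powr b"
  by (intro powr_mono jap_ge_1)

text \<open>Membership in a ball of \<open>H\<^sup>s\<close> is tested on finite sets of frequencies, so that all the
  estimates below become inequalities between finite sums.\<close>

definition Sobolev_le :: "real \<Rightarrow> real \<Rightarrow> torus_dist \<Rightarrow> bool" where
  "Sobolev_le s B c \<longleftrightarrow> 0 \<le> B \<and> (\<forall>K. finite K \<longrightarrow> L2_set (\<lambda>k. jap k powr s * cmod (c k)) K \<le> B)"

lemma Sobolev_leI:
  assumes "0 \<le> B" "\<And>K. finite K \<Longrightarrow> L2_set (\<lambda>k. jap k powr s * cmod (c k)) K \<le> B"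
  shows "Sobolev_le s B c"
  using assms by (auto simp: Sobolev_le_def)

lemma Sobolev_le_nonneg: "Sobolev_le s B c \<Longrightarrow> 0 \<le> B"
  by (simp add: Sobolev_le_def)

lemma Sobolev_leD: "Sobolev_le s B c \<Longrightarrow> L2_set (\<lambda>k. jap k powr s * cmod (c k)) K \<le> B"
  by (cases "finite K") (auto simp: Sobolev_le_def)

lemma weight_square: "(jap k powr s * cmod (c k))\<^sup>2 = jap k powr (2 * s) * (cmod (c k))\<^sup>2"
  by (simp add: power_mult_distrib powr_powr powr_realpow[symmetric] mult.commute flip: powr_numeral)

lemma Sobolev_leI_sum:
  assumes "0 \<le> B" "\<And>K. finite K \<Longrightarrow> (\<Sum>k\<in>K. (jap k powr s * cmod (c k))\<^sup>2) \<le> B\<^sup>2"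
  shows "Sobolev_le s B c"
  using assms by (intro Sobolev_leI) (auto simp: L2_set_def intro!: real_le_lsqrt sum_nonneg)

lemma Sobolev_leD_sum: 
  assumes "Sobolev_le s B c"
  shows "(\<Sum>k\<in>K. (jap k powr s * cmod (c k))\<^sup>2) \<le> B\<^sup>2"
proof -
  have "sqrt (\<Sum>k\<in>K. (jap k powr s * cmod (c k))\<^sup>2) \<le> B"
    using Sobolev_leD[OF assms, of K] by (simp add: L2_set_def)
  then show ?thesis
    using sqrt_le_D by blast
qed

lemma Sobolev_le_iff: "Sobolev_le s B c \<longleftrightarrow> c \<in> Sobolev s \<and> Sobolev_norm s c \<le> B"
proof
  assume B: "Sobolev_le s B c"
  have sm: "(\<lambda>k. jap k powr (2 * s) * (cmod (c k))\<^sup>2) summable_on UNIV"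
    by (rule nonneg_bdd_above_summable_on)
      (use Sobolev_leD_sum[OF B] in \<open>auto simp: weight_square intro!: bdd_aboveI2[where M = "B\<^sup>2"]\<close>)
  have "(\<Sum>\<^sub>\<infinity>k. jap k powr (2 * s) * (cmod (c k))\<^sup>2) \<le> B\<^sup>2"
    by (rule infsum_le_finite_sums[OF sm]) (use Sobolev_leD_sum[OF B] in \<open>simp add: weight_square\<close>)
  then show "c \<in> Sobolev s \<and> Sobolev_norm s c \<le> B"
    using sm Sobolev_le_nonneg[OF B]
    by (auto simp: Sobolev_def Sobolev_norm_def intro!: real_le_lsqrt infsum_nonneg)
next
  assume A: "c \<in> Sobolev s \<and> Sobolev_norm s c \<le> B"
  then have sm: "(\<lambda>k. jap k powr (2 * s) * (cmod (c k))\<^sup>2) summable_on UNIV"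
    by (simp add: Sobolev_def)
  have "L2_set (\<lambda>k. jap k powr s * cmod (c k)) K \<le> B" if "finite K" for K
  proof -
    have "(\<Sum>k\<in>K. jap k powr (2 * s) * (cmod (c k))\<^sup>2) \<le> (\<Sum>\<^sub>\<infinity>k. jap k powr (2 * s) * (cmod (c k))\<^sup>2)"
      by (rule finite_sum_le_infsum[OF sm that]) auto
    then have "L2_set (\<lambda>k. jap k powr s * cmod (c k)) K \<le> Sobolev_norm s c"
      by (simp add: L2_set_def Sobolev_norm_def weight_square)
    then show ?thesis using A by simp
  qed
  moreover have "0 \<le> B"
  proof -
    have "0 \<le> Sobolev_norm s c"
      by (auto simp: Sobolev_norm_def intro!: infsum_nonneg)
    then show ?thesis using A by simp
  qed
  ultimately show "Sobolev_le s B c" by (intro Sobolev_leI)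
qed

lemma Sobolev_le_norm: "c \<in> Sobolev s \<Longrightarrow> Sobolev_le s (Sobolev_norm s c) c"
  by (simp add: Sobolev_le_iff)

lemma Sobolev_dist_le_iff: "Sobolev_dist_le s a b B \<longleftrightarrow> Sobolev_le s B (\<lambda>k. a k - b k)"
  by (simp add: Sobolev_dist_le_def Sobolev_le_iff)

lemma Sobolev_le_mono: "Sobolev_le s A c \<Longrightarrow> A \<le> B \<Longrightarrow> Sobolev_le s B c"
  by (auto simp: Sobolev_le_def intro: order_trans)

text \<open>A Fourier multiplier of order \<open>p\<close> maps \<open>H\<^sup>s\<close> into every \<open>H\<^sup>r\<close> with \<open>r + p \<le> s\<close>.\<close>

lemma Sobolev_le_multiplier:
  assumes "Sobolev_le s B c" "0 \<le> M" "r + p \<le> s"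
    and le: "\<And>k. cmod (d k) \<le> M * jap k powr p * cmod (c k)"
  shows "Sobolev_le r (M * B) d"
proof (rule Sobolev_leI)
  show "0 \<le> M * B" using assms Sobolev_le_nonneg by auto
  fix K :: "(int \<times> int) set" assume "finite K"
  have "L2_set (\<lambda>k. jap k powr r * cmod (d k)) K \<le> L2_set (\<lambda>k. M * (jap k powr s * cmod (c k))) K"
  proof (rule L2_set_mono)
    fix k
    have "jap k powr r * cmod (d k) \<le> jap k powr r * (M * jap k powr p * cmod (c k))"
      by (intro mult_left_mono le) auto
    also have "\<dots> = M * (jap k powr (r + p) * cmod (c k))"
      by (simp add: powr_add)
    also have "\<dots> \<le> M * (jap k powr s * cmod (c k))"
      using assms by (intro mult_left_mono mult_right_mono jap_powr_le) auto
    finally show "jap k powr r * cmod (d k) \<le> M * (jap k powr s * cmod (c k))" .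
  qed auto
  also have "\<dots> = M * L2_set (\<lambda>k. jap k powr s * cmod (c k)) K"
    using assms by (simp add: L2_set_right_distrib)
  also have "\<dots> \<le> M * B"
    using assms Sobolev_leD by (intro mult_left_mono) auto
  finally show "L2_set (\<lambda>k. jap k powr r * cmod (d k)) K \<le> M * B" .
qed

lemma Sobolev_le_weaken:
  assumes "Sobolev_le s A c" "r \<le> s" "A \<le> B"
  shows "Sobolev_le r B c"
proof -
  have "Sobolev_le r (1 * A) c"
    by (rule Sobolev_le_multiplier[where p = 0, OF assms(1)]) (use assms in auto)
  then show ?thesis using assms by (auto intro: Sobolev_le_mono)
qed

lemma Sobolev_le_dominated:
  assumes "Sobolev_le s B c" "\<And>k. cmod (d k) \<le> cmod (c k)"
  shows "Sobolev_le s B d"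
  using Sobolev_le_multiplier[OF assms(1), of 1 s 0 d] assms(2) by simp

lemma Sobolev_le_scale:
  assumes "Sobolev_le s B c"
  shows "Sobolev_le s (cmod z * B) (\<lambda>k. z * c k)"
  by (rule Sobolev_le_multiplier[where p = 0, OF assms]) (auto simp: norm_mult)

lemma Sobolev_le_add:
  assumes "Sobolev_le s A a" "Sobolev_le s B b"
  shows "Sobolev_le s (A + B) (\<lambda>k. a k + b k)"
proof (rule Sobolev_leI)
  show "0 \<le> A + B" using assms[THEN Sobolev_le_nonneg] by simp
  fix K :: "(int \<times> int) set" assume "finite K"
  have "L2_set (\<lambda>k. jap k powr s * cmod (a k + b k)) K
      \<le> L2_set (\<lambda>k. jap k powr s * cmod (a k) + jap k powr s * cmod (b k)) K"
    by (intro L2_set_mono) (auto simp: norm_triangle_ineq mult_left_mono simp flip: distrib_left)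
  also have "\<dots> \<le> L2_set (\<lambda>k. jap k powr s * cmod (a k)) K + L2_set (\<lambda>k. jap k powr s * cmod (b k)) K"
    by (rule L2_set_triangle_ineq)
  also have "\<dots> \<le> A + B"
    using assms by (intro add_mono Sobolev_leD)
  finally show "L2_set (\<lambda>k. jap k powr s * cmod (a k + b k)) K \<le> A + B" .
qed

lemma Sobolev_le_uminus: "Sobolev_le s B c \<Longrightarrow> Sobolev_le s B (\<lambda>k. - c k)"
  by (simp add: Sobolev_le_def)

lemma Sobolev_le_diff:
  assumes "Sobolev_le s A a" "Sobolev_le s B b"
  shows "Sobolev_le s (A + B) (\<lambda>k. a k - b k)"
  using Sobolev_le_add[OF assms(1) Sobolev_le_uminus[OF assms(2)]] by simp

lemma Sobolev_le_cong: "Sobolev_le s B a \<Longrightarrow> (\<And>k. a k = b k) \<Longrightarrow> Sobolev_le s B b"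
  by (simp add: Sobolev_le_def)

lemma Sobolev_le_reflect_cnj:
  assumes "Sobolev_le s B c"
  shows "Sobolev_le s B (\<lambda>k. cnj (c (- k)))"
proof (rule Sobolev_leI_sum)
  show "0 \<le> B" using assms by (rule Sobolev_le_nonneg)
  fix K :: "(int \<times> int) set" assume "finite K"
  have "(\<Sum>k\<in>K. (jap k powr s * cmod (cnj (c (- k))))\<^sup>2) = (\<Sum>k\<in>uminus ` K. (jap k powr s * cmod (c k))\<^sup>2)"
    by (subst sum.reindex) (auto simp: inj_on_def)
  then show "(\<Sum>k\<in>K. (jap k powr s * cmod (cnj (c (- k))))\<^sup>2) \<le> B\<^sup>2"
    using Sobolev_leD_sum[OF assms] by simp
qed

text \<open>Minkowski's inequality for integrals whose integrand is bounded in \<open>H\<^sup>s\<close>, with the integral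
  taken coefficientwise. The integral is tested against itself on a finite set of frequencies, so that only integrals of
  coefficients occur and not the integral of the norm.\<close>

lemma Sobolev_le_integral:
  assumes "a \<le> b" and int: "\<And>k. (\<lambda>r. F r k) integrable_on {a..b}"
    and bd: "\<And>r. r \<in> {a..b} \<Longrightarrow> Sobolev_le s B (F r)"
  shows "Sobolev_le s ((b - a) * B) (\<lambda>k. integral {a..b} (\<lambda>r. F r k))"
proof (rule Sobolev_leI)
  have "0 \<le> B" using bd[of a] assms(1) Sobolev_le_nonneg by auto
  then show nn: "0 \<le> (b - a) * B" using assms by auto
  fix K :: "(int \<times> int) set" assume K: "finite K"
  define I where "I = (\<lambda>k. integral {a..b} (\<lambda>r. F r k))"
  define N where "N = L2_set (\<lambda>k. jap k powr s * cmod (I k)) K"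
  define w where "w = (\<lambda>k. complex_of_real ((jap k powr s)\<^sup>2) * cnj (I k))"
  have "((\<lambda>r. \<Sum>k\<in>K. w k * F r k) has_integral (\<Sum>k\<in>K. w k * I k)) {a..b}"
    unfolding I_def using int
    by (intro has_integral_sum[OF K] has_integral_mult_right integrable_integral) auto
  moreover have "(\<Sum>k\<in>K. w k * I k) = complex_of_real (N\<^sup>2)"
    unfolding N_def L2_set_def w_def
    by (subst real_sqrt_pow2)
       (auto intro!: sum_nonneg sum.cong simp: power_mult_distrib complex_norm_square mult_ac
          simp del: of_real_power simp flip: of_real_power)
  moreover have "cmod (\<Sum>k\<in>K. w k * F r k) \<le> N * B" if "r \<in> {a..b}" for r
  proof -
    have "cmod (\<Sum>k\<in>K. w k * F r k) \<le> (\<Sum>k\<in>K. cmod (w k * F r k))"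
      by (rule norm_sum)
    also have "\<dots> = (\<Sum>k\<in>K. \<bar>jap k powr s * cmod (I k)\<bar> * \<bar>jap k powr s * cmod (F r k)\<bar>)"
      by (intro sum.cong) (auto simp: w_def norm_mult abs_mult power2_eq_square)
    also have "\<dots> \<le> N * L2_set (\<lambda>k. jap k powr s * cmod (F r k)) K"
      unfolding N_def by (rule L2_set_mult_ineq)
    also have "\<dots> \<le> N * B"
      using Sobolev_leD[OF bd[OF that]] by (intro mult_left_mono) (auto simp: N_def)
    finally show ?thesis .
  qed
  moreover have "0 \<le> N * B" using \<open>0 \<le> B\<close> by (simp add: N_def)
  ultimately have "cmod (complex_of_real (N\<^sup>2)) \<le> (N * B) * measure lborel {a..b}"
    using has_integral_bound[where a = a and b = b and B = "N * B" and f = "\<lambda>r. \<Sum>k\<in>K. w k * F r k"]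
    by (auto simp: box_real)
  then have "N * N \<le> N * ((b - a) * B)"
    using assms by (simp add: power2_eq_square mult_ac norm_mult)
  moreover have "0 \<le> N" by (simp add: N_def)
  ultimately have "N \<le> (b - a) * B"
    using nn by (cases "N = 0") (auto simp: mult_le_cancel_left_pos)
  then show "L2_set (\<lambda>k. jap k powr s * cmod (integral {a..b} (\<lambda>r. F r k))) K \<le> (b - a) * B"
    by (simp add: N_def I_def)
qed

section \<open>Products in Sobolev spaces\<close>

lemma sum_powr_nat_le:
  fixes y :: real
  assumes "0 < y" "y \<le> 1"
  shows "(\<Sum>p = 1..n. real p powr (y - 1)) \<le> real n powr y / y"
proof (induction n)
  case (Suc n)
  have "real (Suc n) powr (y - 1) \<le> real (Suc n) powr y / y - real n powr y / y"
  proof (cases "n = 0")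
    case True
    then show ?thesis using assms by simp
  next
    case False
    have "\<exists>z. real n < z \<and> z < real (Suc n) \<and>
        real (Suc n) powr y / y - real n powr y / y = (real (Suc n) - real n) * z powr (y - 1)"
      by (rule MVT2) (use False assms in \<open>auto intro!: derivative_eq_intros simp: powr_diff\<close>)
    then obtain z where z: "real n < z" "z < real (Suc n)"
      "real (Suc n) powr y / y - real n powr y / y = z powr (y - 1)"
      by auto
    have "real (Suc n) powr (y - 1) \<le> z powr (y - 1)"
      using z assms False by (intro powr_mono2') auto
    then show ?thesis using z by simp
  qed
  then show ?case using Suc by simp
qed simp

lemma sum_symmetric_int:
  fixes f :: "real \<Rightarrow> real"
  shows "(\<Sum>p = - int n..int n. f \<bar>real_of_int p\<bar>) = f 0 + 2 * (\<Sum>p = 1..n. f (real p))"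
proof (induction n)
  case (Suc n)
  have "{- int (Suc n)..int (Suc n)} = insert (- int (Suc n)) (insert (int (Suc n)) {- int n..int n})"
    by auto
  then show ?case using Suc by (simp add: add.commute)
qed simp

text \<open>Since \<open>jap (p, q)\<close> dominates both \<open>max 1 \<bar>p\<bar>\<close> and \<open>max 1 \<bar>q\<bar>\<close>, a negative power of it is at most
  a product of functions of \<open>p\<close> and of \<open>q\<close>; this reduces lattice sums to one-dimensional ones.\<close>

lemma sum_jap_powr_le_square:
  fixes x :: real
  assumes "0 \<le> x" "finite L" and L: "\<And>l. l \<in> L \<Longrightarrow> jap l \<le> real n + 1"
  shows "(\<Sum>l\<in>L. jap l powr (- 2 * x)) \<le> (1 + 2 * (\<Sum>p = 1..n. real p powr - x))\<^sup>2"
proof -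
  define f where "f = (\<lambda>r::real. max 1 r powr - x)"
  define g where "g = (\<lambda>p::int. f \<bar>real_of_int p\<bar>)"
  have sub: "L \<subseteq> {- int n..int n} \<times> {- int n..int n}"
  proof
    fix l assume "l \<in> L"
    have "1 + (real_of_int (fst l))\<^sup>2 + (real_of_int (snd l))\<^sup>2 \<le> (real n + 1)\<^sup>2"
      using L[OF \<open>l \<in> L\<close>] unfolding jap_def by (rule sqrt_le_D)
    then have "(real_of_int (fst l))\<^sup>2 < (real n + 1)\<^sup>2" "(real_of_int (snd l))\<^sup>2 < (real n + 1)\<^sup>2"
      by (smt (verit) zero_le_power2)+
    then have "\<bar>real_of_int (fst l)\<bar> < real n + 1" "\<bar>real_of_int (snd l)\<bar> < real n + 1"
      using power2_less_imp_less[of "\<bar>real_of_int (fst l)\<bar>"] power2_less_imp_less[of "\<bar>real_of_int (snd l)\<bar>"]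
      by auto
    then show "l \<in> {- int n..int n} \<times> {- int n..int n}"
      by (cases l) (auto simp: abs_less_iff; linarith)
  qed
  have le: "jap l powr (- 2 * x) \<le> g (fst l) * g (snd l)" for l
  proof -
    have "max 1 \<bar>real_of_int (fst l)\<bar> \<le> jap l" "max 1 \<bar>real_of_int (snd l)\<bar> \<le> jap l"
      using jap_ge_1[of l] by (auto simp: jap_def intro!: real_le_rsqrt)
    then have "jap l powr - x \<le> g (fst l)" "jap l powr - x \<le> g (snd l)"
      unfolding g_def f_def using assms by (auto intro!: powr_mono2')
    then have "jap l powr - x * jap l powr - x \<le> g (fst l) * g (snd l)"
      by (intro mult_mono) (auto simp: g_def f_def)
    then show ?thesis by (simp flip: powr_add)
  qed
  have "(\<Sum>l\<in>L. jap l powr (- 2 * x)) \<le> (\<Sum>l\<in>L. g (fst l) * g (snd l))"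
    by (intro sum_mono le)
  also have "\<dots> \<le> (\<Sum>l\<in>{- int n..int n} \<times> {- int n..int n}. g (fst l) * g (snd l))"
    using sub by (intro sum_mono2) (auto simp: g_def f_def)
  also have "\<dots> = (\<Sum>p = - int n..int n. g p)\<^sup>2"
    by (simp add: power2_eq_square sum_product sum.cartesian_product case_prod_beta)
  also have "(\<Sum>p = - int n..int n. g p) = 1 + 2 * (\<Sum>p = 1..n. f (real p))"
    unfolding g_def by (subst sum_symmetric_int) (simp add: f_def)
  also have "(\<Sum>p = 1..n. f (real p)) = (\<Sum>p = 1..n. real p powr - x)"
    by (intro sum.cong) (auto simp: f_def max_def)
  finally show ?thesis .
qed

text \<open>The two-dimensional lattice sum: the borderline power \<open>x = 1 - y\<close> loses \<open>N\<close> to the power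
  \<open>2 * y\<close> as soon as \<open>y > 0\<close>, and for \<open>y = 0\<close> a power beyond the borderline is summable.\<close>

lemma sum_jap_powr_le:
  fixes x y :: real
  assumes "x + y \<ge> 1" "y \<ge> 0" "y = 0 \<Longrightarrow> x > 1"
  obtains C where "C > 0" 
    "\<And>N L. \<lbrakk>1 \<le> N; finite L; \<And>l. l \<in> L \<Longrightarrow> jap l \<le> N\<rbrakk> \<Longrightarrow>
       (\<Sum>l\<in>L. jap l powr (- 2 * x)) \<le> C * N powr (2 * y)"
proof (cases "y = 0")
  case True
  with assms have x: "x > 1" by simp
  define S where "S = (\<Sum>p. real p powr - x)"
  have sm: "summable (\<lambda>p. real p powr - x)"
    using x by (simp add: summable_real_powr_iff)
  have S: "(\<Sum>p = 1..n. real p powr - x) \<le> S" for n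
    unfolding S_def by (rule sum_le_suminf[OF sm]) auto
  have S0: "0 \<le> S" using S[of 0] by simp
  show thesis
  proof
    show "(1 + 2 * S)\<^sup>2 > 0" using S0 by simp
    fix N :: real and L :: "(int \<times> int) set" 
    assume L: "1 \<le> N" "finite L" "\<And>l. l \<in> L \<Longrightarrow> jap l \<le> N"
    have "(\<Sum>l\<in>L. jap l powr (- 2 * x)) \<le> (1 + 2 * (\<Sum>p = 1..nat \<lfloor>N\<rfloor>. real p powr - x))\<^sup>2"
    proof (rule sum_jap_powr_le_square)
      show "jap l \<le> real (nat \<lfloor>N\<rfloor>) + 1" if "l \<in> L" for l
        using L(1) L(3)[OF that] by linarith
    qed (use L x in auto)
    also have "\<dots> \<le> (1 + 2 * S)\<^sup>2"
      using S by (intro power_mono) (auto intro!: add_nonneg_nonneg sum_nonneg)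
    finally show "(\<Sum>l\<in>L. jap l powr (- 2 * x)) \<le> (1 + 2 * S)\<^sup>2 * N powr (2 * y)"
      using True L by simp
  qed
next
  case False
  then have y: "y > 0" using assms by simp
  define z where "z = min y (1/2)"
  have z: "0 < z" "z \<le> 1/2" "z \<le> y" using y by (auto simp: z_def)
  show thesis
  proof
    show "(1 + 2 / z)\<^sup>2 > 0" using z by (intro zero_less_power add_pos_pos) auto
    fix N :: real and L :: "(int \<times> int) set" 
    assume L: "1 \<le> N" "finite L" "\<And>l. l \<in> L \<Longrightarrow> jap l \<le> N"
    have "jap l powr (- 2 * x) \<le> N powr (2 * (y - z)) * jap l powr (- 2 * (1 - z))" if "l \<in> L" for l
    proof -
      have "jap l powr (- 2 * x) \<le> jap l powr (2 * (y - z) + (- 2 * (1 - z)))"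
        using assms by (intro jap_powr_le) simp
      also have "\<dots> = jap l powr (2 * (y - z)) * jap l powr (- 2 * (1 - z))"
        by (rule powr_add)
      also have "\<dots> \<le> N powr (2 * (y - z)) * jap l powr (- 2 * (1 - z))"
        using z L that by (intro mult_right_mono powr_mono2) auto
      finally show ?thesis .
    qed
    then have "(\<Sum>l\<in>L. jap l powr (- 2 * x)) \<le> N powr (2 * (y - z)) * (\<Sum>l\<in>L. jap l powr (- 2 * (1 - z)))"
      unfolding sum_distrib_left by (intro sum_mono)
    also have "(\<Sum>l\<in>L. jap l powr (- 2 * (1 - z))) \<le> (1 + 2 * (\<Sum>p = 1..nat \<lfloor>N\<rfloor>. real p powr - (1 - z)))\<^sup>2"
    proof (rule sum_jap_powr_le_square)
      show "jap l \<le> real (nat \<lfloor>N\<rfloor>) + 1" if "l \<in> L" for l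
        using L(1) L(3)[OF that] by linarith
    qed (use L z in auto)
    also have "\<dots> \<le> ((1 + 2 / z) * N powr z)\<^sup>2"
    proof (intro power_mono)
      have "(\<Sum>p = 1..nat \<lfloor>N\<rfloor>. real p powr - (1 - z)) \<le> real (nat \<lfloor>N\<rfloor>) powr z / z"
        using sum_powr_nat_le[of z "nat \<lfloor>N\<rfloor>"] z by simp
      also have "\<dots> \<le> N powr z / z"
        using z L by (intro divide_right_mono powr_mono2) (auto simp: of_nat_nat)
      finally have "1 + 2 * (\<Sum>p = 1..nat \<lfloor>N\<rfloor>. real p powr - (1 - z)) \<le> N powr z + 2 * (N powr z / z)"
        using z L by (intro add_mono mult_left_mono) (auto simp: ge_one_powr_ge_zero)
      then show "1 + 2 * (\<Sum>p = 1..nat \<lfloor>N\<rfloor>. real p powr - (1 - z)) \<le> (1 + 2 / z) * N powr z"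
        by (simp add: algebra_simps)
      show "0 \<le> 1 + 2 * (\<Sum>p = 1..nat \<lfloor>N\<rfloor>. real p powr - (1 - z))"
        by (intro add_nonneg_nonneg mult_nonneg_nonneg sum_nonneg) auto
    qed
    also have "N powr (2 * (y - z)) * ((1 + 2 / z) * N powr z)\<^sup>2 
        = (1 + 2 / z)\<^sup>2 * (N powr (2 * (y - z)) * (N powr z * N powr z))"
      by (simp add: power2_eq_square mult_ac)
    also have "N powr (2 * (y - z)) * (N powr z * N powr z) = N powr (2 * y)"
      by (simp add: algebra_simps flip: powr_add)
    finally show "(\<Sum>l\<in>L. jap l powr (- 2 * x)) \<le> (1 + 2 / z)\<^sup>2 * N powr (2 * y)"
      by (simp add: mult_left_mono)
  qed
qed

text \<open>The coefficients of the product of two functions.\<close>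

definition conv :: "torus_dist \<Rightarrow> torus_dist \<Rightarrow> torus_dist" where
  "conv a b = (\<lambda>k. \<Sum>\<^sub>\<infinity>l. a l * b (k - l))"

lemma powr_comparable:
  fixes m n t :: real
  assumes "0 < m" "0 < n" "m \<le> 2 * n" "n \<le> 2 * m"
  shows "m powr t \<le> 2 powr \<bar>t\<bar> * n powr t"
proof (cases "t \<ge> 0")
  case True
  then have "m powr t \<le> (2 * n) powr t"
    using assms by (intro powr_mono2) auto
  then show ?thesis using True assms by (simp add: powr_mult)
next
  case False
  then have "m powr t \<le> (n / 2) powr t"
    using assms by (intro powr_mono2') auto
  then show ?thesis using False assms by (simp add: powr_divide powr_minus_divide)
qed

text \<open>In a frequency interaction \<open>k = l + (k - l)\<close> the two larger brackets are comparable. If the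
  output frequency \<open>k\<close> is the smallest, the weight is square summable in \<open>k\<close> uniformly in \<open>l\<close>;
  otherwise it is square summable in \<open>l\<close> uniformly in \<open>k\<close>. In both cases the Cauchy-Schwarz
  inequality, applied with the weight on the appropriate factor, closes the estimate, also on the
  critical line \<open>\<alpha> + \<beta> + \<gamma> = 1\<close>.\<close>

lemma product_estimate_finite:
  fixes \<alpha> \<beta> \<gamma> :: real
  assumes sum1: "\<alpha> + \<beta> + \<gamma> \<ge> 1"
    and ab: "\<alpha> + \<beta> \<ge> 0" "\<alpha> + \<beta> = 0 \<Longrightarrow> \<gamma> > 1"
    and ag: "\<alpha> + \<gamma> \<ge> 0" "\<alpha> + \<gamma> = 0 \<Longrightarrow> \<beta> > 1"
    and bg: "\<beta> + \<gamma> \<ge> 0" "\<beta> + \<gamma> = 0 \<Longrightarrow> \<alpha> > 1"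
  obtains C where "C > 0"
    "\<And>A B a b K L. \<lbrakk>Sobolev_le \<alpha> A a; Sobolev_le \<beta> B b; finite K; finite L\<rbrakk> \<Longrightarrow>
       (\<Sum>k\<in>K. (jap k powr - \<gamma> * (\<Sum>l\<in>L. cmod (a l) * cmod (b (k - l))))\<^sup>2) \<le> (C * A * B)\<^sup>2"
proof -
  obtain C1 where C1: "C1 > 0"
    "\<And>N L. \<lbrakk>1 \<le> N; finite L; \<And>l. l \<in> L \<Longrightarrow> jap l \<le> N\<rbrakk> \<Longrightarrow> 
       (\<Sum>l\<in>L. jap l powr (- 2 * \<alpha>)) \<le> C1 * N powr (2 * (\<beta> + \<gamma>))"
    using sum_jap_powr_le[of \<alpha> "\<beta> + \<gamma>"] sum1 bg by (auto simp: add_ac)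
  obtain C2 where C2: "C2 > 0"
    "\<And>N L. \<lbrakk>1 \<le> N; finite L; \<And>l. l \<in> L \<Longrightarrow> jap l \<le> N\<rbrakk> \<Longrightarrow> 
       (\<Sum>l\<in>L. jap l powr (- 2 * \<beta>)) \<le> C2 * N powr (2 * (\<alpha> + \<gamma>))"
    using sum_jap_powr_le[of \<beta> "\<alpha> + \<gamma>"] sum1 ag by (auto simp: add_ac)
  obtain C3 where C3: "C3 > 0"
    "\<And>N L. \<lbrakk>1 \<le> N; finite L; \<And>l. l \<in> L \<Longrightarrow> jap l \<le> N\<rbrakk> \<Longrightarrow> 
       (\<Sum>l\<in>L. jap l powr (- 2 * \<gamma>)) \<le> C3 * N powr (2 * (\<alpha> + \<beta>))"
    using sum_jap_powr_le[of \<gamma> "\<alpha> + \<beta>"] sum1 ab by (auto simp: add_ac)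
  define W where "W = (\<lambda>k l. jap l powr - \<alpha> * jap (k - l) powr - \<beta> * jap k powr - \<gamma>)"
  define R where "R = (\<lambda>k l. jap k \<le> jap l \<and> jap k \<le> jap (k - l))"
  define D where "D = (2::real) powr (\<bar>\<alpha>\<bar> + \<bar>\<beta>\<bar>)"
  have D: "D > 0" "2 powr \<bar>\<alpha>\<bar> \<le> D" "2 powr \<bar>\<beta>\<bar> \<le> D"
    by (auto simp: D_def)
  have tri: "jap k \<le> jap l + jap (k - l)" "jap l \<le> jap k + jap (k - l)" "jap (k - l) \<le> jap k + jap l" for k l
    using jap_add[of l "k - l"] jap_add[of k "- (k - l)"] jap_add[of k "- l"]
    by (auto simp del: minus_diff_eq simp add: jap_minus)
  have sq: "(jap k powr - x)\<^sup>2 = jap k powr (- 2 * x)" for k x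
    by (simp add: power2_eq_square flip: powr_add)
  have sq': "(D * jap l powr - x * jap k powr - y)\<^sup>2 = D\<^sup>2 * jap l powr (- 2 * x) * jap k powr (- (2 * y))" for x y k l
    by (simp add: power_mult_distrib sq)
  have cancel: "D\<^sup>2 * (c * jap k powr z) * jap k powr (- z) = D\<^sup>2 * c" for c k z
    by (simp flip: powr_add)
  have W0: "0 \<le> W k l" for k l by (simp add: W_def)
  \<comment> \<open>The weight is bounded in each of the three regions, named after the smallest frequency.\<close>
  have Wl: "(W k l)\<^sup>2 \<le> D\<^sup>2 * jap l powr (- 2 * \<alpha>) * jap k powr (- (2 * (\<beta> + \<gamma>)))"
    if "jap l \<le> jap k" "jap l \<le> jap (k - l)" for k l
  proof -
    have "jap (k - l) powr - \<beta> \<le> 2 powr \<bar>- \<beta>\<bar> * jap k powr - \<beta>"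
      by (rule powr_comparable) (use tri[where k = k and l = l] that in auto)
    also have "\<dots> \<le> D * jap k powr - \<beta>" using D by (intro mult_right_mono) auto
    finally have "W k l \<le> jap l powr - \<alpha> * (D * jap k powr - \<beta>) * jap k powr - \<gamma>"
      unfolding W_def by (intro mult_right_mono mult_left_mono) auto
    also have "\<dots> = D * jap l powr - \<alpha> * jap k powr - (\<beta> + \<gamma>)"
      by (simp add: powr_add powr_diff powr_minus field_simps)
    finally show ?thesis using power_mono[OF _ W0, of k l _ 2] sq' by metis
  qed
  have Wkl: "(W k l)\<^sup>2 \<le> D\<^sup>2 * jap (k - l) powr (- 2 * \<beta>) * jap k powr (- (2 * (\<alpha> + \<gamma>)))"
    if "jap (k - l) \<le> jap k" "jap (k - l) \<le> jap l" for k l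
  proof -
    have "jap l powr - \<alpha> \<le> 2 powr \<bar>- \<alpha>\<bar> * jap k powr - \<alpha>"
      by (rule powr_comparable) (use tri[where k = k and l = l] that in auto)
    also have "\<dots> \<le> D * jap k powr - \<alpha>" using D by (intro mult_right_mono) auto
    finally have "W k l \<le> (D * jap k powr - \<alpha>) * jap (k - l) powr - \<beta> * jap k powr - \<gamma>"
      unfolding W_def by (intro mult_right_mono) auto
    also have "\<dots> = D * jap (k - l) powr - \<beta> * jap k powr - (\<alpha> + \<gamma>)"
      by (simp add: powr_add powr_diff powr_minus field_simps)
    finally show ?thesis using power_mono[OF _ W0, of k l _ 2] sq' by metis
  qed
  have Wk: "(W k l)\<^sup>2 \<le> D\<^sup>2 * jap k powr (- 2 * \<gamma>) * jap l powr (- (2 * (\<alpha> + \<beta>)))"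
    if "R k l" for k l
  proof -
    have "jap (k - l) powr - \<beta> \<le> 2 powr \<bar>- \<beta>\<bar> * jap l powr - \<beta>"
      by (rule powr_comparable) (use tri[where k = k and l = l] that in \<open>auto simp: R_def\<close>)
    also have "\<dots> \<le> D * jap l powr - \<beta>" using D by (intro mult_right_mono) auto
    finally have "W k l \<le> jap l powr - \<alpha> * (D * jap l powr - \<beta>) * jap k powr - \<gamma>"
      unfolding W_def by (intro mult_right_mono mult_left_mono) auto
    also have "\<dots> = D * jap k powr - \<gamma> * jap l powr - (\<alpha> + \<beta>)"
      by (simp add: powr_add powr_diff powr_minus field_simps)
    finally show ?thesis using power_mono[OF _ W0, of k l _ 2] sq' by metis
  qed
  have S3: "(\<Sum>k\<in>{k\<in>K. R k l}. (W k l)\<^sup>2) \<le> D\<^sup>2 * C3" if K: "finite K" for K l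
  proof -
    have "(\<Sum>k\<in>{k\<in>K. R k l}. (W k l)\<^sup>2) 
        \<le> (\<Sum>k\<in>{k\<in>K. R k l}. D\<^sup>2 * jap k powr (- 2 * \<gamma>) * jap l powr (- (2 * (\<alpha> + \<beta>))))"
      by (intro sum_mono Wk) simp
    also have "\<dots> = D\<^sup>2 * (\<Sum>k\<in>{k\<in>K. R k l}. jap k powr (- 2 * \<gamma>)) * jap l powr (- (2 * (\<alpha> + \<beta>)))"
      by (simp add: sum_distrib_left sum_distrib_right)
    also have "\<dots> \<le> D\<^sup>2 * (C3 * jap l powr (2 * (\<alpha> + \<beta>))) * jap l powr (- (2 * (\<alpha> + \<beta>)))"
      using K D by (intro mult_right_mono mult_left_mono C3 jap_ge_1) (auto simp: R_def)
    finally show ?thesis by (simp only: cancel)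
  qed
  have S12: "(\<Sum>l\<in>{l\<in>L. \<not> R k l}. (W k l)\<^sup>2) \<le> D\<^sup>2 * (C1 + C2)" if L: "finite L" for L k
  proof -
    let ?L1 = "{l\<in>L. jap l \<le> jap k \<and> jap l \<le> jap (k - l)}"
    let ?L2 = "{l\<in>L. jap (k - l) \<le> jap k \<and> jap (k - l) \<le> jap l}"
    have "(\<Sum>l\<in>{l\<in>L. \<not> R k l}. (W k l)\<^sup>2) \<le> (\<Sum>l\<in>?L1 \<union> ?L2. (W k l)\<^sup>2)"
      by (intro sum_mono2) (use L in \<open>auto simp: R_def\<close>)
    also have "\<dots> \<le> (\<Sum>l\<in>?L1. (W k l)\<^sup>2) + (\<Sum>l\<in>?L2. (W k l)\<^sup>2)"
      by (subst sum.union_inter[symmetric]) (use L in \<open>auto intro!: sum_nonneg\<close>)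
    also have "(\<Sum>l\<in>?L1. (W k l)\<^sup>2) \<le> D\<^sup>2 * C1"
    proof -
      have "(\<Sum>l\<in>?L1. (W k l)\<^sup>2) \<le> (\<Sum>l\<in>?L1. D\<^sup>2 * jap l powr (- 2 * \<alpha>) * jap k powr (- (2 * (\<beta> + \<gamma>))))"
        by (intro sum_mono Wl) auto
      also have "\<dots> = D\<^sup>2 * (\<Sum>l\<in>?L1. jap l powr (- 2 * \<alpha>)) * jap k powr (- (2 * (\<beta> + \<gamma>)))"
        by (simp add: sum_distrib_left sum_distrib_right)
      also have "\<dots> \<le> D\<^sup>2 * (C1 * jap k powr (2 * (\<beta> + \<gamma>))) * jap k powr (- (2 * (\<beta> + \<gamma>)))"
        using L D by (intro mult_right_mono mult_left_mono C1 jap_ge_1) auto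
      finally show ?thesis by (simp only: cancel)
    qed
    also have "(\<Sum>l\<in>?L2. (W k l)\<^sup>2) \<le> D\<^sup>2 * C2"
    proof -
      have "(\<Sum>l\<in>?L2. (W k l)\<^sup>2) \<le> (\<Sum>l\<in>?L2. D\<^sup>2 * jap (k - l) powr (- 2 * \<beta>) * jap k powr (- (2 * (\<alpha> + \<gamma>))))"
        by (intro sum_mono Wkl) auto
      also have "\<dots> = D\<^sup>2 * (\<Sum>l\<in>?L2. jap (k - l) powr (- 2 * \<beta>)) * jap k powr (- (2 * (\<alpha> + \<gamma>)))"
        by (simp add: sum_distrib_left sum_distrib_right)
      also have "(\<Sum>l\<in>?L2. jap (k - l) powr (- 2 * \<beta>)) = (\<Sum>l\<in>(\<lambda>l. k - l) ` ?L2. jap l powr (- 2 * \<beta>))"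
        by (subst sum.reindex) (auto simp: inj_on_def)
      also have "D\<^sup>2 * \<dots> * jap k powr (- (2 * (\<alpha> + \<gamma>)))
          \<le> D\<^sup>2 * (C2 * jap k powr (2 * (\<alpha> + \<gamma>))) * jap k powr (- (2 * (\<alpha> + \<gamma>)))"
        using L D by (intro mult_right_mono mult_left_mono C2 jap_ge_1) auto
      finally show ?thesis by (simp only: cancel)
    qed
    finally show ?thesis by (simp add: distrib_left)
  qed
  define C where "C = sqrt (2 * (D\<^sup>2 * (C1 + C2)) + 2 * (D\<^sup>2 * C3))"
  have Cpos: "2 * (D\<^sup>2 * (C1 + C2)) + 2 * (D\<^sup>2 * C3) > 0"
    using D C1(1) C2(1) C3(1) by (intro add_pos_pos mult_pos_pos) auto
  show thesis
  proof (rule that[of C])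
    show "C > 0" using Cpos by (simp add: C_def)
    fix A B a b and K L :: "(int \<times> int) set"
    assume a: "Sobolev_le \<alpha> A a" and b: "Sobolev_le \<beta> B b" and K: "finite K" and L: "finite L"
    define F where "F = (\<lambda>l. jap l powr \<alpha> * cmod (a l))"
    define G where "G = (\<lambda>m. jap m powr \<beta> * cmod (b m))"
    have F: "(\<Sum>l\<in>X. (F l)\<^sup>2) \<le> A\<^sup>2" for X
      unfolding F_def by (rule Sobolev_leD_sum[OF a])
    have G: "(\<Sum>l\<in>X. (G l)\<^sup>2) \<le> B\<^sup>2" for X
      unfolding G_def by (rule Sobolev_leD_sum[OF b])
    have G1: "(\<Sum>l\<in>X. (G (k - l))\<^sup>2) \<le> B\<^sup>2" if "finite X" for X k
    proof -
      have "(\<Sum>l\<in>X. (G (k - l))\<^sup>2) = (\<Sum>l\<in>(\<lambda>l. k - l) ` X. (G l)\<^sup>2)"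
        by (subst sum.reindex) (auto simp: inj_on_def)
      then show ?thesis using G by simp
    qed
    have G2: "(\<Sum>k\<in>X. (G (k - l))\<^sup>2) \<le> B\<^sup>2" for X l
    proof -
      have "(\<Sum>k\<in>X. (G (k - l))\<^sup>2) = (\<Sum>k\<in>(\<lambda>k. k - l) ` X. (G k)\<^sup>2)"
        by (subst sum.reindex) (auto simp: inj_on_def)
      then show ?thesis using G by simp
    qed
    have FG: "(\<Sum>l\<in>L. (F l)\<^sup>2 * B\<^sup>2) \<le> A\<^sup>2 * B\<^sup>2"
      unfolding sum_distrib_right[symmetric] by (intro mult_right_mono F) auto
    define P where "P = (\<lambda>k. \<Sum>l\<in>{l\<in>L. \<not> R k l}. W k l * (F l * G (k - l)))"
    define Q where "Q = (\<lambda>k. \<Sum>l\<in>{l\<in>L. R k l}. W k l * F l * G (k - l))"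
    have split: "jap k powr - \<gamma> * (\<Sum>l\<in>L. cmod (a l) * cmod (b (k - l))) = P k + Q k" for k
    proof -
      have "jap k powr - \<gamma> * (\<Sum>l\<in>L. cmod (a l) * cmod (b (k - l))) = (\<Sum>l\<in>L. W k l * F l * G (k - l))"
        by (simp add: sum_distrib_left W_def F_def G_def powr_minus field_simps)
      also have "\<dots> = (\<Sum>l\<in>{l\<in>L. \<not> R k l} \<union> {l\<in>L. R k l}. W k l * F l * G (k - l))"
        by (intro sum.cong) auto
      also have "\<dots> = P k + Q k"
        unfolding P_def Q_def by (subst sum.union_disjoint) (use L in \<open>auto simp: mult.assoc\<close>)
      finally show ?thesis .
    qed
    have "(\<Sum>k\<in>K. (P k)\<^sup>2) \<le> (\<Sum>k\<in>K. D\<^sup>2 * (C1 + C2) * (\<Sum>l\<in>L. (F l)\<^sup>2 * (G (k - l))\<^sup>2))"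
    proof (rule sum_mono)
      fix k
      have "(P k)\<^sup>2 \<le> (\<Sum>l\<in>{l\<in>L. \<not> R k l}. (W k l)\<^sup>2) * (\<Sum>l\<in>{l\<in>L. \<not> R k l}. (F l * G (k - l))\<^sup>2)"
        unfolding P_def by (rule Cauchy_Schwarz_ineq_sum)
      also have "\<dots> \<le> D\<^sup>2 * (C1 + C2) * (\<Sum>l\<in>L. (F l * G (k - l))\<^sup>2)"
        using L D C1 C2 by (intro mult_mono S12 sum_mono2) (auto intro!: sum_nonneg)
      finally show "(P k)\<^sup>2 \<le> D\<^sup>2 * (C1 + C2) * (\<Sum>l\<in>L. (F l)\<^sup>2 * (G (k - l))\<^sup>2)"
        by (simp add: power_mult_distrib)
    qed
    also have "\<dots> = D\<^sup>2 * (C1 + C2) * (\<Sum>l\<in>L. (F l)\<^sup>2 * (\<Sum>k\<in>K. (G (k - l))\<^sup>2))"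
      unfolding sum_distrib_left[symmetric] by (subst sum.swap) (simp add: sum_distrib_left)
    also have "\<dots> \<le> D\<^sup>2 * (C1 + C2) * (\<Sum>l\<in>L. (F l)\<^sup>2 * B\<^sup>2)"
      using D C1 C2 by (intro mult_left_mono sum_mono G2) auto
    also have "\<dots> \<le> D\<^sup>2 * (C1 + C2) * (A\<^sup>2 * B\<^sup>2)"
      using D C1 C2 FG by (intro mult_left_mono) auto
    finally have P: "(\<Sum>k\<in>K. (P k)\<^sup>2) \<le> D\<^sup>2 * (C1 + C2) * (A\<^sup>2 * B\<^sup>2)" .
    have "(\<Sum>k\<in>K. (Q k)\<^sup>2) \<le> (\<Sum>k\<in>K. (\<Sum>l\<in>L. if R k l then (W k l)\<^sup>2 * (F l)\<^sup>2 else 0) * B\<^sup>2)"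
    proof (rule sum_mono)
      fix k
      have "(Q k)\<^sup>2 \<le> (\<Sum>l\<in>{l\<in>L. R k l}. (W k l * F l)\<^sup>2) * (\<Sum>l\<in>{l\<in>L. R k l}. (G (k - l))\<^sup>2)"
        unfolding Q_def by (rule Cauchy_Schwarz_ineq_sum)
      also have "\<dots> \<le> (\<Sum>l\<in>{l\<in>L. R k l}. (W k l * F l)\<^sup>2) * B\<^sup>2"
        using L by (intro mult_left_mono G1) (auto intro!: sum_nonneg)
      also have "(\<Sum>l\<in>{l\<in>L. R k l}. (W k l * F l)\<^sup>2) = (\<Sum>l\<in>L. if R k l then (W k l)\<^sup>2 * (F l)\<^sup>2 else 0)"
        using L by (simp add: sum.inter_filter power_mult_distrib)
      finally show "(Q k)\<^sup>2 \<le> (\<Sum>l\<in>L. if R k l then (W k l)\<^sup>2 * (F l)\<^sup>2 else 0) * B\<^sup>2" .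
    qed
    also have "\<dots> = (\<Sum>l\<in>L. (\<Sum>k\<in>K. if R k l then (W k l)\<^sup>2 * (F l)\<^sup>2 else 0)) * B\<^sup>2"
      unfolding sum_distrib_right[symmetric] by (subst sum.swap) simp
    also have "\<dots> = (\<Sum>l\<in>L. (\<Sum>k\<in>{k\<in>K. R k l}. (W k l)\<^sup>2) * (F l)\<^sup>2) * B\<^sup>2"
      using K by (simp add: sum.inter_filter[symmetric] sum_distrib_right)
    also have "\<dots> \<le> (\<Sum>l\<in>L. (D\<^sup>2 * C3) * (F l)\<^sup>2) * B\<^sup>2"
      using K by (intro mult_right_mono sum_mono S3) auto
    also have "\<dots> \<le> D\<^sup>2 * C3 * (A\<^sup>2 * B\<^sup>2)"
      unfolding sum_distrib_left[symmetric] mult.assoc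
      using D C3 by (intro mult_left_mono mult_right_mono F) auto
    finally have Q: "(\<Sum>k\<in>K. (Q k)\<^sup>2) \<le> D\<^sup>2 * C3 * (A\<^sup>2 * B\<^sup>2)" .
    have "(\<Sum>k\<in>K. (jap k powr - \<gamma> * (\<Sum>l\<in>L. cmod (a l) * cmod (b (k - l))))\<^sup>2) = (\<Sum>k\<in>K. (P k + Q k)\<^sup>2)"
      by (simp only: split)
    also have "\<dots> \<le> (\<Sum>k\<in>K. 2 * (P k)\<^sup>2 + 2 * (Q k)\<^sup>2)"
    proof (rule sum_mono)
      fix k show "(P k + Q k)\<^sup>2 \<le> 2 * (P k)\<^sup>2 + 2 * (Q k)\<^sup>2"
        using zero_le_power2[of "P k - Q k"] by (simp add: power2_eq_square algebra_simps)
    qed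
    also have "\<dots> = 2 * (\<Sum>k\<in>K. (P k)\<^sup>2) + 2 * (\<Sum>k\<in>K. (Q k)\<^sup>2)"
      by (simp add: sum.distrib sum_distrib_left)
    also have "\<dots> \<le> 2 * (D\<^sup>2 * (C1 + C2) * (A\<^sup>2 * B\<^sup>2)) + 2 * (D\<^sup>2 * C3 * (A\<^sup>2 * B\<^sup>2))"
      using P Q by simp
    also have "\<dots> = C\<^sup>2 * (A\<^sup>2 * B\<^sup>2)"
      unfolding C_def using Cpos by (simp add: algebra_simps)
    finally show "(\<Sum>k\<in>K. (jap k powr - \<gamma> * (\<Sum>l\<in>L. cmod (a l) * cmod (b (k - l))))\<^sup>2) \<le> (C * A * B)\<^sup>2"
      by (simp add: power_mult_distrib)
  qed
qed

text \<open>The Sobolev multiplication theorem on the two-dimensional torus, with \<open>H\<close> to the power \<open>- \<gamma>\<close> as the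
  target. The hypotheses treat \<open>\<alpha>\<close>, \<open>\<beta>\<close>, \<open>\<gamma>\<close> symmetrically because the statement is dual to the
  boundedness of a symmetric trilinear form. It follows from the bound for finite truncations, which yields the absolute
  convergence of the convolution and is then preserved in the limit.\<close>

theorem product_estimate:
  fixes \<alpha> \<beta> \<gamma> :: real
  assumes "\<alpha> + \<beta> + \<gamma> \<ge> 1"
    and "\<alpha> + \<beta> \<ge> 0" "\<alpha> + \<beta> = 0 \<Longrightarrow> \<gamma> > 1"
    and "\<alpha> + \<gamma> \<ge> 0" "\<alpha> + \<gamma> = 0 \<Longrightarrow> \<beta> > 1"
    and "\<beta> + \<gamma> \<ge> 0" "\<beta> + \<gamma> = 0 \<Longrightarrow> \<alpha> > 1"
  obtains C where "C > 0"
    "\<And>A B a b. \<lbrakk>Sobolev_le \<alpha> A a; Sobolev_le \<beta> B b\<rbrakk> \<Longrightarrow> Sobolev_le (- \<gamma>) (C * A * B) (conv a b)"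
proof -
  obtain C where C: "C > 0"
    "\<And>A B a b K L. \<lbrakk>Sobolev_le \<alpha> A a; Sobolev_le \<beta> B b; finite K; finite L\<rbrakk> \<Longrightarrow>
       (\<Sum>k\<in>K. (jap k powr - \<gamma> * (\<Sum>l\<in>L. cmod (a l) * cmod (b (k - l))))\<^sup>2) \<le> (C * A * B)\<^sup>2"
    using product_estimate_finite[OF assms] by blast
  show thesis
  proof (rule that[OF C(1)])
    fix A B a b assume ab: "Sobolev_le \<alpha> A a" "Sobolev_le \<beta> B b"
    have CAB: "0 \<le> C * A * B" using C ab[THEN Sobolev_le_nonneg] by simp
    have summable: "(\<lambda>l. cmod (a l) * cmod (b (k - l))) summable_on UNIV" for k
    proof (rule nonneg_bdd_above_summable_on)
      show "bdd_above (sum (\<lambda>l. cmod (a l) * cmod (b (k - l))) ` {F. F \<subseteq> UNIV \<and> finite F})"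
      proof (rule bdd_aboveI2[where M = "C * A * B * jap k powr \<gamma>"], clarify)
        fix F :: "(int \<times> int) set" assume "finite F"
        then have "(jap k powr - \<gamma> * (\<Sum>l\<in>F. cmod (a l) * cmod (b (k - l))))\<^sup>2 \<le> (C * A * B)\<^sup>2"
          using C(2)[OF ab, of "{k}" F] by simp
        then have "jap k powr - \<gamma> * (\<Sum>l\<in>F. cmod (a l) * cmod (b (k - l))) \<le> C * A * B"
          using CAB by (rule power2_le_imp_le)
        then have "jap k powr - \<gamma> * (\<Sum>l\<in>F. cmod (a l) * cmod (b (k - l))) * jap k powr \<gamma> \<le> C * A * B * jap k powr \<gamma>"
          by (intro mult_right_mono) auto
        then show "(\<Sum>l\<in>F. cmod (a l) * cmod (b (k - l))) \<le> C * A * B * jap k powr \<gamma>"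
          by (simp add: powr_minus field_simps)
      qed
    qed auto
    show "Sobolev_le (- \<gamma>) (C * A * B) (conv a b)"
    proof (rule Sobolev_leI_sum[OF CAB])
      fix K :: "(int \<times> int) set" assume K: "finite K"
      let ?S = "\<lambda>k. \<Sum>\<^sub>\<infinity>l. cmod (a l) * cmod (b (k - l))"
      have "cmod (conv a b k) \<le> ?S k" for k
        unfolding conv_def using norm_infsum_bound[of "\<lambda>l. a l * b (k - l)" UNIV] summable[of k]
        by (simp add: norm_mult)
      then have "(\<Sum>k\<in>K. (jap k powr - \<gamma> * cmod (conv a b k))\<^sup>2) \<le> (\<Sum>k\<in>K. (jap k powr - \<gamma> * ?S k)\<^sup>2)"
        by (intro sum_mono power_mono mult_left_mono) auto
      also have "\<dots> \<le> (C * A * B)\<^sup>2"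
      proof (rule tendsto_upperbound)
        show "((\<lambda>F. \<Sum>k\<in>K. (jap k powr - \<gamma> * (\<Sum>l\<in>F. cmod (a l) * cmod (b (k - l))))\<^sup>2)
            \<longlongrightarrow> (\<Sum>k\<in>K. (jap k powr - \<gamma> * ?S k)\<^sup>2)) (finite_subsets_at_top UNIV)"
          by (intro tendsto_sum tendsto_power tendsto_mult tendsto_const infsum_tendsto summable)
        show "\<forall>\<^sub>F F in finite_subsets_at_top UNIV. 
            (\<Sum>k\<in>K. (jap k powr - \<gamma> * (\<Sum>l\<in>F. cmod (a l) * cmod (b (k - l))))\<^sup>2) \<le> (C * A * B)\<^sup>2"
          by (rule eventually_finite_subsets_at_top_weakI) (use C(2)[OF ab K] in auto)
      qed simp
      finally show "(\<Sum>k\<in>K. (jap k powr - \<gamma> * cmod (conv a b k))\<^sup>2) \<le> (C * A * B)\<^sup>2" .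
    qed
  qed
qed

section \<open>Fourier coefficients determine an integrable function\<close>

text \<open>Orthogonal, but not normalized: the integral of \<open>\<bar>character k\<bar>\<^sup>2\<close> is \<open>(2 * pi)\<^sup>2\<close>.\<close>

definition character :: "int \<times> int \<Rightarrow> real \<times> real \<Rightarrow> complex" where
  "character k x = exp (\<i> * complex_of_real (real_of_int (fst k) * fst x + real_of_int (snd k) * snd x))"

lemma character_cis: "character k x = cis (real_of_int (fst k) * fst x + real_of_int (snd k) * snd x)"
  by (simp add: character_def cis_conv_exp)

lemma norm_character [simp]: "cmod (character k x) = 1"
  by (simp add: character_cis)

lemma character_add: "character (k + l) x = character k x * character l x"
  by (simp add: character_cis cis_mult algebra_simps)

lemma character_0 [simp]: "character 0 x = 1"
  by (simp add: character_cis)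

lemma character_minus: "character (- k) x = cnj (character k x)"
  by (simp add: character_cis cis_cnj)

lemma space_torus: "space torus = {0..<2 * pi} \<times> {0..<2 * pi}"
  by (simp add: torus_def space_restrict_space)

lemma fundamental_domain_borel [measurable]: "{0..<2 * pi} \<times> {0..<2 * pi} \<in> sets (borel :: (real \<times> real) measure)"
  by (intro borel_Times) auto

lemma borel_measurable_torus: 
  "f \<in> borel_measurable borel \<Longrightarrow> f \<in> borel_measurable torus"
  unfolding torus_def by (intro measurable_restrict_space1) simp

lemma finite_measure_torus: "finite_measure torus"
proof
  have "emeasure torus (space torus) = emeasure lborel ({0..<2 * pi} \<times> {0..<2 * pi})"
    unfolding space_torus unfolding torus_def by (subst emeasure_restrict_space) auto
  also have "\<dots> = emeasure (lborel \<Otimes>\<^sub>M lborel) ({0..<2 * pi} \<times> {0..<2 * pi})"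
    by (simp add: lborel_prod)
  also have "\<dots> = emeasure lborel {0..<2 * pi} * emeasure lborel {0..<2 * pi}"
    by (subst lborel.emeasure_pair_measure_Times) auto
  also have "\<dots> \<noteq> \<infinity>"
    by (simp add: ennreal_mult_eq_top_iff)
  finally show "emeasure torus (space torus) \<noteq> \<infinity>" .
qed

lemma character_borel [measurable]: "character k \<in> borel_measurable borel"
  unfolding character_def by (intro borel_measurable_continuous_onI continuous_intros)

lemma character_torus [measurable]: "character k \<in> borel_measurable torus"
  by (intro borel_measurable_torus character_borel)

lemma integrable_character [simp]: "integrable torus (character k)"
proof -
  interpret finite_measure torus by (rule finite_measure_torus)
  show ?thesis by (rule integrable_const_bound[where B = 1]) auto
qed

lemma integrable_mult_bounded:
  fixes f g :: "'a \<Rightarrow> complex"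
  assumes "integrable M f" "g \<in> borel_measurable M" "\<And>x. cmod (g x) \<le> B"
  shows "integrable M (\<lambda>x. f x * g x)"
proof (rule Bochner_Integration.integrable_bound)
  show "integrable M (\<lambda>x. B * norm (f x))" using assms(1) by auto
  show "AE x in M. norm (f x * g x) \<le> norm (B * norm (f x))"
  proof (rule AE_I2)
    fix x
    have "norm (f x * g x) \<le> norm (f x) * B" 
      using assms(3)[of x] by (simp add: norm_mult mult_left_mono)
    also have "\<dots> \<le> norm (B * norm (f x))"
      by (simp add: mult.commute)
    finally show "norm (f x * g x) \<le> norm (B * norm (f x))" .
  qed
  show "(\<lambda>x. f x * g x) \<in> borel_measurable M"
    by (intro borel_measurable_times borel_measurable_integrable assms)
qed

lemma integrable_mult_character [simp]:
  "integrable torus f \<Longrightarrow> integrable torus (\<lambda>x. f x * character k x)"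
  by (rule integrable_mult_bounded[where B = 1]) (simp_all add: character_torus)

lemma integral_exp_period:
  "(\<integral>t. indicator {0..<2 * pi} t *\<^sub>R exp (\<i> * complex_of_real (real_of_int p * t)) \<partial>lborel)
     = (if p = 0 then 2 * pi else 0)"
proof -
  have "(\<integral>t. indicator {0..<2 * pi} t *\<^sub>R exp (\<i> * complex_of_real (real_of_int p * t)) \<partial>lborel)
     = (\<integral>t. indicator {0..2 * pi} t *\<^sub>R exp (\<i> * complex_of_real (real_of_int p * t)) \<partial>lborel)"
  proof (rule integral_cong_AE)
    show "AE t in lborel. indicator {0..<2 * pi} t *\<^sub>R exp (\<i> * complex_of_real (real_of_int p * t))
        = indicator {0..2 * pi} t *\<^sub>R exp (\<i> * complex_of_real (real_of_int p * t))"
      using AE_lborel_singleton[of "2 * pi"] by eventually_elim (auto simp: indicator_def)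
  qed (auto intro!: borel_measurable_scaleR borel_measurable_continuous_onI continuous_intros)
  also have "\<dots> = (if p = 0 then 2 * pi else 0)"
  proof (cases "p = 0")
    case True
    then show ?thesis by (simp add: scaleR_conv_of_real)
  next
    case False
    define F where "F = (\<lambda>t. exp (\<i> * complex_of_real (real_of_int p * t)) / (\<i> * of_int p))"
    have "(\<integral>t. indicator {0..2 * pi} t *\<^sub>R exp (\<i> * complex_of_real (real_of_int p * t)) \<partial>lborel) = F (2 * pi) - F 0"
    proof (rule integral_FTC_Icc)
      fix t
      have "((\<lambda>z. exp (\<i> * (of_int p * z)) / (\<i> * of_int p)) has_field_derivative exp (\<i> * (of_int p * of_real t))) (at (of_real t))"
        by (auto intro!: derivative_eq_intros simp: False) (simp add: mult.commute mult.left_commute)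
      from has_vector_derivative_real_field[OF this]
      show "(F has_vector_derivative exp (\<i> * complex_of_real (real_of_int p * t))) (at t within {0..2 * pi})"
        by (simp add: F_def has_vector_derivative_at_within)
    qed (auto intro!: continuous_intros)
    also have "F (2 * pi) - F 0 = 0"
    proof -
      have "exp (\<i> * complex_of_real (real_of_int p * (2 * pi))) = cis (2 * pi * real_of_int p)"
        by (simp add: cis_conv_exp mult_ac)
      also have "\<dots> = 1" by (rule cis_multiple_2pi) simp
      finally show ?thesis by (simp add: F_def)
    qed
    finally show ?thesis using False by simp
  qed
  finally show ?thesis .
qed

lemma integral_character: "(\<integral>x. character k x \<partial>torus) = (if k = 0 then (2 * pi)\<^sup>2 else 0)"
proof -
  let ?g = "\<lambda>p t. indicator {0..<2 * pi} t *\<^sub>R exp (\<i> * complex_of_real (real_of_int p * t))"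
  have eq: "indicator ({0..<2 * pi} \<times> {0..<2 * pi}) x *\<^sub>R character k x = ?g (fst k) (fst x) * ?g (snd k) (snd x)" for x
    by (cases x) (auto simp: character_def indicator_def exp_add distrib_left)
  have int: "integrable lborel (\<lambda>x. indicator ({0..<2 * pi} \<times> {0..<2 * pi}) x *\<^sub>R character k x)"
    using integrable_character[of k] unfolding torus_def by (subst (asm) integrable_restrict_space) auto
  have "(\<integral>x. character k x \<partial>torus) = (\<integral>x. indicator ({0..<2 * pi} \<times> {0..<2 * pi}) x *\<^sub>R character k x \<partial>lborel)"
    unfolding torus_def by (rule integral_restrict_space) auto
  also have "\<dots> = (\<integral>x. (case x of (s, t) \<Rightarrow> ?g (fst k) s * ?g (snd k) t) \<partial>(lborel \<Otimes>\<^sub>M lborel))"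
    unfolding eq by (simp add: lborel_prod case_prod_beta)
  also have "\<dots> = (\<integral>s. (\<integral>t. ?g (fst k) s * ?g (snd k) t \<partial>lborel) \<partial>lborel)"
    by (rule lborel_pair.integral_fst[symmetric])
       (use int in \<open>simp only: eq lborel_prod case_prod_beta'\<close>)
  also have "\<dots> = (\<integral>s. ?g (fst k) s \<partial>lborel) * (\<integral>t. ?g (snd k) t \<partial>lborel)"
    by (simp only: integral_mult_right_zero integral_mult_left_zero)
  also have "\<dots> = (if k = 0 then (2 * pi)\<^sup>2 else 0)"
    unfolding integral_exp_period by (auto simp: power2_eq_square prod_eq_iff)
  finally show ?thesis .
qed

text \<open>The inductive description matches the inductive description of real polynomial functions, through which
  the Stone-Weierstrass theorem enters.\<close>

inductive trig_poly :: "(real \<times> real \<Rightarrow> complex) \<Rightarrow> bool" where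
  monom: "trig_poly (\<lambda>x. c * character k x)"
| add: "trig_poly f \<Longrightarrow> trig_poly g \<Longrightarrow> trig_poly (\<lambda>x. f x + g x)"

lemma trig_poly_const: "trig_poly (\<lambda>x. c)"
  using trig_poly.monom[of c 0] by simp

lemma trig_poly_mult:
  assumes "trig_poly f" "trig_poly g"
  shows "trig_poly (\<lambda>x. f x * g x)"
  using assms(1)
proof induction
  case (monom c k)
  show ?case using assms(2)
  proof induction
    case (monom d l)
    have "trig_poly (\<lambda>x. (c * d) * character (k + l) x)" by (rule trig_poly.monom)
    then show ?case by (simp add: character_add mult_ac)
  next
    case (add f g)
    then show ?case using trig_poly.add by (simp add: distrib_left)
  qed
next
  case (add f1 f2)
  then show ?case using trig_poly.add by (simp add: distrib_right)
qed

lemma integral_mult_trig_poly: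
  assumes "integrable torus f" "\<And>k. (\<integral>x. f x * character k x \<partial>torus) = 0" "trig_poly p"
  shows "integrable torus (\<lambda>x. f x * p x) \<and> (\<integral>x. f x * p x \<partial>torus) = 0"
  using assms(3)
proof induction
  case (monom c k)
  have eq: "(\<lambda>x. f x * (c * character k x)) = (\<lambda>x. c * (f x * character k x))"
    by (simp add: mult_ac)
  show ?case unfolding eq using assms(1,2) by simp
next
  case (add p q)
  then show ?case by (simp add: distrib_left)
qed

text \<open>The fundamental domain is not compact, and continuity on it does not express periodicity. Both
  difficulties disappear on the image of this embedding, a product of two circles, where the
  polynomial functions restrict to the trigonometric polynomials.\<close>

definition torus_embed :: "real \<times> real \<Rightarrow> complex \<times> complex" where
  "torus_embed x = (cis (fst x), cis (snd x))"

lemma continuous_torus_embed: "continuous_on S torus_embed"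
  unfolding torus_embed_def cis_conv_exp by (intro continuous_intros)

lemma trig_poly_polynomial:
  assumes "real_polynomial_function p"
  shows "trig_poly (\<lambda>x. complex_of_real (p (torus_embed x)))"
  using assms
proof induction
  case (linear f)
  interpret bounded_linear f by fact
  have f: "f (w, z) = Re w * f (1, 0) + Im w * f (\<i>, 0) + Re z * f (0, 1) + Im z * f (0, \<i>)" for w z
  proof -
    have "(w, z) = Re w *\<^sub>R (1, 0) + Im w *\<^sub>R (\<i>, 0) + Re z *\<^sub>R (0, 1) + Im z *\<^sub>R (0, \<i>)"
      by (simp add: complex_eq_iff)
    then have "f (w, z) = f (Re w *\<^sub>R (1, 0) + Im w *\<^sub>R (\<i>, 0) + Re z *\<^sub>R (0, 1) + Im z *\<^sub>R (0, \<i>))"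
      by (rule arg_cong)
    then show ?thesis by (simp only: add scaleR real_scaleR_def)
  qed
  have c1: "trig_poly (\<lambda>x. complex_of_real (cos (fst x)))"
  proof -
    have "complex_of_real (cos (fst x)) = (1/2) * character (1, 0) x + (1/2) * character (-1, 0) x" for x
      by (simp add: character_cis complex_eq_iff)
    then show ?thesis by (simp only: trig_poly.add[OF trig_poly.monom trig_poly.monom])
  qed
  have s1: "trig_poly (\<lambda>x. complex_of_real (sin (fst x)))"
  proof -
    have "complex_of_real (sin (fst x)) = (- \<i>/2) * character (1, 0) x + (\<i>/2) * character (-1, 0) x" for x
      by (simp add: character_cis complex_eq_iff)
    then show ?thesis by (simp only: trig_poly.add[OF trig_poly.monom trig_poly.monom])
  qed
  have c2: "trig_poly (\<lambda>x. complex_of_real (cos (snd x)))"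
  proof -
    have "complex_of_real (cos (snd x)) = (1/2) * character (0, 1) x + (1/2) * character (0, -1) x" for x
      by (simp add: character_cis complex_eq_iff)
    then show ?thesis by (simp only: trig_poly.add[OF trig_poly.monom trig_poly.monom])
  qed
  have s2: "trig_poly (\<lambda>x. complex_of_real (sin (snd x)))"
  proof -
    have "complex_of_real (sin (snd x)) = (- \<i>/2) * character (0, 1) x + (\<i>/2) * character (0, -1) x" for x
      by (simp add: character_cis complex_eq_iff)
    then show ?thesis by (simp only: trig_poly.add[OF trig_poly.monom trig_poly.monom])
  qed
  have ft: "complex_of_real (f (torus_embed x)) = complex_of_real (cos (fst x)) * complex_of_real (f (1, 0)) 
      + complex_of_real (sin (fst x)) * complex_of_real (f (\<i>, 0))
      + complex_of_real (cos (snd x)) * complex_of_real (f (0, 1)) 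
      + complex_of_real (sin (snd x)) * complex_of_real (f (0, \<i>))" for x
    using f[of "cis (fst x)" "cis (snd x)"] by (simp add: torus_embed_def)
  have "trig_poly (\<lambda>x. complex_of_real (cos (fst x)) * complex_of_real (f (1, 0)) 
      + complex_of_real (sin (fst x)) * complex_of_real (f (\<i>, 0))
      + complex_of_real (cos (snd x)) * complex_of_real (f (0, 1)) 
      + complex_of_real (sin (snd x)) * complex_of_real (f (0, \<i>)))"
    by (intro trig_poly.add trig_poly_mult trig_poly_const c1 s1 c2 s2)
  then show ?case by (simp only: ft)
next
  case (const c)
  then show ?case by (simp add: trig_poly_const)
next
  case (add f g)
  then show ?case using trig_poly.add by simp
next
  case (mult f g)
  then show ?case using trig_poly_mult by simp
qed

text \<open>The functions \<open>\<phi>\<close> with \<open>\<integral> f * \<phi> = 0\<close> contain all trigonometric polynomials. They are enlarged to the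
  continuous functions by uniform approximation, to indicators of closed sets by a
  bounded pointwise limit, and to indicators of Borel sets by Dynkin's theorem.\<close>

lemma integral_mult_continuous:
  fixes g :: "complex \<times> complex \<Rightarrow> real"
  assumes f: "integrable torus f" "\<And>k. (\<integral>x. f x * character k x \<partial>torus) = 0"
    and g: "continuous_on UNIV g"
  shows "(\<integral>x. f x * complex_of_real (g (torus_embed x)) \<partial>torus) = 0"
proof -
  let ?S = "sphere (0::complex) 1 \<times> sphere (0::complex) 1"
  have S: "compact ?S" by (intro compact_Times) auto
  have inS: "torus_embed x \<in> ?S" for x by (simp add: torus_embed_def)
  define N where "N = (\<integral>x. cmod (f x) \<partial>torus)"
  have cont: "continuous_on ?S g" using g continuous_on_subset by blast
  have "cmod (\<integral>x. f x * complex_of_real (g (torus_embed x)) \<partial>torus) \<le> e * N" if e: "e > 0" for e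
  proof -
    obtain p where p: "real_polynomial_function p" "\<And>y. y \<in> ?S \<Longrightarrow> \<bar>g y - p y\<bar> < e"
      using Stone_Weierstrass_real_polynomial_function[OF S cont e] by blast
    define h where "h = (\<lambda>x. complex_of_real (g (torus_embed x) - p (torus_embed x)))"
    have hb: "cmod (h x) \<le> e" for x
      using p(2)[OF inS[of x]] by (simp add: h_def del: of_real_diff)
    have "continuous_on UNIV p"
      using p(1) by (simp add: real_polynomial_function_eq continuous_on_polymonial_function)
    then have "continuous_on UNIV (\<lambda>x. g (torus_embed x) - p (torus_embed x))"
      by (intro continuous_on_diff continuous_on_compose2[OF g continuous_torus_embed subset_UNIV]
          continuous_on_compose2[OF _ continuous_torus_embed subset_UNIV])
    then have hm: "h \<in> borel_measurable torus"
      unfolding h_def by (intro borel_measurable_torus borel_measurable_continuous_onI continuous_on_of_real)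
    have fh: "integrable torus (\<lambda>x. f x * h x)"
      using f(1) hm hb by (rule integrable_mult_bounded)
    have fp: "integrable torus (\<lambda>x. f x * complex_of_real (p (torus_embed x)))"
      "(\<integral>x. f x * complex_of_real (p (torus_embed x)) \<partial>torus) = 0"
      using integral_mult_trig_poly[OF f trig_poly_polynomial[OF p(1)]] by auto
    have "(\<integral>x. f x * complex_of_real (g (torus_embed x)) \<partial>torus) 
        = (\<integral>x. f x * h x + f x * complex_of_real (p (torus_embed x)) \<partial>torus)"
      by (simp add: h_def algebra_simps)
    also have "\<dots> = (\<integral>x. f x * h x \<partial>torus)"
      using fh fp by simp
    also have "cmod \<dots> \<le> (\<integral>x. e * cmod (f x) \<partial>torus)"
    proof (rule Bochner_Integration.integral_norm_bound_integral)
      fix x show "cmod (f x * h x) \<le> e * cmod (f x)"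
        using hb[of x] by (simp add: norm_mult mult.commute[of e] mult_left_mono)
    qed (use fh f(1) in auto)
    finally show ?thesis by (simp add: N_def)
  qed
  moreover have "0 \<le> N" by (simp add: N_def)
  ultimately have "cmod (\<integral>x. f x * complex_of_real (g (torus_embed x)) \<partial>torus) \<le> e" if "e > 0" for e
  proof -
    assume "0 \<le> N" and *: "\<And>e. 0 < e \<Longrightarrow> cmod (\<integral>x. f x * complex_of_real (g (torus_embed x)) \<partial>torus) \<le> e * N"
    have "e / (N + 1) * N \<le> e" using \<open>e > 0\<close> \<open>0 \<le> N\<close> by (simp add: field_simps)
    then show ?thesis using *[of "e / (N + 1)"] that \<open>0 \<le> N\<close> by (smt (verit) divide_pos_pos)
  qed
  then have "cmod (\<integral>x. f x * complex_of_real (g (torus_embed x)) \<partial>torus) \<le> 0"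
    by (rule field_le_epsilon) simp
  then show ?thesis by simp
qed

lemma indicator_torus_embed_measurable:
  assumes "B \<in> sets borel"
  shows "(\<lambda>x. indicator B (torus_embed x) :: 'a::{zero_neq_one,topological_space}) \<in> borel_measurable torus"
proof -
  have "torus_embed \<in> borel_measurable borel"
    by (intro borel_measurable_continuous_onI continuous_torus_embed)
  moreover have "(indicator B :: _ \<Rightarrow> 'a) \<in> borel_measurable borel"
    using assms by (rule borel_measurable_indicator)
  ultimately show ?thesis
    by (intro borel_measurable_torus) (rule measurable_compose)
qed

lemma integral_mult_indicator_closed:
  assumes f: "integrable torus f" "\<And>k. (\<integral>x. f x * character k x \<partial>torus) = 0"
    and F: "closed F"
  shows "(\<integral>x. f x * indicator F (torus_embed x) \<partial>torus) = 0"
proof (cases "F = {}")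
  case False
  define g where "g = (\<lambda>n y. max 0 (1 - real n * infdist y F))"
  have cont: "continuous_on UNIV (g n)" for n
    unfolding g_def by (intro continuous_intros)
  have lim: "(\<lambda>n. g n y) \<longlonglongrightarrow> indicator F y" for y
  proof (cases "y \<in> F")
    case True
    then show ?thesis by (simp add: g_def)
  next
    case y: False
    then have d: "infdist y F > 0"
      using F False by (metis in_closed_iff_infdist_zero infdist_nonneg less_eq_real_def)
    obtain n0 :: nat where n0: "1 / infdist y F < real n0" using reals_Archimedean2 by blast
    have "\<forall>\<^sub>F n in sequentially. g n y = 0"
      using eventually_ge_at_top[of n0]
    proof eventually_elim
      case (elim n)
      then have "1 / infdist y F < real n" using n0 by linarith
      then have "1 < real n * infdist y F" using d by (simp add: field_simps)
      then show ?case by (simp add: g_def)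
    qed
    then show ?thesis using y by (simp add: tendsto_eventually)
  qed
  have meas: "(\<lambda>x. complex_of_real (g n (torus_embed x))) \<in> borel_measurable torus" for n
    by (intro borel_measurable_torus borel_measurable_continuous_onI continuous_on_of_real
        continuous_on_compose2[OF cont[of n] continuous_torus_embed] subset_UNIV)
  have "(\<lambda>n. \<integral>x. f x * complex_of_real (g n (torus_embed x)) \<partial>torus) 
      \<longlonglongrightarrow> (\<integral>x. f x * complex_of_real (indicator F (torus_embed x)) \<partial>torus)"
  proof (rule integral_dominated_convergence[where w = "\<lambda>x. cmod (f x)"])
    show "(\<lambda>x. f x * complex_of_real (indicator F (torus_embed x))) \<in> borel_measurable torus"
      by (intro borel_measurable_times borel_measurable_integrable[OF f(1)]
          measurable_compose[OF indicator_torus_embed_measurable borel_measurable_of_real] borel_closed F)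
    show "(\<lambda>x. f x * complex_of_real (g n (torus_embed x))) \<in> borel_measurable torus" for n
      by (intro borel_measurable_times meas borel_measurable_integrable[OF f(1)])
    show "AE x in torus. (\<lambda>n. f x * complex_of_real (g n (torus_embed x))) \<longlonglongrightarrow> f x * complex_of_real (indicator F (torus_embed x))"
      by (intro AE_I2 tendsto_mult tendsto_const tendsto_of_real lim)
    show "AE x in torus. cmod (f x * complex_of_real (g n (torus_embed x))) \<le> cmod (f x)" for n
    proof (intro AE_I2)
      fix x
      have "\<bar>g n (torus_embed x)\<bar> \<le> 1" by (simp add: g_def infdist_nonneg)
      then show "cmod (f x * complex_of_real (g n (torus_embed x))) \<le> cmod (f x)"
        by (simp add: norm_mult mult_left_le)
    qed
    show "integrable torus (\<lambda>x. cmod (f x))" using f(1) by (rule integrable_norm)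
  qed
  moreover have "(\<integral>x. f x * complex_of_real (g n (torus_embed x)) \<partial>torus) = 0" for n
    using f cont by (rule integral_mult_continuous)
  ultimately have "(\<integral>x. f x * complex_of_real (indicator F (torus_embed x)) \<partial>torus) = 0"
    by (simp only: LIMSEQ_const_iff)
  moreover have "complex_of_real (indicator F y) = indicator F y" for y
    by (simp add: indicator_def)
  ultimately show ?thesis by simp
qed simp

lemma integral_mult_indicator_borel:
  assumes f: "integrable torus f" "\<And>k. (\<integral>x. f x * character k x \<partial>torus) = 0"
    and B: "B \<in> sets borel"
  shows "(\<integral>x. f x * indicator B (torus_embed x) \<partial>torus) = 0"
proof -
  let ?I = "\<lambda>B. \<integral>x. f x * indicator B (torus_embed x) \<partial>torus"
  note ind = indicator_torus_embed_measurable
  have int: "integrable torus (\<lambda>x. f x * indicator B (torus_embed x))" if "B \<in> sets borel" for B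
    using f(1) ind[OF that] by (rule integrable_mult_bounded[where B = 1]) (auto simp: indicator_def)
  have "Int_stable (Collect closed :: (complex \<times> complex) set set)" by (auto simp: Int_stable_def)
  moreover have "Collect closed \<subseteq> Pow (UNIV :: (complex \<times> complex) set)" by simp
  moreover have "B \<in> sigma_sets UNIV (Collect closed)"
    using B by (simp add: borel_eq_closed)
  ultimately show ?thesis
  proof (induction rule: sigma_sets_induct_disjoint)
    fix A :: "(complex \<times> complex) set" assume "A \<in> Collect closed"
    then show "?I A = 0"
      using integral_mult_indicator_closed[OF f] by simp
  next
    show "?I {} = 0" by simp
  next
    fix A assume A: "A \<in> sigma_sets UNIV (Collect closed)" "?I A = 0"
    then have A': "A \<in> sets borel" by (simp add: borel_eq_closed)
    have "?I (UNIV - A) 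
        = (\<integral>x. f x * indicator UNIV (torus_embed x) - f x * indicator A (torus_embed x) \<partial>torus)"
      by (intro Bochner_Integration.integral_cong) (auto simp: indicator_def)
    also have "\<dots> = ?I UNIV - ?I A"
      by (intro Bochner_Integration.integral_diff int A') auto
    also have "\<dots> = 0"
      using integral_mult_indicator_closed[OF f, of UNIV] A by simp
    finally show "?I (UNIV - A) = 0" .
  next
    fix A :: "nat \<Rightarrow> _" assume disj: "disjoint_family A" and A: "range A \<subseteq> sigma_sets UNIV (Collect closed)"
      and 0: "\<And>i. ?I (A i) = 0"
    have A': "A i \<in> sets borel" for i using A by (auto simp: borel_eq_closed)
    have UN: "(\<Union>i\<in>I. A i) \<in> sets borel" for I
      by (rule sets.countable_UN) (use A' in blast)
    have "(\<lambda>n. \<integral>x. f x * indicator (\<Union>i<n. A i) (torus_embed x) \<partial>torus) 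
        \<longlonglongrightarrow> ?I (\<Union>i. A i)"
    proof (rule integral_dominated_convergence[where w = "\<lambda>x. cmod (f x)"])
      show "(\<lambda>x. f x * indicator (\<Union>i. A i) (torus_embed x)) \<in> borel_measurable torus"
        by (rule borel_measurable_times[OF borel_measurable_integrable[OF f(1)] ind[OF UN]])
      show "(\<lambda>x. f x * indicator (\<Union>i<n. A i) (torus_embed x)) \<in> borel_measurable torus" for n
        by (rule borel_measurable_times[OF borel_measurable_integrable[OF f(1)] ind[OF UN]])
      show "AE x in torus. (\<lambda>n. f x * indicator (\<Union>i<n. A i) (torus_embed x)) \<longlonglongrightarrow> f x * indicator (\<Union>i. A i) (torus_embed x)"
        by (intro AE_I2 tendsto_mult tendsto_const LIMSEQ_indicator_UN)
      show "AE x in torus. cmod (f x * indicator (\<Union>i<n. A i) (torus_embed x)) \<le> cmod (f x)" for n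
        by (intro AE_I2) (simp add: indicator_def)
      show "integrable torus (\<lambda>x. cmod (f x))" using f(1) by (rule integrable_norm)
    qed
    moreover have "?I (\<Union>i<n. A i) = 0" for n
    proof -
      have "?I (\<Union>i<n. A i) = (\<integral>x. (\<Sum>i<n. f x * indicator (A i) (torus_embed x)) \<partial>torus)"
        by (subst indicator_UN_disjoint)
           (simp_all only: finite_lessThan disjoint_family_on_mono[OF subset_UNIV disj] sum_distrib_left)
      also have "\<dots> = (\<Sum>i<n. \<integral>x. f x * indicator (A i) (torus_embed x) \<partial>torus)"
        by (intro Bochner_Integration.integral_sum int A')
      also have "\<dots> = 0" by (simp only: 0 sum.neutral_const)
      finally show ?thesis .
    qed
    ultimately show "?I (\<Union>i. A i) = 0"
      by (simp only: LIMSEQ_const_iff)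
  qed
qed

lemma Arg2pi_borel [measurable]: "Arg2pi \<in> borel_measurable borel"
  by (rule borel_measurableI_greater) (simp add: open_Arg2pi2pi_gt)

text \<open>The embedding is injective on the fundamental domain with the Borel measurable inverse given by
  \<open>Arg2pi\<close>, so that every Borel set of the fundamental domain is the preimage of a Borel set.\<close>

theorem AE_zero_if_fourier_coeff_zero:
  assumes f: "integrable torus f" "\<And>k. (\<integral>x. f x * character k x \<partial>torus) = 0"
  shows "AE x in torus. f x = 0"
proof (rule sigma_finite_measure.density_zero[OF _ f(1)])
  show "sigma_finite_measure torus"
    using finite_measure_torus by (rule finite_measure.axioms)
next
  fix A assume "A \<in> sets torus"
  then obtain A' where A': "A' \<in> sets borel" "A = ({0..<2 * pi} \<times> {0..<2 * pi}) \<inter> A'"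
    by (auto simp: torus_def sets_restrict_space)
  define G where "G = (\<lambda>y::complex \<times> complex. (Arg2pi (fst y), Arg2pi (snd y)))"
  have G: "G \<in> borel_measurable borel"
    unfolding G_def by (intro borel_measurable_Pair measurable_compose[OF _ Arg2pi_borel]
        borel_measurable_continuous_onI continuous_intros)
  have B: "G -` A' \<in> sets borel"
    using measurable_sets[OF G A'(1)] by simp
  have Arg: "Arg2pi (cis t) = t" if "t \<in> {0..<2 * pi}" for t
    using that Arg2pi_unique[of 1 t "cis t"] by (simp add: cis_conv_exp)
  have "set_lebesgue_integral torus A f = (\<integral>x. f x * indicator (G -` A') (torus_embed x) \<partial>torus)"
    unfolding set_lebesgue_integral_def
  proof (intro Bochner_Integration.integral_cong refl)
    fix x assume "x \<in> space torus"
    then have "G (torus_embed x) = x" "x \<in> A \<longleftrightarrow> x \<in> A'"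
      by (auto simp: space_torus G_def torus_embed_def Arg A')
    then show "indicator A x *\<^sub>R f x = f x * indicator (G -` A') (torus_embed x)"
      by (simp add: indicator_def)
  qed
  also have "\<dots> = 0" using f B by (rule integral_mult_indicator_borel)
  finally show "set_lebesgue_integral torus A f = 0" .
qed

section \<open>The Riesz-Fischer theorem and products of square integrable functions\<close>

lemma torus_L2_measurable: "f \<in> torus_L2 \<Longrightarrow> f \<in> borel_measurable torus"
  by (simp add: torus_L2_def)

lemma torus_L2_square_integrable: "f \<in> torus_L2 \<Longrightarrow> integrable torus (\<lambda>x. (cmod (f x))\<^sup>2)"
  by (simp add: torus_L2_def)

lemma mult_le_sum_squares: "a * b \<le> a\<^sup>2 + (b::real)\<^sup>2"
  using zero_le_power2[of "a - b"] zero_le_power2[of "a + b"]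
  by (simp add: power2_eq_square algebra_simps)

lemma torus_L2_mult_integrable:
  assumes "f \<in> torus_L2" "g \<in> torus_L2"
  shows "integrable torus (\<lambda>x. f x * g x)"
proof (rule Bochner_Integration.integrable_bound)
  show "integrable torus (\<lambda>x. (cmod (f x))\<^sup>2 + (cmod (g x))\<^sup>2)"
    by (intro Bochner_Integration.integrable_add torus_L2_square_integrable assms)
  show "(\<lambda>x. f x * g x) \<in> borel_measurable torus"
    by (intro borel_measurable_times torus_L2_measurable assms)
  show "AE x in torus. norm (f x * g x) \<le> norm ((cmod (f x))\<^sup>2 + (cmod (g x))\<^sup>2)"
    by (intro AE_I2) (simp add: norm_mult mult_le_sum_squares)
qed

lemma torus_L2_bounded:
  assumes "f \<in> borel_measurable torus" "\<And>x. cmod (f x) \<le> B"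
  shows "f \<in> torus_L2"
proof -
  interpret finite_measure torus by (rule finite_measure_torus)
  have "integrable torus (\<lambda>x. (cmod (f x))\<^sup>2)"
  proof (rule integrable_const_bound[where B = "B\<^sup>2"])
    show "AE x in torus. norm ((cmod (f x))\<^sup>2) \<le> B\<^sup>2"
      using assms(2) by (intro AE_I2) (simp add: power_mono)
    show "(\<lambda>x. (cmod (f x))\<^sup>2) \<in> borel_measurable torus"
      using assms(1) by measurable
  qed
  then show ?thesis using assms(1) by (simp add: torus_L2_def)
qed

lemma character_torus_L2: "character k \<in> torus_L2"
  by (rule torus_L2_bounded[where B = 1]) (simp_all add: character_torus)

lemma torus_L2_integrable:
  assumes "f \<in> torus_L2"
  shows "integrable torus f"
  using torus_L2_mult_integrable[OF assms character_torus_L2[of 0]] by simp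

lemma torus_L2_mult_character:
  assumes "f \<in> torus_L2"
  shows "(\<lambda>x. f x * character k x) \<in> torus_L2"
  using assms unfolding torus_L2_def
  by (auto simp: norm_mult intro!: borel_measurable_times character_torus)

lemma fourier_coeff_character:
  "fourier_coeff f k = (\<integral>x. f x * character (- k) x \<partial>torus) / complex_of_real ((2 * pi)\<^sup>2)"
proof -
  have "exp (- \<i> * complex_of_real (real_of_int (fst k) * fst x + real_of_int (snd k) * snd x)) = character (- k) x" for x
    by (simp add: character_def algebra_simps)
  then show ?thesis by (simp only: fourier_coeff_def)
qed

lemma two_pi_square_nonzero: "complex_of_real ((2 * pi)\<^sup>2) \<noteq> 0"
  by simp

lemma integral_mult_character:
  "(\<integral>x. f x * character k x \<partial>torus) = complex_of_real ((2 * pi)\<^sup>2) * fourier_coeff f (- k)"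
  unfolding fourier_coeff_character using two_pi_square_nonzero by simp

lemma AE_eq_if_fourier_coeff_eq:
  assumes "integrable torus f" "integrable torus g" "fourier_coeff f = fourier_coeff g"
  shows "AE x in torus. f x = g x"
proof -
  have "AE x in torus. f x - g x = 0"
  proof (rule AE_zero_if_fourier_coeff_zero)
    show "integrable torus (\<lambda>x. f x - g x)" using assms by simp
    fix k
    have "(\<integral>x. (f x - g x) * character k x \<partial>torus)
        = (\<integral>x. f x * character k x \<partial>torus) - (\<integral>x. g x * character k x \<partial>torus)"
      unfolding left_diff_distrib using assms
      by (intro Bochner_Integration.integral_diff integrable_mult_character) auto
    then show "(\<integral>x. (f x - g x) * character k x \<partial>torus) = 0"
      using assms(3) by (simp add: integral_mult_character)
  qed
  then show ?thesis by simp
qed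

definition trig_sum :: "torus_dist \<Rightarrow> (int \<times> int) set \<Rightarrow> real \<times> real \<Rightarrow> complex" where
  "trig_sum c K x = (\<Sum>k\<in>K. c k * character k x)"

lemma trig_sum_measurable: "trig_sum c K \<in> borel_measurable torus"
  unfolding trig_sum_def by (intro borel_measurable_sum borel_measurable_times character_torus) simp

lemma trig_sum_torus_L2: "trig_sum c K \<in> torus_L2"
proof (rule torus_L2_bounded[OF trig_sum_measurable])
  fix x
  have "cmod (trig_sum c K x) \<le> (\<Sum>k\<in>K. cmod (c k * character k x))"
    unfolding trig_sum_def by (rule norm_sum)
  then show "cmod (trig_sum c K x) \<le> (\<Sum>k\<in>K. cmod (c k))"
    by (simp add: norm_mult)
qed

lemma integral_trig_sum_mult:
  assumes "h \<in> torus_L2"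
  shows "(\<integral>x. trig_sum c K x * h x \<partial>torus) = complex_of_real ((2 * pi)\<^sup>2) * (\<Sum>k\<in>K. c k * fourier_coeff h (- k))"
proof -
  have "(\<integral>x. trig_sum c K x * h x \<partial>torus) = (\<integral>x. (\<Sum>k\<in>K. c k * (h x * character k x)) \<partial>torus)"
    by (simp add: trig_sum_def sum_distrib_left sum_distrib_right mult_ac)
  also have "\<dots> = (\<Sum>k\<in>K. \<integral>x. c k * (h x * character k x) \<partial>torus)"
    by (intro Bochner_Integration.integral_sum integrable_mult_right integrable_mult_character torus_L2_integrable assms)
  also have "\<dots> = complex_of_real ((2 * pi)\<^sup>2) * (\<Sum>k\<in>K. c k * fourier_coeff h (- k))"
    by (simp add: integral_mult_character sum_distrib_left mult_ac)
  finally show ?thesis .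
qed

lemma fourier_coeff_trig_sum:
  assumes "finite K"
  shows "fourier_coeff (trig_sum c K) k = (if k \<in> K then c k else 0)"
proof -
  have "(\<integral>x. trig_sum c K x * character (- k) x \<partial>torus) = (\<Sum>l\<in>K. c l * (\<integral>x. character (l - k) x \<partial>torus))"
  proof -
    have "(\<integral>x. trig_sum c K x * character (- k) x \<partial>torus) = (\<integral>x. (\<Sum>l\<in>K. c l * character (l - k) x) \<partial>torus)"
      by (simp add: trig_sum_def sum_distrib_right mult.assoc flip: character_add)
    also have "\<dots> = (\<Sum>l\<in>K. \<integral>x. c l * character (l - k) x \<partial>torus)"
      by (intro Bochner_Integration.integral_sum integrable_mult_right integrable_character)
    finally show ?thesis by simp
  qed
  also have "\<dots> = (\<Sum>l\<in>K. if l = k then c l * complex_of_real ((2 * pi)\<^sup>2) else 0)"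
    by (intro sum.cong) (auto simp: integral_character)
  also have "\<dots> = (if k \<in> K then c k * complex_of_real ((2 * pi)\<^sup>2) else 0)"
    using assms by (simp add: sum.delta)
  finally show ?thesis
    unfolding fourier_coeff_character using two_pi_square_nonzero by simp
qed

lemma integral_norm_trig_sum:
  assumes "finite K"
  shows "(\<integral>x. (cmod (trig_sum c K x))\<^sup>2 \<partial>torus) = (2 * pi)\<^sup>2 * (\<Sum>k\<in>K. (cmod (c k))\<^sup>2)"
proof -
  have cnj: "(\<lambda>x. cnj (trig_sum c K x)) = trig_sum (\<lambda>k. cnj (c (- k))) (uminus ` K)"
    by (rule ext) (simp add: trig_sum_def sum.reindex inj_on_def character_minus)
  have "complex_of_real (\<integral>x. (cmod (trig_sum c K x))\<^sup>2 \<partial>torus) = (\<integral>x. trig_sum c K x * cnj (trig_sum c K x) \<partial>torus)"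
    unfolding integral_complex_of_real[symmetric] complex_norm_square ..
  also have "\<dots> = complex_of_real ((2 * pi)\<^sup>2) * (\<Sum>k\<in>K. c k * fourier_coeff (\<lambda>x. cnj (trig_sum c K x)) (- k))"
    by (rule integral_trig_sum_mult) (simp add: cnj trig_sum_torus_L2)
  also have "(\<Sum>k\<in>K. c k * fourier_coeff (\<lambda>x. cnj (trig_sum c K x)) (- k)) = (\<Sum>k\<in>K. c k * cnj (c k))"
    unfolding cnj using assms by (intro sum.cong) (auto simp: fourier_coeff_trig_sum)
  also have "\<dots> = complex_of_real (\<Sum>k\<in>K. (cmod (c k))\<^sup>2)"
    by (simp only: of_real_sum complex_norm_square)
  finally show ?thesis
    unfolding of_real_mult[symmetric] of_real_eq_iff .
qed

text \<open>The square function method below weights the squared norm of the \<open>j\<close>-th increment by \<open>2 ^ j\<close>, which a decay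
  like \<open>(1/4) ^ j\<close> compensates.\<close>

lemma fast_exhaustion:
  assumes "Sobolev_le 0 B c"
  obtains K :: "nat \<Rightarrow> (int \<times> int) set" where "\<And>j. finite (K j)" "\<And>j. K j \<subseteq> K (Suc j)" "(\<Union>j. K j) = UNIV"
    "\<And>j. (\<Sum>k\<in>K (Suc j) - K j. (cmod (c k))\<^sup>2) \<le> (1/4) ^ j"
proof -
  have sm: "(\<lambda>k. (cmod (c k))\<^sup>2) summable_on UNIV"
    using assms by (simp add: Sobolev_le_iff Sobolev_def)
  define S where "S = (\<Sum>\<^sub>\<infinity>k. (cmod (c k))\<^sup>2)"
  have "\<exists>F. finite F \<and> S - (1/4) ^ j \<le> (\<Sum>k\<in>F. (cmod (c k))\<^sup>2)" for j :: nat
  proof -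
    obtain F where F: "finite F" "dist (\<Sum>k\<in>F. (cmod (c k))\<^sup>2) S \<le> (1/4) ^ j"
      using infsum_finite_approximation[OF sm, of "(1/4) ^ j"] unfolding S_def by auto
    then show ?thesis by (intro exI[of _ F]) (auto simp: dist_real_def)
  qed
  then obtain F where F: "\<And>j. finite (F j)" "\<And>j. S - (1/4) ^ j \<le> (\<Sum>k\<in>F j. (cmod (c k))\<^sup>2)"
    by metis
  define K where "K = (\<lambda>j::nat. {- int j..int j} \<times> {- int j..int j} \<union> (\<Union>i\<le>j. F i))"
  show thesis
  proof
    show fin: "finite (K j)" for j using F by (simp add: K_def)
    show sub: "K j \<subseteq> K (Suc j)" for j by (force simp: K_def)
    show "(\<Union>j. K j) = UNIV"
    proof -
      have "k \<in> K (nat (max \<bar>fst k\<bar> \<bar>snd k\<bar>))" for k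
        by (cases k) (auto simp: K_def)
      then show ?thesis by blast
    qed
    fix j
    have "(\<Sum>k\<in>K (Suc j) - K j. (cmod (c k))\<^sup>2) = (\<Sum>k\<in>K (Suc j). (cmod (c k))\<^sup>2) - (\<Sum>k\<in>K j. (cmod (c k))\<^sup>2)"
      using fin sub by (intro sum_diff) auto
    also have "(\<Sum>k\<in>K (Suc j). (cmod (c k))\<^sup>2) \<le> S"
      unfolding S_def by (rule finite_sum_le_infsum[OF sm fin]) auto
    also have "(\<Sum>k\<in>F j. (cmod (c k))\<^sup>2) \<le> (\<Sum>k\<in>K j. (cmod (c k))\<^sup>2)"
      using fin by (intro sum_mono2) (auto simp: K_def)
    then have "S - (\<Sum>k\<in>K j. (cmod (c k))\<^sup>2) \<le> (1/4) ^ j"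
      using F(2)[of j] by linarith
    finally show "(\<Sum>k\<in>K (Suc j) - K j. (cmod (c k))\<^sup>2) \<le> (1/4) ^ j" by simp
  qed
qed

text \<open>The partial sums over a fast exhaustion converge almost everywhere and are dominated by a
  square integrable function, because the square of the sum of the norms of the increments is at most
  \<open>2 * H\<close>, where \<open>H\<close> sums the squared increments with weights \<open>2 ^ j\<close> and is integrable.\<close>

theorem Riesz_Fischer:
  assumes c: "Sobolev_le 0 B c"
  obtains K :: "nat \<Rightarrow> (int \<times> int) set" and f 
  where "\<And>j. finite (K j)" "incseq K" "(\<Union>j. K j) = UNIV" "f \<in> torus_L2"
    "\<And>h. h \<in> torus_L2 \<Longrightarrow> (\<lambda>j. \<integral>x. trig_sum c (K j) x * h x \<partial>torus) \<longlonglongrightarrow> (\<integral>x. f x * h x \<partial>torus)"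
proof -
  obtain K :: "nat \<Rightarrow> (int \<times> int) set" where K: "\<And>j. finite (K j)" "\<And>j. K j \<subseteq> K (Suc j)" "(\<Union>j. K j) = UNIV"
    "\<And>j. (\<Sum>k\<in>K (Suc j) - K j. (cmod (c k))\<^sup>2) \<le> (1/4) ^ j"
    using fast_exhaustion[OF c] by blast
  define S where "S = (\<lambda>j. trig_sum c (K j))"
  define d where "d = (\<lambda>j. trig_sum c (K (Suc j) - K j))"
  define q where "q = (\<lambda>j x. 2 ^ j * (cmod (d j x))\<^sup>2)"
  define H where "H = (\<lambda>x. \<Sum>j. q j x)"
  define w where "w = (\<lambda>x. cmod (S 0 x) + sqrt (2 * H x))"
  define f where "f = (\<lambda>x. lim (\<lambda>j. S j x))"
  have Sd: "S j x = S 0 x + (\<Sum>i<j. d i x)" for j x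
  proof (induction j)
    case (Suc j)
    have "S (Suc j) x = S j x + d j x"
      unfolding S_def d_def trig_sum_def
      using sum.subset_diff[OF K(2)[of j] K(1)[of "Suc j"]] by (simp add: add.commute)
    then show ?case using Suc by simp
  qed simp
  have qint: "integrable torus (q j)" for j
    unfolding q_def d_def by (intro integrable_mult_right torus_L2_square_integrable trig_sum_torus_L2)
  have q0: "0 \<le> q j x" for j x by (simp add: q_def)
  have qle: "(\<integral>x. q j x \<partial>torus) \<le> (2 * pi)\<^sup>2 * (1/2) ^ j" for j
  proof -
    have "(\<integral>x. q j x \<partial>torus) = 2 ^ j * ((2 * pi)\<^sup>2 * (\<Sum>k\<in>K (Suc j) - K j. (cmod (c k))\<^sup>2))"
      unfolding q_def d_def using K by (simp add: integral_norm_trig_sum)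
    also have "\<dots> \<le> 2 ^ j * ((2 * pi)\<^sup>2 * (1/4) ^ j)"
      using K(4) by (intro mult_left_mono) auto
    also have "\<dots> = (2 * pi)\<^sup>2 * (2 ^ j * (1/4) ^ j)"
      by simp
    also have "2 ^ j * (1/4) ^ j = (1/2 :: real) ^ j"
      by (simp flip: power_mult_distrib)
    finally show ?thesis .
  qed
  have qsum: "summable (\<lambda>j. \<integral>x. q j x \<partial>torus)"
  proof (rule summable_comparison_test')
    show "summable (\<lambda>j. (2 * pi)\<^sup>2 * (1/2 :: real) ^ j)"
      by (intro summable_mult summable_geometric) simp
    show "norm (\<integral>x. q j x \<partial>torus) \<le> (2 * pi)\<^sup>2 * (1/2) ^ j" for j
      using qle[of j] q0 by simp
  qed
  have AEsum: "AE x in torus. summable (\<lambda>j. q j x)"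
  proof -
    have meas: "(\<lambda>x. ennreal (q j x)) \<in> borel_measurable torus" for j
      using qint by (intro measurable_compose[OF borel_measurable_integrable measurable_ennreal])
    have "(\<integral>\<^sup>+x. (\<Sum>j. ennreal (q j x)) \<partial>torus) = (\<Sum>j. \<integral>\<^sup>+x. ennreal (q j x) \<partial>torus)"
      by (intro nn_integral_suminf meas)
    also have "\<dots> = (\<Sum>j. ennreal (\<integral>x. q j x \<partial>torus))"
      by (subst nn_integral_eq_integral[OF qint]) (simp_all add: q0)
    also have "\<dots> \<noteq> \<infinity>"
      unfolding infinity_ennreal_def by (rule ennreal_suminf_neq_top[OF qsum]) (simp add: q0)
    finally have "(\<integral>\<^sup>+x. (\<Sum>j. ennreal (q j x)) \<partial>torus) \<noteq> \<infinity>" .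
    moreover have "(\<lambda>x. \<Sum>j. ennreal (q j x)) \<in> borel_measurable torus"
      using meas by measurable
    ultimately have "AE x in torus. (\<Sum>j. ennreal (q j x)) \<noteq> \<infinity>"
      by (intro nn_integral_PInf_AE)
    then show ?thesis
    proof eventually_elim
      case (elim x)
      show ?case by (rule summable_suminf_not_top) (use elim q0 in auto)
    qed
  qed
  have Hint: "integrable torus H"
    unfolding H_def by (rule integrable_suminf) (use qint AEsum qsum q0 in simp_all)
  have H0: "0 \<le> H x" if "summable (\<lambda>j. q j x)" for x
    unfolding H_def using that q0 by (intro suminf_nonneg)
  have Smeas: "S j \<in> borel_measurable torus" for j
    unfolding S_def by (rule trig_sum_measurable)
  have fmeas: "f \<in> borel_measurable torus"
    unfolding f_def by (rule borel_measurable_lim_metric[OF Smeas])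
  have Hmeas: "H \<in> borel_measurable torus" using Hint by (rule borel_measurable_integrable)
  have wmeas: "w \<in> borel_measurable torus"
    unfolding w_def using Smeas Hmeas by measurable
  have conv: "AE x in torus. (\<lambda>j. S j x) \<longlonglongrightarrow> f x \<and> (\<forall>j. cmod (S j x) \<le> w x) \<and> (w x)\<^sup>2 \<le> 2 * (cmod (S 0 x))\<^sup>2 + 4 * H x"
    using AEsum
  proof eventually_elim
    case (elim x)
    have part: "(\<Sum>i<j. cmod (d i x)) \<le> sqrt (2 * H x)" for j
    proof (rule real_le_rsqrt)
      have "(\<Sum>i<j. cmod (d i x))\<^sup>2 = (\<Sum>i<j. sqrt ((1/2) ^ i) * sqrt (q i x))\<^sup>2"
        by (intro arg_cong[where f = "\<lambda>x. x\<^sup>2"] sum.cong refl)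
           (simp add: q_def flip: real_sqrt_mult power_mult_distrib mult.assoc)
      also have "\<dots> \<le> (\<Sum>i<j. (sqrt ((1/2) ^ i))\<^sup>2) * (\<Sum>i<j. (sqrt (q i x))\<^sup>2)"
        by (rule Cauchy_Schwarz_ineq_sum)
      also have "\<dots> = (\<Sum>i<j. (1/2) ^ i) * (\<Sum>i<j. q i x)"
        using q0 by simp
      also have "\<dots> \<le> 2 * H x"
      proof (rule mult_mono)
        show "(\<Sum>i<j. (1/2) ^ i) \<le> (2::real)"
          by (simp add: sum_gp_strict)
        show "(\<Sum>i<j. q i x) \<le> H x"
          unfolding H_def by (rule sum_le_suminf[OF elim]) (auto simp: q0)
      qed (auto intro!: sum_nonneg q0)
      finally show "(\<Sum>i<j. cmod (d i x))\<^sup>2 \<le> 2 * H x" .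
    qed
    have "summable (\<lambda>i. cmod (d i x))"
      by (rule summableI_nonneg_bounded[OF _ part]) simp
    then have "(\<lambda>j. \<Sum>i<j. d i x) \<longlonglongrightarrow> (\<Sum>i. d i x)"
      by (rule summable_LIMSEQ[OF summable_norm_cancel])
    then have "(\<lambda>j. S 0 x + (\<Sum>i<j. d i x)) \<longlonglongrightarrow> S 0 x + (\<Sum>i. d i x)"
      by (rule tendsto_add[OF tendsto_const])
    moreover have "(\<lambda>j. S j x) = (\<lambda>j. S 0 x + (\<Sum>i<j. d i x))"
      by (rule ext) (rule Sd)
    ultimately have "(\<lambda>j. S j x) \<longlonglongrightarrow> S 0 x + (\<Sum>i. d i x)"
      by (rule ssubst[rotated])
    then have "(\<lambda>j. S j x) \<longlonglongrightarrow> f x"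
      unfolding f_def by (simp add: limI)
    moreover have "cmod (S j x) \<le> w x" for j
    proof -
      have "cmod (S j x) \<le> cmod (S 0 x) + cmod (\<Sum>i<j. d i x)"
        unfolding Sd[of j x] by (rule norm_triangle_ineq)
      also have "cmod (\<Sum>i<j. d i x) \<le> (\<Sum>i<j. cmod (d i x))" by (rule norm_sum)
      also have "\<dots> \<le> sqrt (2 * H x)" by (rule part)
      finally show ?thesis by (simp add: w_def)
    qed
    moreover have "(w x)\<^sup>2 \<le> 2 * (cmod (S 0 x))\<^sup>2 + 4 * H x"
    proof -
      have "(w x)\<^sup>2 \<le> 2 * (cmod (S 0 x))\<^sup>2 + 2 * (sqrt (2 * H x))\<^sup>2"
        using zero_le_power2[of "cmod (S 0 x) - sqrt (2 * H x)"]
        unfolding w_def by (simp add: power2_eq_square algebra_simps)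
      also have "(sqrt (2 * H x))\<^sup>2 = 2 * H x" using H0[OF elim] by simp
      finally show ?thesis by simp
    qed
    ultimately show ?case by blast
  qed
  have S0int: "integrable torus (\<lambda>x. (cmod (S 0 x))\<^sup>2)"
    unfolding S_def by (intro torus_L2_square_integrable trig_sum_torus_L2)
  have wint: "integrable torus (\<lambda>x. (w x)\<^sup>2)"
  proof (rule Bochner_Integration.integrable_bound)
    show "integrable torus (\<lambda>x. 2 * (cmod (S 0 x))\<^sup>2 + 4 * H x)"
      by (intro Bochner_Integration.integrable_add integrable_mult_right Hint S0int)
    show "(\<lambda>x. (w x)\<^sup>2) \<in> borel_measurable torus"
      by (intro borel_measurable_power wmeas)
    show "AE x in torus. norm ((w x)\<^sup>2) \<le> norm (2 * (cmod (S 0 x))\<^sup>2 + 4 * H x)"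
      using conv by eventually_elim (auto intro: order_trans[OF _ abs_ge_self])
  qed
  have fle: "AE x in torus. cmod (f x) \<le> w x"
    using conv
  proof eventually_elim
    case (elim x)
    then have "(\<lambda>j. cmod (S j x)) \<longlonglongrightarrow> cmod (f x)" by (intro tendsto_norm) simp
    then show ?case by (rule LIMSEQ_le_const2) (use elim in auto)
  qed
  have fL2: "f \<in> torus_L2"
  proof -
    have "integrable torus (\<lambda>x. (cmod (f x))\<^sup>2)"
    proof (rule Bochner_Integration.integrable_bound[OF wint])
      show "(\<lambda>x. (cmod (f x))\<^sup>2) \<in> borel_measurable torus"
        using fmeas by measurable
      show "AE x in torus. norm ((cmod (f x))\<^sup>2) \<le> norm ((w x)\<^sup>2)"
        using fle by eventually_elim (simp add: power_mono)
    qed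
    then show ?thesis using fmeas by (simp add: torus_L2_def)
  qed
  show thesis
  proof (rule that[OF K(1) _ K(3) fL2])
    show "incseq K" using K(2) by (rule incseq_SucI)
    fix h assume h: "h \<in> torus_L2"
    have "(\<lambda>j. \<integral>x. S j x * h x \<partial>torus) \<longlonglongrightarrow> (\<integral>x. f x * h x \<partial>torus)"
    proof (rule integral_dominated_convergence[where w = "\<lambda>x. (w x)\<^sup>2 + (cmod (h x))\<^sup>2"])
      show "(\<lambda>x. f x * h x) \<in> borel_measurable torus"
        by (intro borel_measurable_times fmeas torus_L2_measurable h)
      show "(\<lambda>x. S j x * h x) \<in> borel_measurable torus" for j
        by (intro borel_measurable_times Smeas torus_L2_measurable h)
      show "integrable torus (\<lambda>x. (w x)\<^sup>2 + (cmod (h x))\<^sup>2)"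
        by (intro Bochner_Integration.integrable_add wint torus_L2_square_integrable h)
      show "AE x in torus. (\<lambda>j. S j x * h x) \<longlonglongrightarrow> f x * h x"
        using conv by eventually_elim (intro tendsto_mult tendsto_const, blast)
      show "AE x in torus. cmod (S j x * h x) \<le> (w x)\<^sup>2 + (cmod (h x))\<^sup>2" for j
        using conv
      proof eventually_elim
        case (elim x)
        have "cmod (S j x * h x) \<le> w x * cmod (h x)"
          using elim by (simp add: norm_mult mult_right_mono)
        also have "\<dots> \<le> (w x)\<^sup>2 + (cmod (h x))\<^sup>2" by (rule mult_le_sum_squares)
        finally show ?case .
      qed
    qed
    then show "(\<lambda>j. \<integral>x. trig_sum c (K j) x * h x \<partial>torus) \<longlonglongrightarrow> (\<integral>x. f x * h x \<partial>torus)"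
      by (simp add: S_def)
  qed
qed

lemma fourier_coeff_reflect: 
  assumes "\<And>x. f x \<in> \<real>"
  shows "fourier_coeff f (- k) = cnj (fourier_coeff f k)"
proof -
  have "(\<integral>x. f x * character k x \<partial>torus) = (\<integral>x. cnj (f x * character (- k) x) \<partial>torus)"
    by (rule Bochner_Integration.integral_cong) (use assms in \<open>auto simp: character_minus Reals_cnj_iff\<close>)
  then show ?thesis by (simp only: fourier_coeff_character Bochner_Integration.integral_cnj minus_minus complex_cnj_divide complex_cnj_complex_of_real)
qed

text \<open>Integrating the partial sums against \<open>g * character (- k)\<close> gives partial sums of the convolution; so the function built from \<open>c\<close>
  comes with its product formula, before uniqueness is known to make this a property of \<open>c\<close> alone.\<close>

lemma fourier_coeff_surj_square_summable:
  assumes c: "Sobolev_le 0 B c"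
  obtains f where "f \<in> torus_L2" "fourier_coeff f = c"
    "\<And>g k. \<lbrakk>g \<in> torus_L2; (\<lambda>l. c l * fourier_coeff g (k - l)) summable_on UNIV\<rbrakk> \<Longrightarrow>
       fourier_coeff (\<lambda>x. f x * g x) k = (\<Sum>\<^sub>\<infinity>l. c l * fourier_coeff g (k - l))"
proof -
  obtain K :: "nat \<Rightarrow> (int \<times> int) set" and f 
    where K: "\<And>j. finite (K j)" "incseq K" "(\<Union>j. K j) = UNIV" and f: "f \<in> torus_L2"
      and lim: "\<And>h. h \<in> torus_L2 \<Longrightarrow> (\<lambda>j. \<integral>x. trig_sum c (K j) x * h x \<partial>torus) \<longlonglongrightarrow> (\<integral>x. f x * h x \<partial>torus)"
    using Riesz_Fischer[OF c] by blast
  have ev: "\<forall>\<^sub>F j in sequentially. k \<in> K j" for k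
  proof -
    obtain j0 where "k \<in> K j0" using K(3) by blast
    then have "k \<in> K j" if "j \<ge> j0" for j
      using incseqD[OF K(2) that] by blast
    then show ?thesis by (auto simp: eventually_sequentially)
  qed
  have Klim: "filterlim K (finite_subsets_at_top UNIV) sequentially"
    unfolding filterlim_finite_subsets_at_top
  proof (intro allI impI, elim conjE)
    fix X :: "(int \<times> int) set" assume X: "finite X" "X \<subseteq> UNIV"
    have "\<forall>\<^sub>F j in sequentially. \<forall>k\<in>X. k \<in> K j"
      using X by (intro eventually_ball_finite) (auto intro: ev)
    then show "\<forall>\<^sub>F j in sequentially. finite (K j) \<and> X \<subseteq> K j \<and> K j \<subseteq> UNIV"
      by eventually_elim (auto simp: K)
  qed
  show thesis
  proof (rule that[OF f])
    show "fourier_coeff f = c"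
    proof
      fix k
      have "(\<lambda>j. \<integral>x. trig_sum c (K j) x * character (- k) x \<partial>torus) \<longlonglongrightarrow> (\<integral>x. f x * character (- k) x \<partial>torus)"
        by (rule lim[OF character_torus_L2])
      moreover have "\<forall>\<^sub>F j in sequentially. (\<integral>x. trig_sum c (K j) x * character (- k) x \<partial>torus) = complex_of_real ((2 * pi)\<^sup>2) * c k"
        using ev[of k] by eventually_elim (simp only: integral_mult_character fourier_coeff_trig_sum K minus_minus if_True)
      then have "(\<lambda>j. \<integral>x. trig_sum c (K j) x * character (- k) x \<partial>torus) \<longlonglongrightarrow> complex_of_real ((2 * pi)\<^sup>2) * c k"
        by (rule tendsto_eventually)
      ultimately have "(\<integral>x. f x * character (- k) x \<partial>torus) = complex_of_real ((2 * pi)\<^sup>2) * c k"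
        by (rule LIMSEQ_unique)
      then show "fourier_coeff f k = c k"
        unfolding fourier_coeff_character using two_pi_square_nonzero by simp
    qed
    fix g k assume g: "g \<in> torus_L2" and sm: "(\<lambda>l. c l * fourier_coeff g (k - l)) summable_on UNIV"
    define h where "h = (\<lambda>x. g x * character (- k) x)"
    have h: "h \<in> torus_L2" unfolding h_def by (rule torus_L2_mult_character[OF g])
    have hl: "fourier_coeff h (- l) = fourier_coeff g (k - l)" for l
      unfolding fourier_coeff_character h_def by (simp add: mult.assoc flip: character_add)
    have "(\<lambda>j. \<integral>x. trig_sum c (K j) x * h x \<partial>torus) \<longlonglongrightarrow> (\<integral>x. f x * h x \<partial>torus)"
      by (rule lim[OF h])
    moreover have "(\<lambda>j. \<integral>x. trig_sum c (K j) x * h x \<partial>torus) 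
        \<longlonglongrightarrow> complex_of_real ((2 * pi)\<^sup>2) * (\<Sum>\<^sub>\<infinity>l. c l * fourier_coeff g (k - l))"
      unfolding integral_trig_sum_mult[OF h] hl
      by (rule tendsto_mult[OF tendsto_const filterlim_compose[OF infsum_tendsto[OF sm] Klim]])
    ultimately have "(\<integral>x. f x * h x \<partial>torus) = complex_of_real ((2 * pi)\<^sup>2) * (\<Sum>\<^sub>\<infinity>l. c l * fourier_coeff g (k - l))"
      by (rule LIMSEQ_unique)
    then show "fourier_coeff (\<lambda>x. f x * g x) k = (\<Sum>\<^sub>\<infinity>l. c l * fourier_coeff g (k - l))"
      unfolding fourier_coeff_character h_def using two_pi_square_nonzero by (simp add: mult.assoc)
  qed
qed

lemma conv_summable:
  assumes a: "Sobolev_le 0 A a" and b: "Sobolev_le 0 B b"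
  shows "(\<lambda>l. a l * b (k - l)) summable_on UNIV"
proof -
  have "(\<lambda>l. cmod (a l * b (k - l))) summable_on UNIV"
  proof (rule nonneg_bdd_above_summable_on)
    show "bdd_above (sum (\<lambda>l. cmod (a l * b (k - l))) ` {F. F \<subseteq> UNIV \<and> finite F})"
    proof (rule bdd_aboveI2[where M = "A * B"])
      fix F assume "F \<in> {F :: (int \<times> int) set. F \<subseteq> UNIV \<and> finite F}"
      then have F: "finite F" by simp
      have a2: "L2_set (\<lambda>l. cmod (a l)) F \<le> A"
        using Sobolev_leD[OF a, of F] by simp
      have "L2_set (\<lambda>l. cmod (b (k - l))) F = L2_set (\<lambda>l. cmod (b l)) ((\<lambda>l. k - l) ` F)"
        unfolding L2_set_def by (subst sum.reindex) (auto simp: inj_on_def)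
      then have b2: "L2_set (\<lambda>l. cmod (b (k - l))) F \<le> B"
        using Sobolev_leD[OF b, of "(\<lambda>l. k - l) ` F"] by simp
      have "(\<Sum>l\<in>F. cmod (a l * b (k - l))) = (\<Sum>l\<in>F. \<bar>cmod (a l)\<bar> * \<bar>cmod (b (k - l))\<bar>)"
        by (simp add: norm_mult)
      also have "\<dots> \<le> L2_set (\<lambda>l. cmod (a l)) F * L2_set (\<lambda>l. cmod (b (k - l))) F"
        by (rule L2_set_mult_ineq)
      also have "\<dots> \<le> A * B"
        using a2 b2 Sobolev_le_nonneg[OF a] by (intro mult_mono) auto
      finally show "(\<Sum>l\<in>F. cmod (a l * b (k - l))) \<le> A * B" .
    qed
  qed auto
  then show ?thesis by (rule abs_summable_summable)
qed

text \<open>Uniqueness of Fourier coefficients identifies an arbitrary square integrable function with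
  the limit provided by the Riesz-Fischer theorem, for which the product formula is a limit of
  finite sums.\<close>

theorem fourier_coeff_mult:
  assumes f: "f \<in> torus_L2" "Sobolev_le 0 A (fourier_coeff f)"
    and g: "g \<in> torus_L2" "Sobolev_le 0 B (fourier_coeff g)"
  shows "fourier_coeff (\<lambda>x. f x * g x) = conv (fourier_coeff f) (fourier_coeff g)"
proof -
  obtain f' where f': "f' \<in> torus_L2" "fourier_coeff f' = fourier_coeff f"
    and prod: "\<And>g k. \<lbrakk>g \<in> torus_L2; (\<lambda>l. fourier_coeff f l * fourier_coeff g (k - l)) summable_on UNIV\<rbrakk> \<Longrightarrow>
       fourier_coeff (\<lambda>x. f' x * g x) k = (\<Sum>\<^sub>\<infinity>l. fourier_coeff f l * fourier_coeff g (k - l))"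
    using fourier_coeff_surj_square_summable[OF f(2)] by blast
  have eq: "AE x in torus. f x = f' x"
    by (intro AE_eq_if_fourier_coeff_eq torus_L2_integrable f(1) f'(1)) (simp add: f')
  have "fourier_coeff (\<lambda>x. f x * g x) k = fourier_coeff (\<lambda>x. f' x * g x) k" for k
  proof -
    have "(\<integral>x. f x * g x * character (- k) x \<partial>torus) = (\<integral>x. f' x * g x * character (- k) x \<partial>torus)"
      by (intro integral_cong_AE borel_measurable_times character_torus torus_L2_measurable f(1) f'(1) g(1))
         (use eq in eventually_elim, simp)
    then show ?thesis by (simp only: fourier_coeff_character)
  qed
  then show ?thesis
    unfolding conv_def using prod[OF g(1) conv_summable[OF f(2) g(2)]] by auto
qed

section \<open>The cubic nonlinearity as a convolution\<close>

text \<open>The Fourier coefficients of the pointwise real part.\<close>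

definition real_part :: "torus_dist \<Rightarrow> torus_dist" where
  "real_part c = (\<lambda>k. (c k + cnj (c (- k))) / 2)"

lemma Sobolev_le_real_part:
  assumes "Sobolev_le s B c"
  shows "Sobolev_le s B (real_part c)"
proof -
  have "Sobolev_le s (cmod (1/2) * (B + B)) (\<lambda>k. (1/2) * (c k + cnj (c (- k))))"
    by (intro Sobolev_le_scale Sobolev_le_add Sobolev_le_reflect_cnj assms)
  then show ?thesis by (simp add: real_part_def)
qed

lemma fourier_coeff_Re:
  assumes "f \<in> torus_L2"
  shows "fourier_coeff (\<lambda>x. complex_of_real (Re (f x))) = real_part (fourier_coeff f)"
proof
  fix k
  have eq: "complex_of_real (Re (f x)) * character (- k) x
      = (1/2) * (f x * character (- k) x) + (1/2) * cnj (f x * character k x)" for x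
    by (simp add: character_minus complex_eq_iff field_simps)
  have int: "integrable torus (\<lambda>x. f x * character k x)" for k
    by (intro integrable_mult_character torus_L2_integrable assms)
  have "(\<integral>x. complex_of_real (Re (f x)) * character (- k) x \<partial>torus)
     = (1/2) * (\<integral>x. f x * character (- k) x \<partial>torus) + (1/2) * cnj (\<integral>x. f x * character k x \<partial>torus)"
    unfolding eq
    by (simp only: Bochner_Integration.integral_add[OF integrable_mult_right[OF int]
          integrable_mult_right[OF integrable_cnj[OF int]]] integral_mult_right_zero Bochner_Integration.integral_cnj)
  then have "fourier_coeff (\<lambda>x. complex_of_real (Re (f x))) k
     = ((1/2) * (\<integral>x. f x * character (- k) x \<partial>torus) + (1/2) * cnj (\<integral>x. f x * character k x \<partial>torus)) / complex_of_real ((2 * pi)\<^sup>2)"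
    by (simp only: fourier_coeff_character)
  also have "\<dots> = real_part (fourier_coeff f) k"
    unfolding integral_mult_character real_part_def using two_pi_square_nonzero
    by (simp add: field_simps)
  finally show "fourier_coeff (\<lambda>x. complex_of_real (Re (f x))) k = real_part (fourier_coeff f) k" .
qed

lemma torus_fun:
  assumes "Sobolev_le 0 B c"
  shows "torus_fun c \<in> torus_L2" "fourier_coeff (torus_fun c) = c"
proof -
  have "\<exists>f. f \<in> torus_L2 \<and> fourier_coeff f = c"
    using fourier_coeff_surj_square_summable[OF assms] by metis
  then have "torus_fun c \<in> torus_L2 \<and> fourier_coeff (torus_fun c) = c"
    unfolding torus_fun_def by (rule someI_ex)
  then show "torus_fun c \<in> torus_L2" "fourier_coeff (torus_fun c) = c" by auto
qed

definition cube :: "torus_dist \<Rightarrow> torus_dist" where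
  "cube a = conv (conv a a) a"

text \<open>For \<open>c\<close> in \<open>H\<^sup>1\<^sup>/\<^sup>2\<close> the square of the real part has square summable coefficients by the product
  estimate, hence is square integrable by uniqueness of Fourier coefficients; this is the embedding
  of \<open>H\<^sup>1\<^sup>/\<^sup>2\<close> into \<open>L\<^sup>4\<close>, and it makes the product formula applicable a second time.\<close>

theorem Re_cubed_eq_cube:
  assumes c: "Sobolev_le (1/2) B c"
  shows "Re_cubed c = cube (real_part c)"
proof -
  define \<rho> where "\<rho> = real_part c"
  define r where "r = (\<lambda>x. complex_of_real (Re (torus_fun c x)))"
  have c0: "Sobolev_le 0 B c" using c by (rule Sobolev_le_weaken) auto
  have \<rho>: "Sobolev_le (1/2) B \<rho>" unfolding \<rho>_def using c by (rule Sobolev_le_real_part)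
  then have \<rho>0: "Sobolev_le 0 B \<rho>" by (rule Sobolev_le_weaken) auto
  have tf: "torus_fun c \<in> torus_L2" "fourier_coeff (torus_fun c) = c"
    using torus_fun[OF c0] by auto
  have rc: "fourier_coeff r = \<rho>"
    unfolding r_def \<rho>_def using fourier_coeff_Re[OF tf(1)] tf(2) by simp
  have rmeas: "r \<in> borel_measurable torus"
    unfolding r_def using torus_L2_measurable[OF tf(1)] by measurable
  have r: "r \<in> torus_L2"
  proof -
    have "integrable torus (\<lambda>x. (cmod (r x))\<^sup>2)"
    proof (rule Bochner_Integration.integrable_bound[OF torus_L2_square_integrable[OF tf(1)]])
      show "(\<lambda>x. (cmod (r x))\<^sup>2) \<in> borel_measurable torus" using rmeas by measurable
      show "AE x in torus. norm ((cmod (r x))\<^sup>2) \<le> norm ((cmod (torus_fun c x))\<^sup>2)"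
        by (intro AE_I2) (simp add: r_def cmod_power2)
    qed
    then show ?thesis using rmeas by (simp add: torus_L2_def)
  qed
  define q where "q = (\<lambda>x. r x * r x)"
  have qc: "fourier_coeff q = conv \<rho> \<rho>"
    unfolding q_def using fourier_coeff_mult[OF r _ r] rc \<rho>0 by simp
  obtain C where "C > 0" 
    and C: "\<And>A B a b. \<lbrakk>Sobolev_le (1/2) A a; Sobolev_le (1/2) B b\<rbrakk> \<Longrightarrow> Sobolev_le (- 0) (C * A * B) (conv a b)"
    by (rule product_estimate[of "1/2" "1/2" 0]) auto
  have q0: "Sobolev_le 0 (C * B * B) (conv \<rho> \<rho>)"
    using C[OF \<rho> \<rho>] by simp
  have q: "q \<in> torus_L2"
  proof -
    obtain h where h: "h \<in> torus_L2" "fourier_coeff h = conv \<rho> \<rho>"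
      using torus_fun[OF q0] by blast
    have qint: "integrable torus q"
      unfolding q_def by (rule torus_L2_mult_integrable[OF r r])
    have "AE x in torus. q x = h x"
      by (rule AE_eq_if_fourier_coeff_eq[OF qint torus_L2_integrable[OF h(1)]]) (simp add: qc h)
    then have AE: "AE x in torus. (cmod (h x))\<^sup>2 = (cmod (q x))\<^sup>2"
      by eventually_elim simp
    have qm: "q \<in> borel_measurable torus" using qint by (rule borel_measurable_integrable)
    have "integrable torus (\<lambda>x. (cmod (q x))\<^sup>2)"
    proof (rule integrable_cong_AE_imp[OF torus_L2_square_integrable[OF h(1)]])
      show "(\<lambda>x. (cmod (q x))\<^sup>2) \<in> borel_measurable torus" using qm by measurable
    qed (rule AE)
    then show ?thesis using qm by (simp add: torus_L2_def)
  qed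
  have "fourier_coeff (\<lambda>x. q x * r x) = conv (conv \<rho> \<rho>) \<rho>"
    using fourier_coeff_mult[OF q _ r] q0 \<rho>0 by (simp add: qc rc)
  moreover have "(\<lambda>x. q x * r x) = (\<lambda>x. complex_of_real ((Re (torus_fun c x)) ^ 3))"
    by (simp add: q_def r_def power3_eq_cube)
  ultimately show ?thesis
    by (simp add: Re_cubed_def cube_def \<rho>_def)
qed

lemma Re_cubed_reflect: "Re_cubed c (- k) = cnj (Re_cubed c k)"
  unfolding Re_cubed_def by (rule fourier_coeff_reflect) simp

section \<open>Trilinear estimates and differences of cubes\<close>

lemma conv_commute: "conv a b = conv b a"
proof
  fix k
  have "(\<Sum>\<^sub>\<infinity>l. a l * b (k - l)) = (\<Sum>\<^sub>\<infinity>l. b l * a (k - l))"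
    by (rule infsum_reindex_bij_witness[where i = "\<lambda>l. k - l" and j = "\<lambda>l. k - l"]) auto
  then show "conv a b k = conv b a k" by (simp add: conv_def)
qed

lemma conv_diff_left:
  assumes "Sobolev_le 0 A a" "Sobolev_le 0 B b" "Sobolev_le 0 D d"
  shows "conv (\<lambda>k. a k - b k) d = (\<lambda>k. conv a d k - conv b d k)"
proof
  fix k
  have "(\<Sum>\<^sub>\<infinity>l. a l * d (k - l) + (- (b l * d (k - l)))) = (\<Sum>\<^sub>\<infinity>l. a l * d (k - l)) + (\<Sum>\<^sub>\<infinity>l. - (b l * d (k - l)))"
    by (intro infsum_add summable_on_uminus[THEN iffD2] conv_summable[OF assms(1,3)] conv_summable[OF assms(2,3)])
  then show "conv (\<lambda>k. a k - b k) d k = conv a d k - conv b d k"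
    by (simp add: conv_def left_diff_distrib infsum_uminus)
qed

lemma conv_diff_right:
  assumes "Sobolev_le 0 A a" "Sobolev_le 0 B b" "Sobolev_le 0 D d"
  shows "conv d (\<lambda>k. a k - b k) = (\<lambda>k. conv d a k - conv d b k)"
  using conv_diff_left[OF assms] by (simp add: conv_commute[of d])

definition triple :: "torus_dist \<Rightarrow> torus_dist \<Rightarrow> torus_dist \<Rightarrow> torus_dist" where
  "triple a b c = conv (conv a b) c"

lemma cube_triple: "cube a = triple a a a"
  by (simp add: cube_def triple_def)

lemma triple_commute: "triple a b c = triple b a c"
  by (simp add: triple_def conv_commute[of a b])

definition product_bound :: "real \<Rightarrow> real \<Rightarrow> real \<Rightarrow> real \<Rightarrow> bool" where
  "product_bound p q t C \<longleftrightarrow> C > 0 \<and>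
     (\<forall>A B a b. Sobolev_le p A a \<longrightarrow> Sobolev_le q B b \<longrightarrow> Sobolev_le t (C * A * B) (conv a b))"

definition triple_bound :: "real \<Rightarrow> real \<Rightarrow> real \<Rightarrow> real \<Rightarrow> real \<Rightarrow> bool" where
  "triple_bound p q r t C \<longleftrightarrow> C > 0 \<and>
     (\<forall>A B D a b d. Sobolev_le p A a \<longrightarrow> Sobolev_le q B b \<longrightarrow> Sobolev_le r D d \<longrightarrow> 
        Sobolev_le t (C * A * B * D) (triple a b d))"

lemma product_bound_exists:
  assumes "p + q - t \<ge> 1"
    and "p + q \<ge> 0" "p + q = 0 \<Longrightarrow> t < -1"
    and "p \<ge> t" "p = t \<Longrightarrow> q > 1"
    and "q \<ge> t" "q = t \<Longrightarrow> p > 1"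
  shows "\<exists>C. product_bound p q t C"
proof -
  obtain C where "C > 0" 
    "\<And>A B a b. \<lbrakk>Sobolev_le p A a; Sobolev_le q B b\<rbrakk> \<Longrightarrow> Sobolev_le (- (- t)) (C * A * B) (conv a b)"
    by (rule product_estimate[of p q "- t"]) (use assms in auto)
  then show ?thesis unfolding product_bound_def by auto
qed

lemma triple_bound_compose:
  assumes "product_bound p q m C1" "product_bound m r t C2"
  shows "triple_bound p q r t (C2 * C1)"
  unfolding triple_bound_def
proof (intro conjI allI impI)
  show "C2 * C1 > 0" using assms by (simp add: product_bound_def)
  fix A B D a b d
  assume a: "Sobolev_le p A a" "Sobolev_le q B b" "Sobolev_le r D d"
  then have "Sobolev_le m (C1 * A * B) (conv a b)"
    using assms(1) unfolding product_bound_def by blast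
  then have "Sobolev_le t (C2 * (C1 * A * B) * D) (conv (conv a b) d)"
    using a(3) assms(2) unfolding product_bound_def by blast
  then show "Sobolev_le t (C2 * C1 * A * B * D) (triple a b d)"
    by (simp add: triple_def mult_ac)
qed

lemma triple_bound_mono:
  assumes "triple_bound p q r t C" "C \<le> C'"
  shows "triple_bound p q r t C'"
  unfolding triple_bound_def
proof (intro conjI allI impI)
  show "C' > 0" using assms by (simp add: triple_bound_def)
  fix A B D a b d
  assume a: "Sobolev_le p A a" "Sobolev_le q B b" "Sobolev_le r D d"
  then have "Sobolev_le t (C * A * B * D) (triple a b d)"
    using assms(1) unfolding triple_bound_def by blast
  moreover have "C * A * B * D \<le> C' * A * B * D"
    using a[THEN Sobolev_le_nonneg] assms(2) by (intro mult_right_mono) auto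
  ultimately show "Sobolev_le t (C' * A * B * D) (triple a b d)"
    by (rule Sobolev_le_mono)
qed

lemma triple_boundD:
  "\<lbrakk>triple_bound p q r t C; Sobolev_le p A a; Sobolev_le q B b; Sobolev_le r D d\<rbrakk>
     \<Longrightarrow> Sobolev_le t (C * A * B * D) (triple a b d)"
  unfolding triple_bound_def by blast

lemma triple_boundD_commute:
  "\<lbrakk>triple_bound p q r t C; Sobolev_le p A a; Sobolev_le q B b; Sobolev_le r D d\<rbrakk>
     \<Longrightarrow> Sobolev_le t (C * A * B * D) (triple b a d)"
  using triple_boundD triple_commute by metis

lemma conv_half_half:
  assumes "Sobolev_le (1/2) A a" "Sobolev_le (1/2) B b"
  obtains C where "Sobolev_le 0 C (conv a b)"
proof -
  have "\<exists>C. product_bound (1/2) (1/2) 0 C" by (rule product_bound_exists) auto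
  then show thesis using assms that unfolding product_bound_def by blast
qed

lemma half_imp_0: "Sobolev_le (1/2) A a \<Longrightarrow> Sobolev_le 0 A a"
  by (rule Sobolev_le_weaken) auto

lemma triple_diff1:
  assumes "Sobolev_le (1/2) A a" "Sobolev_le (1/2) A' a'" "Sobolev_le (1/2) B b" "Sobolev_le (1/2) D d"
  shows "triple (\<lambda>k. a k - a' k) b d = (\<lambda>k. triple a b d k - triple a' b d k)"
proof -
  obtain C C' where "Sobolev_le 0 C (conv a b)" "Sobolev_le 0 C' (conv a' b)"
    using conv_half_half assms by metis
  then show ?thesis
    unfolding triple_def conv_diff_left[OF assms(1-3)[THEN half_imp_0]]
    by (rule conv_diff_left[OF _ _ half_imp_0[OF assms(4)]])
qed

lemma triple_diff2:
  assumes "Sobolev_le (1/2) A a" "Sobolev_le (1/2) A' a'" "Sobolev_le (1/2) B b" "Sobolev_le (1/2) D d"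
  shows "triple b (\<lambda>k. a k - a' k) d = (\<lambda>k. triple b a d k - triple b a' d k)"
  using triple_diff1[OF assms] by (simp add: triple_commute[of b])

lemma triple_diff3:
  assumes "Sobolev_le (1/2) A a" "Sobolev_le (1/2) A' a'" "Sobolev_le (1/2) B b" "Sobolev_le (1/2) D d"
  shows "triple b d (\<lambda>k. a k - a' k) = (\<lambda>k. triple b d a k - triple b d a' k)"
proof -
  obtain C where "Sobolev_le 0 C (conv b d)"
    using conv_half_half assms by metis
  then show ?thesis
    unfolding triple_def by (rule conv_diff_right[OF assms(1,2)[THEN half_imp_0]])
qed

text \<open>All differences of cubes are taken of elements of \<open>H\<^sup>1\<^sup>/\<^sup>2\<close>, where the triple product is
  additive in each argument; the size of the difference is measured in a weaker or stronger norm
  \<open>H\<^sup>\<sigma>\<close>, depending on the powers of the time increment that are to be gained.\<close>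

lemma cube_diff_estimate:
  assumes C1: "triple_bound \<sigma> s s t C" and C2: "triple_bound s s \<sigma> t C"
    and s: "1/2 \<le> s"
    and a: "Sobolev_le s M a" and b: "Sobolev_le s M b" and d: "Sobolev_le \<sigma> E (\<lambda>k. a k - b k)"
  shows "Sobolev_le t (3 * C * M\<^sup>2 * E) (\<lambda>k. cube a k - cube b k)"
proof -
  have a': "Sobolev_le (1/2) M a" and b': "Sobolev_le (1/2) M b"
    using a b s by (auto intro: Sobolev_le_weaken)
  let ?d = "\<lambda>k. a k - b k"
  have "Sobolev_le t (C * E * M * M + C * E * M * M + C * M * M * E) 
      (\<lambda>k. triple ?d a a k + triple b ?d a k + triple b b ?d k)"
    by (intro Sobolev_le_add triple_boundD[OF C1 d a a] triple_boundD_commute[OF C1 d b a] triple_boundD[OF C2 b b d])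
  moreover have "triple ?d a a k + triple b ?d a k + triple b b ?d k = cube a k - cube b k" for k
    using triple_diff1[OF a' b' a' a'] triple_diff2[OF a' b' b' a'] triple_diff3[OF a' b' b' b']
    by (simp add: cube_triple)
  ultimately have "Sobolev_le t (C * E * M * M + C * E * M * M + C * M * M * E) (\<lambda>k. cube a k - cube b k)"
    by (rule Sobolev_le_cong)
  then show ?thesis
    by (rule Sobolev_le_mono) (simp add: power2_eq_square algebra_simps)
qed

text \<open>The second difference of the cube splits into the derivative applied to the second difference
  of the argument, which may be measured in a weak norm \<open>H\<^sup>\<sigma>\<close>, and terms that are quadratic in the
  increments, where one increment is measured in \<open>H\<^sup>1\<^sup>/\<^sup>2\<close> and the other in \<open>H\<^sup>q\<close>.\<close>

lemma cube_second_difference_estimate: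
  fixes w a b :: torus_dist
  assumes L1: "triple_bound \<sigma> s s t C" and L2: "triple_bound s s \<sigma> t C"
    and Q1: "triple_bound (1/2) s q t C" and Q2: "triple_bound (1/2) q s t C"
    and s: "1/2 \<le> s"
    and w: "Sobolev_le s M w" and a: "Sobolev_le s M a" and b: "Sobolev_le s M b"
    and da: "Sobolev_le (1/2) D (\<lambda>k. a k - w k)" "Sobolev_le q E (\<lambda>k. a k - w k)"
    and db: "Sobolev_le (1/2) D (\<lambda>k. b k - w k)" "Sobolev_le q E (\<lambda>k. b k - w k)"
    and dd: "Sobolev_le \<sigma> F (\<lambda>k. a k + b k - 2 * w k)"
  shows "Sobolev_le t (3 * C * M\<^sup>2 * F + 6 * C * M * D * E) (\<lambda>k. cube a k + cube b k - 2 * cube w k)"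
proof -
  have h: "Sobolev_le (1/2) M w" "Sobolev_le (1/2) M a" "Sobolev_le (1/2) M b"
    using w a b s by (auto intro: Sobolev_le_weaken)
  let ?L = "\<lambda>x k. triple x w w k + triple w x w k + triple w w x k"
  let ?Q = "\<lambda>x c k. triple x w x k + triple x x c k + triple x w x k"
  have expand: "cube c k = cube w k + ?L (\<lambda>k. c k - w k) k + ?Q (\<lambda>k. c k - w k) c k"
    if c: "Sobolev_le (1/2) M c" and d: "Sobolev_le (1/2) D (\<lambda>k. c k - w k)" for c k
    by (simp add: triple_diff1[OF c h(1) h(1) h(1)] triple_diff2[OF c h(1) h(1) h(1)] triple_diff3[OF c h(1) h(1) h(1)]
        triple_diff1[OF c h(1) h(1) d] triple_diff3[OF c h(1) c h(1)] triple_diff3[OF c h(1) h(1) h(1)]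
        triple_diff1[OF c h(1) d c] triple_diff2[OF c h(1) c c] triple_diff2[OF c h(1) h(1) c]
        cube_triple triple_commute[of w c])
  let ?dd = "\<lambda>k. a k + b k - 2 * w k"
  let ?nb = "\<lambda>k. w k - b k"
  have nb: "Sobolev_le (1/2) D ?nb"
    using Sobolev_le_uminus[OF db(1)] by simp
  have Ldd: "?L ?dd k = ?L (\<lambda>k. a k - w k) k + ?L (\<lambda>k. b k - w k) k" for k
    using triple_diff1[OF da(1) nb h(1) h(1), THEN fun_cong, of k] 
      triple_diff2[OF da(1) nb h(1) h(1), THEN fun_cong, of k] triple_diff3[OF da(1) nb h(1) h(1), THEN fun_cong, of k]
    by (simp add: triple_diff1[OF h(1) h(3) h(1) h(1)] triple_diff2[OF h(1) h(3) h(1) h(1)] triple_diff3[OF h(1) h(3) h(1) h(1)]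
        triple_diff1[OF h(3) h(1) h(1) h(1)] triple_diff2[OF h(3) h(1) h(1) h(1)] triple_diff3[OF h(3) h(1) h(1) h(1)])
  have Qb: "Sobolev_le t (C * D * M * E + C * D * E * M + C * D * M * E) (?Q x c)"
    if "Sobolev_le (1/2) D x" "Sobolev_le q E x" "Sobolev_le s M c" for x c
    by (intro Sobolev_le_add triple_boundD[OF Q1 that(1) w that(2)] triple_boundD[OF Q2 that])
  have "Sobolev_le t ((C * F * M * M + C * F * M * M + C * M * M * F) + 
      ((C * D * M * E + C * D * E * M + C * D * M * E) + (C * D * M * E + C * D * E * M + C * D * M * E)))
    (\<lambda>k. ?L ?dd k + (?Q (\<lambda>k. a k - w k) a k + ?Q (\<lambda>k. b k - w k) b k))"
    by (intro Sobolev_le_add Qb[OF da a, unfolded fun_eq_iff] Qb[OF db b] triple_boundD[OF L1 dd w w] triple_boundD_commute[OF L1 dd w w] 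
        triple_boundD[OF L2 w w dd])
  moreover have "?L ?dd k + (?Q (\<lambda>k. a k - w k) a k + ?Q (\<lambda>k. b k - w k) b k) = cube a k + cube b k - 2 * cube w k" for k
    unfolding Ldd expand[OF h(2) da(1), of k] expand[OF h(3) db(1), of k] by simp
  ultimately have "Sobolev_le t ((C * F * M * M + C * F * M * M + C * M * M * F) + 
      ((C * D * M * E + C * D * E * M + C * D * M * E) + (C * D * M * E + C * D * E * M + C * D * M * E)))
    (\<lambda>k. cube a k + cube b k - 2 * cube w k)"
    by (simp only:)
  then show ?thesis
    by (rule Sobolev_le_mono) (simp add: power2_eq_square algebra_simps)
qed

lemma triple_bound_exists:
  assumes "\<exists>C. product_bound p q m C" "\<exists>C. product_bound m r t C"
  shows "\<exists>C. triple_bound p q r t C"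
  using assms triple_bound_compose by blast

lemma triple_bound_common:
  assumes "\<exists>C. triple_bound p q r t C" "\<exists>C. triple_bound p' q' r' t' C"
  shows "\<exists>C. triple_bound p q r t C \<and> triple_bound p' q' r' t' C"
proof -
  obtain C C' where "triple_bound p q r t C" "triple_bound p' q' r' t' C'" using assms by blast
  then have "triple_bound p q r t (max C C')" "triple_bound p' q' r' t' (max C C')"
    by (auto elim: triple_bound_mono)
  then show ?thesis by blast
qed

text \<open>The product of three functions in \<open>H\<^sup>1\<^sup>/\<^sup>2\<close>, hence in \<open>L\<^sup>4\<close>, lies in \<open>L\<^sup>4\<^sup>/\<^sup>3\<close>, the dual of \<open>L\<^sup>4\<close>,
  and therefore in \<open>H\<^sup>-\<^sup>1\<^sup>/\<^sup>2\<close>.\<close>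

lemma triple_bound_critical: "\<exists>C. triple_bound (1/2) (1/2) (1/2) (-1/2) C"
  by (rule triple_bound_exists[where m = 0]; rule product_bound_exists) auto

section \<open>The half-wave flow\<close>

text \<open>Interpolation between the trivial bound and the bound by \<open>\<bar>\<theta>\<bar>\<close>; with \<open>\<theta> = t * jap k\<close> it trades \<open>p\<close>
  derivatives for \<open>\<bar>t\<bar>\<^sup>p\<close>.\<close>

lemma cmod_exp_minus_one_le:
  assumes "0 \<le> p" "p \<le> 1"
  shows "cmod (exp (\<i> * complex_of_real \<theta>) - 1) \<le> 2 * \<bar>\<theta>\<bar> powr p"
proof (cases "\<bar>\<theta>\<bar> \<ge> 1")
  case True
  have "cmod (exp (\<i> * complex_of_real \<theta>) - 1) \<le> 2 * 1"
    unfolding dist_exp_i_1 by (intro mult_left_mono abs_sin_le_one) auto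
  also have "\<dots> \<le> 2 * \<bar>\<theta>\<bar> powr p"
    using True assms by (intro mult_left_mono ge_one_powr_ge_zero) auto
  finally show ?thesis .
next
  case False
  have "cmod (exp (\<i> * complex_of_real \<theta>) - 1) \<le> \<bar>\<theta>\<bar>"
    unfolding dist_exp_i_1 using abs_sin_x_le_abs_x[of "\<theta> / 2"] by simp
  also have "\<bar>\<theta>\<bar> \<le> \<bar>\<theta>\<bar> powr p"
    using False assms powr_mono'[of p 1 "\<bar>\<theta>\<bar>"] by simp
  finally show ?thesis using powr_ge_zero[of "\<bar>\<theta>\<bar>" p] by linarith
qed

lemma cmod_exp_second_difference_le:
  assumes "0 \<le> p" "p \<le> 2"
  shows "cmod (exp (\<i> * complex_of_real \<theta>) + exp (- \<i> * complex_of_real \<theta>) - 2) \<le> 4 * \<bar>\<theta>\<bar> powr p"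
proof -
  have "exp (\<i> * complex_of_real \<theta>) + exp (- \<i> * complex_of_real \<theta>) - 2
      = exp (- \<i> * complex_of_real \<theta>) * (exp (\<i> * complex_of_real \<theta>) - 1)\<^sup>2"
    by (simp add: power2_eq_square algebra_simps flip: exp_add)
  then have "cmod (exp (\<i> * complex_of_real \<theta>) + exp (- \<i> * complex_of_real \<theta>) - 2) = (cmod (exp (\<i> * complex_of_real \<theta>) - 1))\<^sup>2"
    by (simp add: norm_mult norm_power)
  also have "\<dots> \<le> (2 * \<bar>\<theta>\<bar> powr (p / 2))\<^sup>2"
    using assms by (intro power_mono cmod_exp_minus_one_le) auto
  also have "\<dots> = 4 * \<bar>\<theta>\<bar> powr p"
    by (simp add: power2_eq_square flip: powr_add)
  finally show ?thesis .
qed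

lemma flow_exp: "flow t c k = exp (- \<i> * complex_of_real (t * jap k)) * c k"
  by (simp add: flow_def)

lemma flow_flow: "flow a (flow b c) = flow (a + b) c"
  by (rule ext) (simp add: flow_def algebra_simps flip: exp_add)

lemma norm_flow [simp]: "cmod (flow t c k) = cmod (c k)"
  by (simp add: flow_def norm_mult)

lemma flow_diff: "flow t (\<lambda>k. a k - b k) k = flow t a k - flow t b k"
  by (simp add: flow_def algebra_simps)

lemma Sobolev_le_flow: "Sobolev_le s B c \<Longrightarrow> Sobolev_le s B (flow t c)"
  by (erule Sobolev_le_dominated) simp

lemma Sobolev_le_jap_pow_neg:
  assumes "Sobolev_le s B c" "r \<le> s + 1"
  shows "Sobolev_le r B (jap_pow (-1) c)"
proof -
  have "Sobolev_le r (1 * B) (jap_pow (-1) c)"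
    by (rule Sobolev_le_multiplier[where p = "-1", OF assms(1)])
       (use assms(2) in \<open>auto simp: jap_pow_def norm_mult norm_divide\<close>)
  then show ?thesis by simp
qed

lemma Sobolev_le_flow_minus_id:
  assumes "Sobolev_le s B c" "0 \<le> p" "p \<le> 1" "r + p \<le> s"
  shows "Sobolev_le r (2 * \<bar>t\<bar> powr p * B) (\<lambda>k. flow t c k - c k)"
proof (rule Sobolev_le_multiplier[OF assms(1) _ assms(4)])
  fix k
  have "flow t c k - c k = (exp (\<i> * complex_of_real (- (t * jap k))) - 1) * c k"
    by (simp add: flow_def algebra_simps)
  also have "cmod \<dots> \<le> 2 * \<bar>- (t * jap k)\<bar> powr p * cmod (c k)"
    unfolding norm_mult using assms by (intro mult_right_mono cmod_exp_minus_one_le) auto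
  also have "\<bar>- (t * jap k)\<bar> powr p = \<bar>t\<bar> powr p * jap k powr p"
    by (simp add: abs_mult powr_mult)
  finally show "cmod (flow t c k - c k) \<le> 2 * \<bar>t\<bar> powr p * jap k powr p * cmod (c k)"
    by (simp add: mult_ac)
qed auto

lemma Sobolev_le_flow_second_difference:
  assumes "Sobolev_le s B c" "0 \<le> p" "p \<le> 2" "r + p \<le> s"
  shows "Sobolev_le r (4 * \<bar>t\<bar> powr p * B) (\<lambda>k. flow t c k + flow (- t) c k - 2 * c k)"
proof (rule Sobolev_le_multiplier[OF assms(1) _ assms(4)])
  fix k
  have "flow t c k + flow (- t) c k - 2 * c k 
      = (exp (\<i> * complex_of_real (- (t * jap k))) + exp (- \<i> * complex_of_real (- (t * jap k))) - 2) * c k"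
    by (simp add: flow_def algebra_simps)
  also have "cmod \<dots> \<le> 4 * \<bar>- (t * jap k)\<bar> powr p * cmod (c k)"
    unfolding norm_mult using assms by (intro mult_right_mono cmod_exp_second_difference_le) auto
  also have "\<bar>- (t * jap k)\<bar> powr p = \<bar>t\<bar> powr p * jap k powr p"
    by (simp add: abs_mult powr_mult)
  finally show "cmod (flow t c k + flow (- t) c k - 2 * c k) \<le> 4 * \<bar>t\<bar> powr p * jap k powr p * cmod (c k)"
    by (simp add: mult_ac)
qed auto

lemma real_part_diff: "real_part (\<lambda>k. a k - b k) = (\<lambda>k. real_part a k - real_part b k)"
  by (auto simp: real_part_def diff_divide_distrib add_divide_distrib)

lemma jap_pow_flow: "jap_pow \<alpha> (flow t c) k = exp (- \<i> * complex_of_real (t * jap k)) * jap_pow \<alpha> c k"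
  by (simp add: jap_pow_def flow_def mult_ac)

lemma jap_pow_diff: "jap_pow \<alpha> (\<lambda>k. a k - b k) = (\<lambda>k. jap_pow \<alpha> a k - jap_pow \<alpha> b k)"
  by (auto simp: jap_pow_def right_diff_distrib)

lemma le_powr_of_le_one: "\<lbrakk>0 \<le> h; h \<le> 1; p \<le> 1\<rbrakk> \<Longrightarrow> h \<le> h powr p" for h p :: real
  using powr_mono'[of p 1 h] by simp

section \<open>The Duhamel formula\<close>

text \<open>The constants in the local errors will depend on the solution only through \<open>M\<close>.\<close>

locale bounded_mild_solution =
  fixes s T M :: real and u0 :: torus_dist and u :: "real \<Rightarrow> torus_dist"
  assumes s_gt: "1/2 < s"
    and bound: "t \<in> {0..T} \<Longrightarrow> Sobolev_le s M (u t)"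
    and integrable: "t \<in> {0..T} \<Longrightarrow> (\<lambda>r. jap_pow (-1) (flow (t - r) (Re_cubed (u r))) k) integrable_on {0..t}"
    and formula: "t \<in> {0..T} \<Longrightarrow> u t k = flow t u0 k 
          - \<i> * integral {0..t} (\<lambda>r. jap_pow (-1) (flow (t - r) (Re_cubed (u r))) k)"
begin

text \<open>The first argument is the time up to which the nonlinearity at time \<open>r\<close> is transported. Keeping it apart from the domain
  of integration lets the formula be restarted at any time, and run backwards.\<close>

definition duhamel :: "real \<Rightarrow> real \<Rightarrow> torus_dist" where
  "duhamel x r = jap_pow (-1) (flow (x - r) (Re_cubed (u r)))"

lemma duhamel_shift: "duhamel x r k = exp (- \<i> * complex_of_real ((x - y) * jap k)) * duhamel y r k"
proof -
  have "flow (x - r) (Re_cubed (u r)) = flow (x - y) (flow (y - r) (Re_cubed (u r)))"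
    by (simp add: flow_flow)
  then show ?thesis by (simp add: duhamel_def jap_pow_flow)
qed

lemma duhamel_integrable:
  assumes "0 \<le> a" "b \<le> T"
  shows "(\<lambda>r. duhamel x r k) integrable_on {a..b}"
proof (cases "a \<le> b")
  case True
  have "(\<lambda>r. duhamel T r k) integrable_on {0..T}"
    unfolding duhamel_def using integrable[of T k] True assms by simp
  then have "(\<lambda>r. exp (- \<i> * complex_of_real ((x - T) * jap k)) * duhamel T r k) integrable_on {0..T}"
    by (rule integrable_on_mult_right)
  then have "(\<lambda>r. duhamel x r k) integrable_on {0..T}"
    by (simp only: duhamel_shift[of x _ k T, symmetric])
  then show ?thesis
    by (rule integrable_subinterval_real) (use assms in auto)
qed (simp add: integrable_on_empty)

lemma flow_integral_duhamel:
  "exp (- \<i> * complex_of_real ((x - y) * jap k)) * integral S (\<lambda>r. duhamel y r k) = integral S (\<lambda>r. duhamel x r k)"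
  unfolding duhamel_shift[of x _ k y] by (rule integral_mult_right[symmetric])

lemma duhamel_formula:
  assumes "0 \<le> a" "a \<le> b" "b \<le> T"
  shows "u b k = flow (b - a) (u a) k - \<i> * integral {a..b} (\<lambda>r. duhamel b r k)"
proof -
  let ?E = "exp (- \<i> * complex_of_real ((b - a) * jap k))"
  have a: "u a k = flow a u0 k - \<i> * integral {0..a} (\<lambda>r. duhamel a r k)"
    unfolding duhamel_def using formula[of a k] assms by simp
  have b: "u b k = flow b u0 k - \<i> * integral {0..b} (\<lambda>r. duhamel b r k)"
    unfolding duhamel_def using formula[of b k] assms by simp
  have "flow (b - a) (u a) k = ?E * (flow a u0 k - \<i> * integral {0..a} (\<lambda>r. duhamel a r k))"
    unfolding flow_exp[of "b - a" "u a"] a ..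
  also have "\<dots> = ?E * flow a u0 k - \<i> * (?E * integral {0..a} (\<lambda>r. duhamel a r k))"
    by (simp only: right_diff_distrib mult.left_commute[of ?E \<i>])
  also have "?E * flow a u0 k = flow b u0 k"
    unfolding flow_exp[of "b - a" "flow a u0", symmetric] flow_flow by simp
  finally have split: "flow (b - a) (u a) k = flow b u0 k - \<i> * integral {0..a} (\<lambda>r. duhamel b r k)"
    by (simp only: flow_integral_duhamel)
  have "integral {0..b} (\<lambda>r. duhamel b r k) = integral {0..a} (\<lambda>r. duhamel b r k) + integral {a..b} (\<lambda>r. duhamel b r k)"
    using assms by (intro Henstock_Kurzweil_Integration.integral_combine[symmetric] duhamel_integrable) auto
  then show ?thesis
    by (simp only: b split distrib_left diff_diff_eq)
qed

text \<open>The deviation from the free evolution, forwards or backwards in time.\<close>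

definition defect :: "real \<Rightarrow> real \<Rightarrow> torus_dist" where
  "defect t t' = (\<lambda>k. u t' k - flow (t' - t) (u t) k)"

lemma defect_integral:
  assumes "t \<in> {0..T}" "t' \<in> {0..T}"
  obtains z a b where "z = \<i> \<or> z = - \<i>" "0 \<le> a" "a \<le> b" "b \<le> T" "b - a = \<bar>t' - t\<bar>"
    "\<And>r. r \<in> {a..b} \<Longrightarrow> \<bar>t' - r\<bar> \<le> \<bar>t' - t\<bar>"
    "\<And>k. defect t t' k = z * integral {a..b} (\<lambda>r. duhamel t' r k)"
proof (cases "t \<le> t'")
  case True
  have "defect t t' k = - \<i> * integral {t..t'} (\<lambda>r. duhamel t' r k)" for k
    using duhamel_formula[of t t' k] assms True by (simp add: defect_def)
  then show thesis
    by (rule that[of "- \<i>" t t', rotated -1]) (use assms True in auto)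
next
  case False
  have "defect t t' k = \<i> * integral {t'..t} (\<lambda>r. duhamel t' r k)" for k
  proof -
    have "flow (t' - t) (u t) k = exp (- \<i> * complex_of_real ((t' - t) * jap k)) * 
        (flow (t - t') (u t') k - \<i> * integral {t'..t} (\<lambda>r. duhamel t r k))"
      using False assms by (subst flow_exp, subst duhamel_formula[of t' t k]) auto
    also have "\<dots> = flow (t' - t) (flow (t - t') (u t')) k 
        - \<i> * (exp (- \<i> * complex_of_real ((t' - t) * jap k)) * integral {t'..t} (\<lambda>r. duhamel t r k))"
      by (simp only: flow_exp[of "t' - t" "flow (t - t') (u t')"] right_diff_distrib mult.left_commute[of _ \<i>])
    also have "\<dots> = u t' k - \<i> * integral {t'..t} (\<lambda>r. duhamel t' r k)"
      unfolding flow_flow flow_integral_duhamel by (simp add: flow_exp)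
    finally show ?thesis by (simp add: defect_def)
  qed
  then show thesis
    by (rule that[of \<i> t' t, rotated -1]) (use assms False in auto)
qed

lemma defect_bound:
  assumes N: "\<And>r. r \<in> {0..T} \<Longrightarrow> Sobolev_le \<sigma> K (Re_cubed (u r))"
    and t: "t \<in> {0..T}" "t' \<in> {0..T}"
  shows "Sobolev_le (\<sigma> + 1) (\<bar>t' - t\<bar> * K) (defect t t')"
proof -
  obtain z a b where z: "z = \<i> \<or> z = - \<i>" and ab: "0 \<le> a" "a \<le> b" "b \<le> T" "b - a = \<bar>t' - t\<bar>"
    and near: "\<And>r. r \<in> {a..b} \<Longrightarrow> \<bar>t' - r\<bar> \<le> \<bar>t' - t\<bar>"
    and eq: "\<And>k. defect t t' k = z * integral {a..b} (\<lambda>r. duhamel t' r k)"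
    by (rule defect_integral[OF t]) (rule that; assumption)
  have "Sobolev_le (\<sigma> + 1) ((b - a) * K) (\<lambda>k. integral {a..b} (\<lambda>r. duhamel t' r k))"
  proof (rule Sobolev_le_integral)
    show "(\<lambda>r. duhamel t' r k) integrable_on {a..b}" for k
      using ab by (intro duhamel_integrable) auto
    show "Sobolev_le (\<sigma> + 1) K (duhamel t' r)" if "r \<in> {a..b}" for r
      unfolding duhamel_def using ab that
      by (intro Sobolev_le_jap_pow_neg[of \<sigma>] Sobolev_le_flow N) auto
  qed (use ab in auto)
  then have "Sobolev_le (\<sigma> + 1) (cmod z * ((b - a) * K)) (\<lambda>k. z * integral {a..b} (\<lambda>r. duhamel t' r k))"
    by (rule Sobolev_le_scale)
  then show ?thesis
    using z ab(4) by (auto simp: eq[symmetric])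
qed

text \<open>The nonlinearity is real-valued, so that taking the real part replaces the kernel
  \<open>exp (- \<i> * \<theta>)\<close>, up to a factor \<open>\<plusminus>\<i>\<close>, by a sine. This gains a power of the time increment
  without any loss of derivatives.\<close>

lemma real_part_defect_bound:
  assumes N: "\<And>r. r \<in> {0..T} \<Longrightarrow> Sobolev_le \<sigma> K (Re_cubed (u r))"
    and t: "t \<in> {0..T}" "t' \<in> {0..T}"
  shows "Sobolev_le \<sigma> (\<bar>t' - t\<bar>\<^sup>2 * K) (real_part (defect t t'))"
proof -
  obtain z a b where z: "z = \<i> \<or> z = - \<i>" and ab: "0 \<le> a" "a \<le> b" "b \<le> T" "b - a = \<bar>t' - t\<bar>"
    and near: "\<And>r. r \<in> {a..b} \<Longrightarrow> \<bar>t' - r\<bar> \<le> \<bar>t' - t\<bar>"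
    and eq: "\<And>k. defect t t' k = z * integral {a..b} (\<lambda>r. duhamel t' r k)"
    by (rule defect_integral[OF t]) (rule that; assumption)
  define F where "F = (\<lambda>r. real_part (\<lambda>k. z * duhamel t' r k))"
  have int: "((\<lambda>r. z * duhamel t' r k) has_integral defect t t' k) {a..b}" for k
    unfolding eq using ab by (intro has_integral_mult_right integrable_integral duhamel_integrable) auto
  have Fint: "((\<lambda>r. F r k) has_integral real_part (defect t t') k) {a..b}" for k
  proof -
    have "((\<lambda>r. cnj (z * duhamel t' r (- k))) has_integral cnj (defect t t' (- k))) {a..b}"
      using has_integral_cnj[of "\<lambda>r. z * duhamel t' r (- k)" "defect t t' (- k)" "{a..b}"] int[of "- k"]
      by (simp only: comp_def)
    from has_integral_divide[OF has_integral_add[OF int[of k] this], of 2]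
    show ?thesis by (simp only: F_def real_part_def)
  qed
  have Feq: "cmod (F r k) \<le> \<bar>t' - t\<bar> * jap k powr 0 * cmod (Re_cubed (u r) k)" if r: "r \<in> {a..b}" for r k
  proof -
    let ?\<theta> = "(t' - r) * jap k"
    have d1: "duhamel t' r k = cis (- ?\<theta>) * (Re_cubed (u r) k / jap k)"
      by (simp add: duhamel_def jap_pow_def flow_def cis_conv_exp powr_minus field_simps)
    have d2: "cnj (duhamel t' r (- k)) = cis ?\<theta> * (Re_cubed (u r) k / jap k)"
      by (simp add: duhamel_def jap_pow_def flow_def cis_conv_exp powr_minus field_simps Re_cubed_reflect exp_cnj)
    let ?W = "(z * cis (- ?\<theta>) + cnj z * cis ?\<theta>) / 2"
    have "?W = complex_of_real (sin ?\<theta>) \<or> ?W = - complex_of_real (sin ?\<theta>)"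
      using z by (auto simp: complex_eq_iff)
    then have W: "cmod ?W = \<bar>sin ?\<theta>\<bar>"
      by (elim disjE) (simp_all only: norm_minus_cancel norm_of_real)
    have "F r k = ?W * (Re_cubed (u r) k / jap k)"
      unfolding F_def real_part_def complex_cnj_mult d1 d2 by (simp add: field_simps)
    then have "cmod (F r k) = cmod ?W * cmod (Re_cubed (u r) k / jap k)"
      by (simp only: norm_mult)
    also have "\<dots> = \<bar>sin ?\<theta>\<bar> * (cmod (Re_cubed (u r) k) / jap k)"
      unfolding W by (simp add: norm_divide)
    also have "\<dots> \<le> \<bar>?\<theta>\<bar> * (cmod (Re_cubed (u r) k) / jap k)"
      by (intro mult_right_mono abs_sin_x_le_abs_x) auto
    also have "\<dots> = \<bar>t' - r\<bar> * cmod (Re_cubed (u r) k)"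
      by (simp add: abs_mult)
    also have "\<dots> \<le> \<bar>t' - t\<bar> * cmod (Re_cubed (u r) k)"
      by (intro mult_right_mono near r) auto
    finally show ?thesis by simp
  qed
  have "Sobolev_le \<sigma> ((b - a) * (\<bar>t' - t\<bar> * K)) (\<lambda>k. integral {a..b} (\<lambda>r. F r k))"
  proof (rule Sobolev_le_integral)
    show "(\<lambda>r. F r k) integrable_on {a..b}" for k using Fint by blast
    show "Sobolev_le \<sigma> (\<bar>t' - t\<bar> * K) (F r)" if "r \<in> {a..b}" for r
      by (rule Sobolev_le_multiplier[where p = 0 and s = \<sigma>, OF N _ _ Feq[OF that]]) (use that ab in auto)
  qed (use ab in auto)
  moreover have "(\<lambda>k. integral {a..b} (\<lambda>r. F r k)) = real_part (defect t t')"
    by (rule ext) (rule integral_unique[OF Fint])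
  moreover have "(b - a) * (\<bar>t' - t\<bar> * K) = \<bar>t' - t\<bar>\<^sup>2 * K"
    by (simp only: ab(4) power2_eq_square mult.assoc)
  ultimately show ?thesis by (simp only:)
qed

lemma bound_half: "t \<in> {0..T} \<Longrightarrow> Sobolev_le (1/2) M (u t)"
  using s_gt by (intro Sobolev_le_weaken[OF bound]) auto

lemma Re_cubed_u: "t \<in> {0..T} \<Longrightarrow> Re_cubed (u t) = cube (real_part (u t))"
  by (rule Re_cubed_eq_cube[OF bound_half])

lemma real_part_bound: "t \<in> {0..T} \<Longrightarrow> Sobolev_le s M (real_part (u t))"
  by (rule Sobolev_le_real_part[OF bound])

lemma Re_cubed_bound:
  assumes "triple_bound p p p \<sigma> C" "p \<le> s" "r \<in> {0..T}"
  shows "Sobolev_le \<sigma> (C * M * M * M) (Re_cubed (u r))"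
proof -
  have "Sobolev_le p M (real_part (u r))"
    using assms by (intro Sobolev_le_weaken[OF real_part_bound]) auto
  then show ?thesis
    unfolding Re_cubed_u[OF assms(3)] cube_triple by (intro triple_boundD[OF assms(1)])
qed

text \<open>The free evolution gains \<open>\<bar>t' - t\<bar>\<^sup>p\<close> at the cost of \<open>p\<close> derivatives, while the defect is Lipschitz in
  \<open>H\<^sup>1\<^sup>/\<^sup>2\<close>, which is enough because \<open>p \<le> 1\<close> and \<open>\<sigma> \<le> 1/2\<close>.\<close>

lemma increment_bound:
  assumes N: "\<And>r. r \<in> {0..T} \<Longrightarrow> Sobolev_le (-1/2) K (Re_cubed (u r))"
    and t: "t \<in> {0..T}" "t' \<in> {0..T}" "\<bar>t' - t\<bar> \<le> 1"
    and p: "0 \<le> p" "p \<le> 1" "\<sigma> + p \<le> s" "\<sigma> \<le> 1/2"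
  shows "Sobolev_le \<sigma> ((2 * M + K) * \<bar>t' - t\<bar> powr p) (\<lambda>k. u t' k - u t k)"
proof -
  have K: "0 \<le> K" using N[OF t(1)] by (rule Sobolev_le_nonneg)
  have "Sobolev_le \<sigma> (2 * \<bar>t' - t\<bar> powr p * M + \<bar>t' - t\<bar> * K) 
      (\<lambda>k. (flow (t' - t) (u t) k - u t k) + defect t t' k)"
    by (intro Sobolev_le_add Sobolev_le_flow_minus_id[OF bound[OF t(1)] p(1-3)] 
        Sobolev_le_weaken[OF defect_bound[OF N t(1,2)] _ order_refl]) (use p in auto)
  then have "Sobolev_le \<sigma> (2 * \<bar>t' - t\<bar> powr p * M + \<bar>t' - t\<bar> * K) (\<lambda>k. u t' k - u t k)"
    by (rule Sobolev_le_cong) (simp add: defect_def)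
  then show ?thesis
  proof (rule Sobolev_le_mono)
    have "\<bar>t' - t\<bar> * K \<le> \<bar>t' - t\<bar> powr p * K"
      using t p K by (intro mult_right_mono le_powr_of_le_one) auto
    then show "2 * \<bar>t' - t\<bar> powr p * M + \<bar>t' - t\<bar> * K \<le> (2 * M + K) * \<bar>t' - t\<bar> powr p"
      by (simp add: algebra_simps)
  qed
qed

lemma real_part_increment_bound:
  assumes "\<And>r. r \<in> {0..T} \<Longrightarrow> Sobolev_le (-1/2) K (Re_cubed (u r))"
    and "t \<in> {0..T}" "t' \<in> {0..T}" "\<bar>t' - t\<bar> \<le> 1"
    and "0 \<le> p" "p \<le> 1" "\<sigma> + p \<le> s" "\<sigma> \<le> 1/2"
  shows "Sobolev_le \<sigma> ((2 * M + K) * \<bar>t' - t\<bar> powr p) (\<lambda>k. real_part (u t') k - real_part (u t) k)"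
  using Sobolev_le_real_part[OF increment_bound[OF assms]] by (simp only: real_part_diff)

end

section \<open>Local errors of the splitting schemes\<close>

definition lie_step :: "real \<Rightarrow> torus_dist \<Rightarrow> torus_dist" where
  "lie_step \<tau> c = (\<lambda>k. flow \<tau> c k - \<i> * complex_of_real \<tau> * jap_pow (-1) (flow \<tau> (Re_cubed c)) k)"

definition strang_step :: "real \<Rightarrow> torus_dist \<Rightarrow> torus_dist" where
  "strang_step \<tau> c = (\<lambda>k. flow \<tau> c k 
     - \<i> * complex_of_real \<tau> * jap_pow (-1) (flow (\<tau> / 2) (Re_cubed (flow (\<tau> / 2) c))) k)"

text \<open>The local error is the integral over one step of a difference of Duhamel integrands. Up to the flow and
  \<open>\<langle>\<nabla>\<rangle>\<^sup>-\<^sup>1\<close>, this difference splits into the change of the flow on the nonlinearity, bounded in \<open>H\<close> to the power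
  \<open>3s - 2\<close>, and the change of the nonlinearity. The upper bound on \<open>s\<close> means \<open>3s - 3/2 \<le> 1\<close>, the
  largest gain from a first difference of the flow.\<close>

theorem (in bounded_mild_solution) lie_local_error:
  assumes s: "s \<le> 5/6"
  shows "\<exists>K\<ge>0. \<forall>t \<tau>. 0 \<le> t \<longrightarrow> 0 < \<tau> \<longrightarrow> \<tau> \<le> 1 \<longrightarrow> t + \<tau> \<le> T \<longrightarrow>
     Sobolev_le (1/2) (\<tau> * (K * \<tau> powr (3 * s - 3/2))) (\<lambda>k. u (t + \<tau>) k - lie_step \<tau> (u t) k)"
proof (cases "0 \<le> T")
  case False
  then show ?thesis by (intro exI[of _ 0]) auto
next
  case T: True
  \<comment> \<open>The weakest norm in which one of three factors may be measured, the others being in \<open>H\<^sup>s\<close>, if the product is to be in \<open>H\<^sup>-\<^sup>1\<^sup>/\<^sup>2\<close>.\<close>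
  define \<sigma> where "\<sigma> = 3/2 - 2 * s"
  define p where "p = 3 * s - 3/2"
  have p: "0 \<le> p" "p \<le> 1" using s s_gt by (auto simp: p_def)
  have M: "0 \<le> M" using bound[of 0] T Sobolev_le_nonneg by auto
  obtain C0 where C0: "triple_bound (1/2) (1/2) (1/2) (-1/2) C0" using triple_bound_critical by blast
  have "\<exists>C. triple_bound s s s (3 * s - 2) C"
    by (rule triple_bound_exists[where m = "2 * s - 1"]; rule product_bound_exists) (use s s_gt in auto)
  then obtain C1 where C1: "triple_bound s s s (3 * s - 2) C1" by blast
  have "\<exists>C. triple_bound \<sigma> s s (-1/2) C"
    by (rule triple_bound_exists[where m = "1/2 - s"]; rule product_bound_exists) (use s s_gt in \<open>auto simp: \<sigma>_def\<close>)
  moreover have "\<exists>C. triple_bound s s \<sigma> (-1/2) C"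
    by (rule triple_bound_exists[where m = "2 * s - 1"]; rule product_bound_exists) (use s s_gt in \<open>auto simp: \<sigma>_def\<close>)
  ultimately obtain C2 where C2: "triple_bound \<sigma> s s (-1/2) C2" "triple_bound s s \<sigma> (-1/2) C2"
    using triple_bound_common by blast
  have pos: "C0 > 0" "C1 > 0" "C2 > 0" using C0 C1 C2 by (auto simp: triple_bound_def)
  have N0: "Sobolev_le (-1/2) (C0 * M * M * M) (Re_cubed (u r))" if "r \<in> {0..T}" for r
    using s_gt by (intro Re_cubed_bound[OF C0 _ that]) auto
  define E where "E = 2 * M + C0 * M * M * M"
  have E: "0 \<le> E" unfolding E_def using M pos by auto
  define K where "K = 2 * (C1 * M * M * M) + 3 * C2 * M\<^sup>2 * E"
  have K: "0 \<le> K" unfolding K_def using M pos E by auto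
  show ?thesis
  proof (intro exI[of _ K] conjI allI impI K)
    fix t \<tau> assume t: "0 \<le> t" and \<tau>: "0 < \<tau>" "\<tau> \<le> 1" and tT: "t + \<tau> \<le> T"
    have tin: "t \<in> {0..T}" using t \<tau> tT by auto
    define F where "F = (\<lambda>r k. duhamel (t + \<tau>) r k - jap_pow (-1) (flow \<tau> (Re_cubed (u t))) k)"
    have Fb: "Sobolev_le (1/2) (K * \<tau> powr p) (F r)" if r: "r \<in> {t..t + \<tau>}" for r
    proof -
      have rin: "r \<in> {0..T}" using r t tT by auto
      let ?h = "r - t"
      have h: "\<bar>?h\<bar> \<le> 1" "\<bar>?h\<bar> \<le> \<tau>" "\<bar>- ?h\<bar> \<le> \<tau>" using r \<tau> by auto
      have hp: "\<bar>?h\<bar> powr p \<le> \<tau> powr p" "\<bar>- ?h\<bar> powr p \<le> \<tau> powr p"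
        using h p by (auto intro!: powr_mono2)
      have flow_part: "Sobolev_le (-1/2) (2 * \<bar>- ?h\<bar> powr p * (C1 * M * M * M)) 
          (\<lambda>k. flow (- ?h) (Re_cubed (u r)) k - Re_cubed (u r) k)"
        by (rule Sobolev_le_flow_minus_id[OF Re_cubed_bound[OF C1 order_refl rin] p]) (simp add: p_def)
      have d: "Sobolev_le \<sigma> (E * \<bar>?h\<bar> powr p) (\<lambda>k. real_part (u r) k - real_part (u t) k)"
        unfolding E_def by (rule real_part_increment_bound[OF N0 tin rin h(1) p]) (use s_gt in \<open>auto simp: p_def \<sigma>_def\<close>)
      have cube_part: "Sobolev_le (-1/2) (3 * C2 * M\<^sup>2 * (E * \<bar>?h\<bar> powr p)) (\<lambda>k. Re_cubed (u r) k - Re_cubed (u t) k)"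
        unfolding Re_cubed_u[OF rin] Re_cubed_u[OF tin]
        by (rule cube_diff_estimate[OF C2 _ real_part_bound[OF rin] real_part_bound[OF tin] d]) (use s_gt in auto)
      define X where "X = (\<lambda>k. (flow (- ?h) (Re_cubed (u r)) k - Re_cubed (u r) k) + (Re_cubed (u r) k - Re_cubed (u t) k))"
      have "Sobolev_le (-1/2) (2 * \<bar>- ?h\<bar> powr p * (C1 * M * M * M) + 3 * C2 * M\<^sup>2 * (E * \<bar>?h\<bar> powr p)) X"
        unfolding X_def by (rule Sobolev_le_add[OF flow_part cube_part])
      moreover have "2 * \<bar>- ?h\<bar> powr p * (C1 * M * M * M) + 3 * C2 * M\<^sup>2 * (E * \<bar>?h\<bar> powr p) = K * \<bar>?h\<bar> powr p"
        by (simp add: K_def algebra_simps abs_minus_commute[of t r])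
      moreover have "K * \<bar>?h\<bar> powr p \<le> K * \<tau> powr p"
        using hp K by (intro mult_left_mono) auto
      ultimately have "Sobolev_le (-1/2) (K * \<tau> powr p) X"
        by (auto intro: Sobolev_le_mono)
      then have "Sobolev_le (1/2) (K * \<tau> powr p) (jap_pow (-1) (flow \<tau> X))"
        by (intro Sobolev_le_jap_pow_neg[of "-1/2"] Sobolev_le_flow) auto
      moreover have "jap_pow (-1) (flow \<tau> X) = F r"
      proof -
        have "flow \<tau> X = (\<lambda>k. flow \<tau> (flow (- ?h) (Re_cubed (u r))) k - flow \<tau> (Re_cubed (u t)) k)"
          by (rule ext) (simp add: X_def flow_exp algebra_simps)
        also have "flow \<tau> (flow (- ?h) (Re_cubed (u r))) = flow (t + \<tau> - r) (Re_cubed (u r))"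
          by (simp add: flow_flow algebra_simps)
        finally show ?thesis by (simp add: F_def duhamel_def jap_pow_diff)
      qed
      ultimately show ?thesis by simp
    qed
    have "Sobolev_le (1/2) (((t + \<tau>) - t) * (K * \<tau> powr p)) (\<lambda>k. integral {t..t + \<tau>} (\<lambda>r. F r k))"
    proof (rule Sobolev_le_integral)
      show "(\<lambda>r. F r k) integrable_on {t..t + \<tau>}" for k
        unfolding F_def using t tT by (intro integrable_diff duhamel_integrable) auto
    qed (use \<tau> Fb in auto)
    then have "Sobolev_le (1/2) (\<tau> * (K * \<tau> powr p)) (\<lambda>k. integral {t..t + \<tau>} (\<lambda>r. F r k))"
      by simp
    from Sobolev_le_scale[OF this, of "- \<i>"]
    have "Sobolev_le (1/2) (\<tau> * (K * \<tau> powr p)) (\<lambda>k. - \<i> * integral {t..t + \<tau>} (\<lambda>r. F r k))"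
      by simp
    moreover have "- \<i> * integral {t..t + \<tau>} (\<lambda>r. F r k) = u (t + \<tau>) k - lie_step \<tau> (u t) k" for k
    proof -
      have "integral {t..t + \<tau>} (\<lambda>r. F r k) 
          = integral {t..t + \<tau>} (\<lambda>r. duhamel (t + \<tau>) r k) - \<tau> * jap_pow (-1) (flow \<tau> (Re_cubed (u t))) k"
        (is "?I = ?J - ?c")
        unfolding F_def using t tT \<tau>
        by (subst Henstock_Kurzweil_Integration.integral_diff) (auto intro!: duhamel_integrable simp: scaleR_conv_of_real)
      moreover have "u (t + \<tau>) k = flow \<tau> (u t) k - \<i> * ?J"
        using duhamel_formula[of t "t + \<tau>" k] t tT \<tau> by simp
      ultimately show ?thesis
        by (simp only: lie_step_def) (simp add: algebra_simps)
    qed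
    ultimately show "Sobolev_le (1/2) (\<tau> * (K * \<tau> powr (3 * s - 3/2))) (\<lambda>k. u (t + \<tau>) k - lie_step \<tau> (u t) k)"
      unfolding p_def by (rule Sobolev_le_cong)
  qed
qed

text \<open>Folding an integral about the midpoint turns the error of the midpoint rule into an integral of symmetric
  second differences, whose size expresses fractional smoothness up to order two.\<close>

lemma has_integral_symmetrize:
  fixes f :: "real \<Rightarrow> complex"
  assumes "0 \<le> \<eta>" and f: "f integrable_on {m - \<eta>..m + \<eta>}"
  shows "((\<lambda>h. f (m + h) + f (m - h)) has_integral integral {m - \<eta>..m + \<eta>} f) {0..\<eta>}"
proof -
  have "f integrable_on {m..m + \<eta>}" "f integrable_on {m - \<eta>..m}"
    by (rule integrable_subinterval_real[OF f]; use assms in auto)+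
  then have "(f has_integral integral {m..m + \<eta>} f) {m..m + \<eta>}" "(f has_integral integral {m - \<eta>..m} f) {m - \<eta>..m}"
    by (simp_all add: integrable_integral)
  then have 1: "((\<lambda>h. f (h + m)) has_integral integral {m..m + \<eta>} f) {m - m..m + \<eta> - m}"
    and 2: "((\<lambda>h. f (h + m)) has_integral integral {m - \<eta>..m} f) {m - \<eta> - m..m - m}"
    by (simp_all only: has_integral_shift_real_ivl)
  from 2 have "((\<lambda>h. f (- h + m)) has_integral integral {m - \<eta>..m} f) {0..\<eta>}"
    using has_integral_reflect_real[of "\<lambda>h. f (h + m)" _ 0 "- \<eta>"] by simp
  with 1 have "((\<lambda>h. f (h + m) + f (- h + m)) has_integral integral {m..m + \<eta>} f + integral {m - \<eta>..m} f) {0..\<eta>}"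
    by (intro has_integral_add) simp_all
  moreover have "integral {m..m + \<eta>} f + integral {m - \<eta>..m} f = integral {m - \<eta>..m + \<eta>} f"
    using Henstock_Kurzweil_Integration.integral_combine[OF _ _ f, of m] assms by (simp add: add.commute)
  ultimately show ?thesis by (simp add: add.commute)
qed

text \<open>The second difference of \<open>exp (\<i> * h * \<langle>\<nabla>\<rangle>) g(m + h)\<close> at the midpoint \<open>m\<close> consists of first differences of the flow applied
  to first differences of \<open>g\<close>, gaining \<open>h\<close> and \<open>h\<close> to the power \<open>s - 1/2\<close>, the second difference of the
  flow applied to \<open>g(m)\<close>, and the second difference of \<open>g\<close>. Since \<open>s > 1\<close>, multiplication by functions in \<open>H\<^sup>s\<close>
  preserves \<open>H\<^sup>s\<close>, \<open>H\<^sup>1\<^sup>/\<^sup>2\<close> and \<open>H\<^sup>-\<^sup>1\<^sup>/\<^sup>2\<close>. The upper bound on \<open>s\<close> means \<open>s + 1/2 \<le> 2\<close>, the order of a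
  second difference.\<close>

theorem (in bounded_mild_solution) strang_local_error:
  assumes s: "1 < s" "s \<le> 3/2"
  shows "\<exists>K\<ge>0. \<forall>t \<tau>. 0 \<le> t \<longrightarrow> 0 < \<tau> \<longrightarrow> \<tau> \<le> 1 \<longrightarrow> t + \<tau> \<le> T \<longrightarrow>
     Sobolev_le (1/2) (\<tau> * (K * \<tau> powr (s + 1/2))) (\<lambda>k. u (t + \<tau>) k - strang_step \<tau> (u t) k)"
proof (cases "0 \<le> T")
  case False
  then show ?thesis by (intro exI[of _ 0]) auto
next
  case T: True
  have M: "0 \<le> M" using bound[of 0] T Sobolev_le_nonneg by auto
  obtain C0 where C0: "triple_bound (1/2) (1/2) (1/2) (-1/2) C0" using triple_bound_critical by blast
  have sss: "\<exists>C. product_bound s s s C" by (rule product_bound_exists) (use s in auto)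
  have hsh: "\<exists>C. product_bound (1/2) s (1/2) C" by (rule product_bound_exists) (use s in auto)
  have shh: "\<exists>C. product_bound s (1/2) (1/2) C" by (rule product_bound_exists) (use s in auto)
  have nsn: "\<exists>C. product_bound (-1/2) s (-1/2) C" by (rule product_bound_exists) (use s in auto)
  have snn: "\<exists>C. product_bound s (-1/2) (-1/2) C" by (rule product_bound_exists) (use s in auto)
  have hqn: "\<exists>C. product_bound (1/2) (s - 1) (-1/2) C" by (rule product_bound_exists) (use s in auto)
  obtain C1 where C1: "triple_bound s s s s C1"
    using triple_bound_exists[OF sss sss] by blast
  obtain C3 where C3: "triple_bound (1/2) s s (1/2) C3" "triple_bound s s (1/2) (1/2) C3"
    using triple_bound_common[OF triple_bound_exists[OF hsh hsh] triple_bound_exists[OF sss shh]] by blast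
  obtain C2 where C2: "triple_bound (-1/2) s s (-1/2) C2" "triple_bound s s (-1/2) (-1/2) C2"
      "triple_bound (1/2) s (s - 1) (-1/2) C2" "triple_bound (1/2) (s - 1) s (-1/2) C2"
  proof -
    obtain C where C: "triple_bound (-1/2) s s (-1/2) C" "triple_bound s s (-1/2) (-1/2) C"
      using triple_bound_common[OF triple_bound_exists[OF nsn nsn] triple_bound_exists[OF sss snn]] by blast
    obtain C' where C': "triple_bound (1/2) s (s - 1) (-1/2) C'" "triple_bound (1/2) (s - 1) s (-1/2) C'"
      using triple_bound_common[OF triple_bound_exists[OF hsh hqn] triple_bound_exists[OF hqn nsn]] by blast
    show thesis
      by (rule that[of "max C C'"]; rule triple_bound_mono) (use C C' in auto)
  qed
  have pos: "C0 > 0" "C1 > 0" "C2 > 0" "C3 > 0" using C0 C1 C2 C3 by (auto simp: triple_bound_def)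
  define K0 where "K0 = C0 * M * M * M"
  define K1 where "K1 = C1 * M * M * M"
  have N0: "Sobolev_le (-1/2) K0 (Re_cubed (u r))" if "r \<in> {0..T}" for r
    unfolding K0_def using s by (intro Re_cubed_bound[OF C0 _ that]) auto
  have N1: "Sobolev_le s K1 (Re_cubed (u r))" if "r \<in> {0..T}" for r
    unfolding K1_def by (rule Re_cubed_bound[OF C1 order_refl that])
  have Nh: "Sobolev_le (1/2) K1 (Re_cubed (u r))" if "r \<in> {0..T}" for r
    using s by (intro Sobolev_le_weaken[OF N1[OF that]]) auto
  have K01: "0 \<le> K0" "0 \<le> K1" unfolding K0_def K1_def using M pos by auto
  define E where "E = 2 * M + K0"
  have E: "0 \<le> E" unfolding E_def using M K01 by auto
  define p where "p = s + 1/2"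
  have p: "0 \<le> p" "p \<le> 2" using s by (auto simp: p_def)
  define K where "K = 12 * C3 * M\<^sup>2 * E + 4 * K1 + (3 * C2 * M\<^sup>2 * (4 * M + 2 * K0) + 6 * C2 * M * E\<^sup>2)"
  define K' where "K' = 3 * C0 * M\<^sup>2 * K1"
  have KK: "0 \<le> K" "0 \<le> K'" unfolding K_def K'_def using M pos E K01 by auto
  have second: "Sobolev_le (-1/2) (K * h powr p)
      (\<lambda>k. flow (- h) (Re_cubed (u (m + h))) k + flow h (Re_cubed (u (m - h))) k - 2 * Re_cubed (u m) k)"
    if h: "0 \<le> h" "h \<le> 1" and m: "m - h \<in> {0..T}" "m + h \<in> {0..T}" for h m
  proof -
    have min: "m \<in> {0..T}" using h m by auto
    have habs: "\<bar>m + h - m\<bar> = h" "\<bar>m - h - m\<bar> = h" "\<bar>- h\<bar> = h" "\<bar>h\<bar> = h" using h by auto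
    have hp: "h powr (s - 1/2) * h = h powr p"
      using h powr_mult_base[of h "s - 1/2"] by (simp add: p_def mult.commute add.commute)
    have h1: "h powr 1 = h" using h by simp
    have h2: "h\<^sup>2 \<le> h powr p"
    proof (cases "h = 0")
      case False
      then have "h\<^sup>2 = h powr 2" using h by simp
      also have "\<dots> \<le> h powr p" using p h by (intro powr_mono') auto
      finally show ?thesis .
    qed simp
    have half: "Sobolev_le (1/2) (E * h powr (s - 1/2)) (\<lambda>k. real_part (u t') k - real_part (u m) k)"
      if "t' \<in> {0..T}" "\<bar>t' - m\<bar> = h" for t'
      using real_part_increment_bound[OF N0 min that(1), of "s - 1/2" "1/2"] that h s by (simp add: E_def)
    have low: "Sobolev_le (s - 1) (E * h) (\<lambda>k. real_part (u t') k - real_part (u m) k)"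
      if "t' \<in> {0..T}" "\<bar>t' - m\<bar> = h" for t'
      using real_part_increment_bound[OF N0 min that(1), of 1 "s - 1"] that h s by (simp add: E_def)
    have dd: "Sobolev_le (-1/2) ((4 * M + 2 * K0) * h powr p) 
        (\<lambda>k. real_part (u (m + h)) k + real_part (u (m - h)) k - 2 * real_part (u m) k)"
    proof -
      have "Sobolev_le (-1/2) (4 * \<bar>h\<bar> powr p * M) (\<lambda>k. flow h (u m) k + flow (- h) (u m) k - 2 * u m k)"
        by (rule Sobolev_le_flow_second_difference[OF bound[OF min] p]) (simp add: p_def)
      from Sobolev_le_real_part[OF this]
      have "Sobolev_le (-1/2) (4 * \<bar>h\<bar> powr p * M + (\<bar>m + h - m\<bar>\<^sup>2 * K0 + \<bar>m - h - m\<bar>\<^sup>2 * K0))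
          (\<lambda>k. real_part (\<lambda>k. flow h (u m) k + flow (- h) (u m) k - 2 * u m k) k
            + (real_part (defect m (m + h)) k + real_part (defect m (m - h)) k))"
        by (intro Sobolev_le_add real_part_defect_bound N0 min m)
      then have "Sobolev_le (-1/2) (4 * \<bar>h\<bar> powr p * M + (\<bar>m + h - m\<bar>\<^sup>2 * K0 + \<bar>m - h - m\<bar>\<^sup>2 * K0))
          (\<lambda>k. real_part (u (m + h)) k + real_part (u (m - h)) k - 2 * real_part (u m) k)"
        by (rule Sobolev_le_cong) (simp add: real_part_def defect_def field_simps)
      then show ?thesis
      proof (rule Sobolev_le_mono)
        have "h\<^sup>2 * K0 \<le> h powr p * K0" using h2 K01(1) by (rule mult_right_mono)
        then show "4 * \<bar>h\<bar> powr p * M + (\<bar>m + h - m\<bar>\<^sup>2 * K0 + \<bar>m - h - m\<bar>\<^sup>2 * K0) \<le> (4 * M + 2 * K0) * h powr p"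
          unfolding habs by (simp add: algebra_simps)
      qed
    qed
    have cubes: "Sobolev_le (-1/2) (3 * C2 * M\<^sup>2 * ((4 * M + 2 * K0) * h powr p) + 6 * C2 * M * (E * h powr (s - 1/2)) * (E * h))
        (\<lambda>k. Re_cubed (u (m + h)) k + Re_cubed (u (m - h)) k - 2 * Re_cubed (u m) k)"
      unfolding Re_cubed_u[OF m(2)] Re_cubed_u[OF m(1)] Re_cubed_u[OF min]
      by (rule cube_second_difference_estimate[OF C2 _ real_part_bound[OF min] real_part_bound[OF m(2)] real_part_bound[OF m(1)]
            half[OF m(2) habs(1)] low[OF m(2) habs(1)] half[OF m(1) habs(2)] low[OF m(1) habs(2)] dd])
         (use s in auto)
    have diff: "Sobolev_le (1/2) (3 * C3 * M\<^sup>2 * (E * h powr (s - 1/2))) (\<lambda>k. Re_cubed (u t') k - Re_cubed (u m) k)"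
      if "t' \<in> {0..T}" "\<bar>t' - m\<bar> = h" for t'
      unfolding Re_cubed_u[OF that(1)] Re_cubed_u[OF min]
      by (rule cube_diff_estimate[OF C3 _ real_part_bound[OF that(1)] real_part_bound[OF min] half[OF that]]) (use s in auto)
    have shift: "Sobolev_le (-1/2) (2 * \<bar>x\<bar> powr 1 * (3 * C3 * M\<^sup>2 * (E * h powr (s - 1/2))))
        (\<lambda>k. flow x (\<lambda>k. Re_cubed (u t') k - Re_cubed (u m) k) k - (Re_cubed (u t') k - Re_cubed (u m) k))"
      if "t' \<in> {0..T}" "\<bar>t' - m\<bar> = h" for t' x
      by (rule Sobolev_le_flow_minus_id[OF diff[OF that]]) auto
    have mid: "Sobolev_le (-1/2) (4 * \<bar>h\<bar> powr p * K1)
        (\<lambda>k. flow h (Re_cubed (u m)) k + flow (- h) (Re_cubed (u m)) k - 2 * Re_cubed (u m) k)"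
      by (rule Sobolev_le_flow_second_difference[OF N1[OF min] p]) (simp add: p_def)
    let ?B = "((2 * \<bar>- h\<bar> powr 1 * (3 * C3 * M\<^sup>2 * (E * h powr (s - 1/2)))
          + 2 * \<bar>h\<bar> powr 1 * (3 * C3 * M\<^sup>2 * (E * h powr (s - 1/2))))
          + (4 * \<bar>h\<bar> powr p * K1 + (3 * C2 * M\<^sup>2 * ((4 * M + 2 * K0) * h powr p) + 6 * C2 * M * (E * h powr (s - 1/2)) * (E * h))))"
    have "Sobolev_le (-1/2) ?B
        (\<lambda>k. ((flow (- h) (\<lambda>k. Re_cubed (u (m + h)) k - Re_cubed (u m) k) k - (Re_cubed (u (m + h)) k - Re_cubed (u m) k))
          + (flow h (\<lambda>k. Re_cubed (u (m - h)) k - Re_cubed (u m) k) k - (Re_cubed (u (m - h)) k - Re_cubed (u m) k)))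
          + ((flow h (Re_cubed (u m)) k + flow (- h) (Re_cubed (u m)) k - 2 * Re_cubed (u m) k)
          + (Re_cubed (u (m + h)) k + Re_cubed (u (m - h)) k - 2 * Re_cubed (u m) k)))"
      by (intro Sobolev_le_add[OF Sobolev_le_add[OF shift[OF m(2) habs(1)] shift[OF m(1) habs(2)]] Sobolev_le_add[OF mid cubes]])
    then have "Sobolev_le (-1/2) ?B
        (\<lambda>k. flow (- h) (Re_cubed (u (m + h))) k + flow h (Re_cubed (u (m - h))) k - 2 * Re_cubed (u m) k)"
      by (rule Sobolev_le_cong) (simp add: flow_diff)
    moreover have "?B = K * h powr p"
      unfolding habs h1 hp[symmetric] K_def by (simp add: power2_eq_square algebra_simps)
    ultimately show ?thesis by (simp only:)
  qed
  show ?thesis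
  proof (intro exI[of _ "K + K'"] conjI allI impI)
    show "0 \<le> K + K'" using KK by simp
    fix t \<tau> assume t: "0 \<le> t" and \<tau>: "0 < \<tau>" "\<tau> \<le> 1" and tT: "t + \<tau> \<le> T"
    define \<eta> where "\<eta> = \<tau> / 2"
    define m where "m = t + \<eta>"
    have tin: "t \<in> {0..T}" and min: "m \<in> {0..T}" using t \<tau> tT by (auto simp: m_def \<eta>_def)
    have ends: "m - \<eta> = t" "m + \<eta> = t + \<tau>" "t + \<tau> - m = \<eta>" by (auto simp: m_def \<eta>_def)
    define F where "F = (\<lambda>h k. (duhamel (t + \<tau>) (m + h) k + duhamel (t + \<tau>) (m - h) k) - 2 * duhamel (t + \<tau>) m k)"
    have Fb: "Sobolev_le (1/2) (K * \<tau> powr p) (F h)" if h: "h \<in> {0..\<eta>}" for h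
    proof -
      define X where "X = (\<lambda>k. flow (- h) (Re_cubed (u (m + h))) k + flow h (Re_cubed (u (m - h))) k - 2 * Re_cubed (u m) k)"
      have hr: "0 \<le> h" "h \<le> 1" "h \<le> \<tau>" "m - h \<in> {0..T}" "m + h \<in> {0..T}"
        using h t \<tau> tT by (auto simp: m_def \<eta>_def)
      have "Sobolev_le (-1/2) (K * h powr p) X"
        unfolding X_def by (rule second[OF hr(1,2,4,5)])
      moreover have "K * h powr p \<le> K * \<tau> powr p"
        using hr p KK by (intro mult_left_mono powr_mono2) auto
      ultimately have "Sobolev_le (-1/2) (K * \<tau> powr p) X" by (rule Sobolev_le_mono)
      then have "Sobolev_le (1/2) (K * \<tau> powr p) (jap_pow (-1) (flow \<eta> X))"
        by (intro Sobolev_le_jap_pow_neg[of "-1/2"] Sobolev_le_flow) auto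
      then show ?thesis
      proof (rule Sobolev_le_cong)
        fix k
        have "flow \<eta> X = (\<lambda>k. flow \<eta> (flow (- h) (Re_cubed (u (m + h)))) k + flow \<eta> (flow h (Re_cubed (u (m - h)))) k
            - 2 * flow \<eta> (Re_cubed (u m)) k)"
          by (rule ext) (simp add: X_def flow_exp algebra_simps)
        also have "flow \<eta> (flow (- h) (Re_cubed (u (m + h)))) = flow (t + \<tau> - (m + h)) (Re_cubed (u (m + h)))"
          by (simp add: flow_flow m_def \<eta>_def)
        also have "flow \<eta> (flow h (Re_cubed (u (m - h)))) = flow (t + \<tau> - (m - h)) (Re_cubed (u (m - h)))"
          by (simp add: flow_flow m_def \<eta>_def add.commute)
        finally have "flow \<eta> X = (\<lambda>k. flow (t + \<tau> - (m + h)) (Re_cubed (u (m + h))) k + flow (t + \<tau> - (m - h)) (Re_cubed (u (m - h))) k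
            - 2 * flow (t + \<tau> - m) (Re_cubed (u m)) k)"
          by (simp only: ends)
        then show "jap_pow (-1) (flow \<eta> X) k = F h k"
          by (simp only: F_def duhamel_def jap_pow_def) (simp add: algebra_simps)
      qed
    qed
    have Fint: "((\<lambda>h. F h k) has_integral 
        integral {t..t + \<tau>} (\<lambda>r. duhamel (t + \<tau>) r k) - \<tau> * duhamel (t + \<tau>) m k) {0..\<eta>}" for k
    proof -
      have "((\<lambda>h. duhamel (t + \<tau>) (m + h) k + duhamel (t + \<tau>) (m - h) k) has_integral 
          integral {m - \<eta>..m + \<eta>} (\<lambda>r. duhamel (t + \<tau>) r k)) {0..\<eta>}"
      proof (rule has_integral_symmetrize)
        show "0 \<le> \<eta>" using \<tau> by (simp add: \<eta>_def)
        show "(\<lambda>r. duhamel (t + \<tau>) r k) integrable_on {m - \<eta>..m + \<eta>}"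
          unfolding ends by (intro duhamel_integrable t tT)
      qed
      from has_integral_diff[OF this has_integral_const_real[of "2 * duhamel (t + \<tau>) m k" 0 \<eta>]]
      show ?thesis
        using \<tau> by (simp add: F_def ends scaleR_conv_of_real) (simp add: \<eta>_def)
    qed
    have "Sobolev_le (1/2) ((\<eta> - 0) * (K * \<tau> powr p)) (\<lambda>k. integral {0..\<eta>} (\<lambda>h. F h k))"
      by (rule Sobolev_le_integral) (use Fint Fb \<tau> in \<open>auto simp: \<eta>_def\<close>)
    then have "Sobolev_le (1/2) (\<tau> * (K * \<tau> powr p)) (\<lambda>k. integral {0..\<eta>} (\<lambda>h. F h k))"
      by (rule Sobolev_le_mono) (use \<tau> KK in \<open>auto simp: \<eta>_def intro!: mult_right_mono\<close>)
    from Sobolev_le_scale[OF this, of "- \<i>"]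
    have quad: "Sobolev_le (1/2) (\<tau> * (K * \<tau> powr p)) (\<lambda>k. - \<i> * integral {0..\<eta>} (\<lambda>h. F h k))"
      by simp
    \<comment> \<open>Replacing the exact midpoint value by the free evolution only costs its defect, whose real part is of second order.\<close>
    define w where "w = flow \<eta> (u t)"
    have w: "Sobolev_le (1/2) M w" unfolding w_def by (rule Sobolev_le_flow[OF bound_half[OF tin]])
    have "Sobolev_le (1/2) (\<bar>m - t\<bar>\<^sup>2 * K1) (real_part (defect t m))"
      by (rule real_part_defect_bound[OF Nh tin min])
    moreover have "defect t m = (\<lambda>k. u m k - w k)"
      by (simp add: defect_def w_def m_def)
    ultimately have d: "Sobolev_le (1/2) (\<bar>m - t\<bar>\<^sup>2 * K1) (\<lambda>k. real_part (u m) k - real_part w k)"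
      by (simp only: real_part_diff)
    have "Sobolev_le (-1/2) (3 * C0 * M\<^sup>2 * (\<bar>m - t\<bar>\<^sup>2 * K1)) (\<lambda>k. Re_cubed (u m) k - Re_cubed w k)"
      unfolding Re_cubed_u[OF min] Re_cubed_eq_cube[OF w]
      by (rule cube_diff_estimate[OF C0 C0 order_refl Sobolev_le_real_part[OF bound_half[OF min]] Sobolev_le_real_part[OF w] d])
    moreover have "3 * C0 * M\<^sup>2 * (\<bar>m - t\<bar>\<^sup>2 * K1) \<le> K' * \<tau> powr p"
    proof -
      have "\<bar>m - t\<bar>\<^sup>2 \<le> \<tau>\<^sup>2" using \<tau> by (intro power_mono) (auto simp: m_def \<eta>_def)
      also have "\<tau>\<^sup>2 = \<tau> powr 2" using \<tau> by simp
      also have "\<dots> \<le> \<tau> powr p" using \<tau> p by (intro powr_mono') auto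
      finally have "K' * \<bar>m - t\<bar>\<^sup>2 \<le> K' * \<tau> powr p" using KK by (intro mult_left_mono)
      then show ?thesis by (simp add: K'_def mult_ac)
    qed
    ultimately have "Sobolev_le (-1/2) (K' * \<tau> powr p) (\<lambda>k. Re_cubed (u m) k - Re_cubed w k)"
      by (rule Sobolev_le_mono)
    then have "Sobolev_le (1/2) (K' * \<tau> powr p) (jap_pow (-1) (flow \<eta> (\<lambda>k. Re_cubed (u m) k - Re_cubed w k)))"
      by (intro Sobolev_le_jap_pow_neg[of "-1/2"] Sobolev_le_flow) auto
    from Sobolev_le_scale[OF this, of "- \<i> * complex_of_real \<tau>"]
    have mid: "Sobolev_le (1/2) (\<tau> * (K' * \<tau> powr p)) 
        (\<lambda>k. - \<i> * complex_of_real \<tau> * jap_pow (-1) (flow \<eta> (\<lambda>k. Re_cubed (u m) k - Re_cubed w k)) k)"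
      using \<tau> by (simp add: norm_mult)
    have "Sobolev_le (1/2) (\<tau> * (K * \<tau> powr p) + \<tau> * (K' * \<tau> powr p)) (\<lambda>k. u (t + \<tau>) k - strang_step \<tau> (u t) k)"
    proof (rule Sobolev_le_cong[OF Sobolev_le_add[OF quad mid]])
      fix k
      let ?J = "integral {t..t + \<tau>} (\<lambda>r. duhamel (t + \<tau>) r k)"
      have 1: "integral {0..\<eta>} (\<lambda>h. F h k) = ?J - \<tau> * duhamel (t + \<tau>) m k"
        by (rule integral_unique[OF Fint])
      have 2: "u (t + \<tau>) k = flow \<tau> (u t) k - \<i> * ?J"
        using duhamel_formula[of t "t + \<tau>" k] t tT \<tau> by simp
      have 3: "jap_pow (-1) (flow \<eta> (\<lambda>k. Re_cubed (u m) k - Re_cubed w k)) k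
          = duhamel (t + \<tau>) m k - jap_pow (-1) (flow \<eta> (Re_cubed w)) k"
        by (simp only: duhamel_def ends jap_pow_def flow_diff right_diff_distrib)
      have 4: "strang_step \<tau> (u t) k = flow \<tau> (u t) k - \<i> * complex_of_real \<tau> * jap_pow (-1) (flow \<eta> (Re_cubed w)) k"
        by (simp add: strang_step_def w_def \<eta>_def)
      show "- \<i> * integral {0..\<eta>} (\<lambda>h. F h k) 
          + - \<i> * complex_of_real \<tau> * jap_pow (-1) (flow \<eta> (\<lambda>k. Re_cubed (u m) k - Re_cubed w k)) k
          = u (t + \<tau>) k - strang_step \<tau> (u t) k"
        unfolding 1 2 3 4 by (simp add: algebra_simps)
    qed
    then show "Sobolev_le (1/2) (\<tau> * ((K + K') * \<tau> powr (s + 1/2))) (\<lambda>k. u (t + \<tau>) k - strang_step \<tau> (u t) k)"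
      by (rule Sobolev_le_mono) (simp add: p_def algebra_simps)
  qed
qed

section \<open>Stability and error propagation\<close>

lemma Re_cubed_stability:
  assumes C: "triple_bound (1/2) (1/2) (1/2) (-1/2) C"
    and a: "Sobolev_le (1/2) R a" and b: "Sobolev_le (1/2) R b" and d: "Sobolev_le (1/2) E (\<lambda>k. a k - b k)"
  shows "Sobolev_le (-1/2) (3 * C * R\<^sup>2 * E) (\<lambda>k. Re_cubed a k - Re_cubed b k)"
  unfolding Re_cubed_eq_cube[OF a] Re_cubed_eq_cube[OF b]
proof (rule cube_diff_estimate[OF C C order_refl Sobolev_le_real_part[OF a] Sobolev_le_real_part[OF b]])
  show "Sobolev_le (1/2) E (\<lambda>k. real_part a k - real_part b k)"
    using Sobolev_le_real_part[OF d] by (simp only: real_part_diff)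
qed

lemma lie_step_stability:
  assumes "0 \<le> \<tau>" and C: "triple_bound (1/2) (1/2) (1/2) (-1/2) C"
    and a: "Sobolev_le (1/2) R a" and b: "Sobolev_le (1/2) R b" and d: "Sobolev_le (1/2) E (\<lambda>k. a k - b k)"
  shows "Sobolev_le (1/2) ((1 + \<tau> * (3 * C * R\<^sup>2)) * E) (\<lambda>k. lie_step \<tau> a k - lie_step \<tau> b k)"
proof -
  let ?D = "jap_pow (-1) (flow \<tau> (\<lambda>k. Re_cubed a k - Re_cubed b k))"
  have "Sobolev_le (1/2) (3 * C * R\<^sup>2 * E) ?D"
    by (rule Sobolev_le_jap_pow_neg[OF Sobolev_le_flow[OF Re_cubed_stability[OF C a b d]]]) simp
  from Sobolev_le_scale[OF this, of "- \<i> * complex_of_real \<tau>"]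
  have "Sobolev_le (1/2) (\<tau> * (3 * C * R\<^sup>2 * E)) (\<lambda>k. - \<i> * complex_of_real \<tau> * ?D k)"
    using assms(1) by (simp add: norm_mult)
  from Sobolev_le_add[OF Sobolev_le_flow[OF d, of \<tau>] this]
  have "Sobolev_le (1/2) (E + \<tau> * (3 * C * R\<^sup>2 * E)) (\<lambda>k. lie_step \<tau> a k - lie_step \<tau> b k)"
    by (rule Sobolev_le_cong) (simp add: lie_step_def jap_pow_def flow_exp algebra_simps)
  then show ?thesis by (rule Sobolev_le_mono) (simp add: algebra_simps)
qed

lemma strang_step_stability:
  assumes "0 \<le> \<tau>" and C: "triple_bound (1/2) (1/2) (1/2) (-1/2) C"
    and a: "Sobolev_le (1/2) R a" and b: "Sobolev_le (1/2) R b" and d: "Sobolev_le (1/2) E (\<lambda>k. a k - b k)"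
  shows "Sobolev_le (1/2) ((1 + \<tau> * (3 * C * R\<^sup>2)) * E) (\<lambda>k. strang_step \<tau> a k - strang_step \<tau> b k)"
proof -
  let ?a = "flow (\<tau> / 2) a" and ?b = "flow (\<tau> / 2) b"
  let ?D = "jap_pow (-1) (flow (\<tau> / 2) (\<lambda>k. Re_cubed ?a k - Re_cubed ?b k))"
  have d': "Sobolev_le (1/2) E (\<lambda>k. ?a k - ?b k)"
    using Sobolev_le_flow[OF d, of "\<tau> / 2"] by (rule Sobolev_le_cong) (rule flow_diff)
  have "Sobolev_le (1/2) (3 * C * R\<^sup>2 * E) ?D"
    by (rule Sobolev_le_jap_pow_neg[OF Sobolev_le_flow[OF Re_cubed_stability[OF C Sobolev_le_flow[OF a] Sobolev_le_flow[OF b] d']]]) simp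
  from Sobolev_le_scale[OF this, of "- \<i> * complex_of_real \<tau>"]
  have "Sobolev_le (1/2) (\<tau> * (3 * C * R\<^sup>2 * E)) (\<lambda>k. - \<i> * complex_of_real \<tau> * ?D k)"
    using assms(1) by (simp add: norm_mult)
  from Sobolev_le_add[OF Sobolev_le_flow[OF d, of \<tau>] this]
  have "Sobolev_le (1/2) (E + \<tau> * (3 * C * R\<^sup>2 * E)) (\<lambda>k. strang_step \<tau> a k - strang_step \<tau> b k)"
  proof (rule Sobolev_le_cong)
    fix k
    have D: "?D k = jap_pow (-1) (flow (\<tau> / 2) (Re_cubed ?a)) k - jap_pow (-1) (flow (\<tau> / 2) (Re_cubed ?b)) k"
      by (simp only: jap_pow_def flow_diff right_diff_distrib)
    show "flow \<tau> (\<lambda>k. a k - b k) k + - \<i> * complex_of_real \<tau> * ?D k = strang_step \<tau> a k - strang_step \<tau> b k"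
      unfolding D flow_diff by (simp add: strang_step_def algebra_simps)
  qed
  then show ?thesis by (rule Sobolev_le_mono) (simp add: algebra_simps)
qed

text \<open>A discrete Gronwall argument. The stability estimate holds on a ball of radius \<open>M + 1\<close>; for small
  \<open>\<tau>\<close> the error bound itself keeps the numerical solution inside this ball.\<close>

lemma error_propagation:
  fixes step :: "real \<Rightarrow> torus_dist \<Rightarrow> torus_dist"
  assumes T: "0 < T" and p: "0 < p" and K: "0 \<le> K" and L: "0 \<le> L"
    and bound: "\<And>t. t \<in> {0..T} \<Longrightarrow> Sobolev_le (1/2) M (u t)"
    and local_error: "\<And>t \<tau>. \<lbrakk>0 \<le> t; 0 < \<tau>; \<tau> \<le> 1; t + \<tau> \<le> T\<rbrakk> \<Longrightarrow> 
       Sobolev_le (1/2) (\<tau> * (K * \<tau> powr p)) (\<lambda>k. u (t + \<tau>) k - step \<tau> (u t) k)"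
    and stability: "\<And>\<tau> a b E. \<lbrakk>0 < \<tau>; \<tau> \<le> 1; Sobolev_le (1/2) (M + 1) a; Sobolev_le (1/2) (M + 1) b; 
       Sobolev_le (1/2) E (\<lambda>k. a k - b k)\<rbrakk> \<Longrightarrow> 
       Sobolev_le (1/2) ((1 + \<tau> * L) * E) (\<lambda>k. step \<tau> a k - step \<tau> b k)"
  shows "\<exists>\<tau>\<^sub>0 > 0. \<exists>C > 0. \<forall>\<tau> \<in> {0<..\<tau>\<^sub>0}. \<forall>n. real n * \<tau> \<le> T \<longrightarrow>
    Sobolev_le (1/2) (C * \<tau> powr p) (\<lambda>k. u (real n * \<tau>) k - (step \<tau> ^^ n) (u 0) k)"
proof -
  define C where "C = T * K * exp (T * L) + 1"
  have C: "0 < C" unfolding C_def using T K by (intro add_nonneg_pos mult_nonneg_nonneg) auto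
  define \<tau>\<^sub>0 where "\<tau>\<^sub>0 = min 1 ((1 / C) powr (1 / p))"
  have \<tau>0: "0 < \<tau>\<^sub>0" unfolding \<tau>\<^sub>0_def using C by simp
  show ?thesis
  proof (rule exI[of _ "\<tau>\<^sub>0"], rule conjI[OF \<tau>0], rule exI[of _ C], rule conjI[OF C], intro ballI allI impI)
    fix \<tau> n assume \<tau>in: "\<tau> \<in> {0<..\<tau>\<^sub>0}" and nT: "real n * \<tau> \<le> T"
    then have \<tau>: "0 < \<tau>" "\<tau> \<le> 1" "\<tau> \<le> (1 / C) powr (1 / p)" by (auto simp: \<tau>\<^sub>0_def)
    have small: "C * \<tau> powr p \<le> 1"
    proof -
      have "\<tau> powr p \<le> ((1 / C) powr (1 / p)) powr p"
        using \<tau> p by (intro powr_mono2) auto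
      also have "\<dots> = 1 / C" using p C by (simp add: powr_powr)
      finally show ?thesis using C by (simp add: field_simps)
    qed
    define B where "B = (\<lambda>n. real n * \<tau> * (K * \<tau> powr p) * (1 + \<tau> * L) ^ n)"
    have g: "1 \<le> 1 + \<tau> * L" using \<tau> L by simp
    have Ble: "B n \<le> C * \<tau> powr p" if "real n * \<tau> \<le> T" for n
    proof -
      have "(1 + \<tau> * L) ^ n \<le> exp (\<tau> * L) ^ n"
        using g by (intro power_mono exp_ge_add_one_self) auto
      also have "\<dots> = exp (real n * \<tau> * L)" by (simp add: exp_of_nat_mult[symmetric] mult.assoc)
      also have "\<dots> \<le> exp (T * L)" using that L by (simp add: mult_right_mono)
      finally have "B n \<le> T * (K * \<tau> powr p) * exp (T * L)"
        unfolding B_def using that T K g \<tau> by (intro mult_mono) auto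
      also have "\<dots> = (C - 1) * \<tau> powr p" by (simp add: C_def)
      also have "\<dots> \<le> C * \<tau> powr p" by (intro mult_right_mono) auto
      finally show ?thesis .
    qed
    have "Sobolev_le (1/2) (B n) (\<lambda>k. u (real n * \<tau>) k - (step \<tau> ^^ n) (u 0) k)"
      using nT
    proof (induction n)
      case 0
      have "Sobolev_le (1/2) 0 (\<lambda>k. 0)" by (rule Sobolev_leI) (auto simp: L2_set_def)
      then show ?case by (simp add: B_def)
    next
      case (Suc n)
      let ?t = "real n * \<tau>" and ?v = "(step \<tau> ^^ n) (u 0)"
      have tS: "real (Suc n) * \<tau> = ?t + \<tau>" by (simp add: algebra_simps)
      have t: "0 \<le> ?t" "?t \<le> T" "?t + \<tau> \<le> T" using Suc.prems \<tau> tS by auto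
      have IH: "Sobolev_le (1/2) (B n) (\<lambda>k. u ?t k - ?v k)" using Suc.IH t by blast
      have u: "Sobolev_le (1/2) M (u ?t)" using t by (intro bound) auto
      have "Sobolev_le (1/2) (M + B n) (\<lambda>k. u ?t k - (u ?t k - ?v k))"
        by (rule Sobolev_le_diff[OF u IH])
      then have "Sobolev_le (1/2) (M + B n) ?v" by simp
      moreover have "M + B n \<le> M + 1" using Ble[OF t(2)] small by linarith
      ultimately have v: "Sobolev_le (1/2) (M + 1) ?v" by (rule Sobolev_le_mono)
      have u1: "Sobolev_le (1/2) (M + 1) (u ?t)" using u by (rule Sobolev_le_mono) simp
      have "Sobolev_le (1/2) ((1 + \<tau> * L) * B n) (\<lambda>k. step \<tau> (u ?t) k - step \<tau> ?v k)"
        by (rule stability[OF \<tau>(1,2) u1 v IH])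
      from Sobolev_le_add[OF local_error[OF t(1) \<tau>(1,2) t(3)] this]
      have "Sobolev_le (1/2) (\<tau> * (K * \<tau> powr p) + (1 + \<tau> * L) * B n) (\<lambda>k. u (?t + \<tau>) k - step \<tau> ?v k)"
        by simp
      moreover have "\<tau> * (K * \<tau> powr p) + (1 + \<tau> * L) * B n \<le> B (Suc n)"
      proof -
        have "\<tau> * (K * \<tau> powr p) * 1 \<le> \<tau> * (K * \<tau> powr p) * (1 + \<tau> * L) ^ Suc n"
          using g \<tau> K by (intro mult_left_mono one_le_power) auto
        then show ?thesis by (simp add: B_def algebra_simps)
      qed
      ultimately have "Sobolev_le (1/2) (B (Suc n)) (\<lambda>k. u (?t + \<tau>) k - step \<tau> ?v k)"
        by (rule Sobolev_le_mono)
      then show ?case by (simp only: tS funpow.simps comp_def)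
    qed
    then show "Sobolev_le (1/2) (C * \<tau> powr p) (\<lambda>k. u (real n * \<tau>) k - (step \<tau> ^^ n) (u 0) k)"
      using Ble[OF nT] by (rule Sobolev_le_mono)
  qed
qed

lemma lie_splitting_funpow: "lie_splitting \<tau> c n = (lie_step \<tau> ^^ n) c"
  by (induction n) (simp_all add: lie_step_def)

lemma strang_splitting_funpow: "strang_splitting \<tau> c n = (strang_step \<tau> ^^ n) c"
  by (induction n) (simp_all add: strang_step_def)

lemma continuous_into_Sobolev_bounded:
  assumes "continuous_into_Sobolev s T u"
  obtains M where "\<And>t. t \<in> {0..T} \<Longrightarrow> Sobolev_le s M (u t)"
proof -
  have mem: "u t \<in> Sobolev s" if "t \<in> {0..T}" for t
    using assms that by (simp add: continuous_into_Sobolev_def)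
  have lim: "((\<lambda>r. Sobolev_norm s (\<lambda>k. u r k - u t k)) \<longlongrightarrow> 0) (at t within {0..T})" if "t \<in> {0..T}" for t
    using assms that by (simp add: continuous_into_Sobolev_def)
  have dist: "\<bar>Sobolev_norm s (u r) - Sobolev_norm s (u t)\<bar> \<le> Sobolev_norm s (\<lambda>k. u r k - u t k)"
    if r: "r \<in> {0..T}" and t: "t \<in> {0..T}" for r t
  proof -
    let ?D = "Sobolev_norm s (\<lambda>k. u r k - u t k)"
    have R: "Sobolev_le s (Sobolev_norm s (u r)) (u r)" and U: "Sobolev_le s (Sobolev_norm s (u t)) (u t)"
      by (intro Sobolev_le_norm mem r t)+
    have "(\<lambda>k. u r k - u t k) \<in> Sobolev s"
      using Sobolev_le_diff[OF R U] by (simp add: Sobolev_le_iff)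
    then have D: "Sobolev_le s ?D (\<lambda>k. u r k - u t k)" by (rule Sobolev_le_norm)
    have "Sobolev_norm s (u r) \<le> Sobolev_norm s (u t) + ?D"
      using Sobolev_le_add[OF U D] by (simp add: Sobolev_le_iff)
    moreover have "Sobolev_norm s (u t) \<le> Sobolev_norm s (u r) + ?D"
      using Sobolev_le_diff[OF R D] by (simp add: Sobolev_le_iff)
    ultimately show ?thesis by linarith
  qed
  have "continuous_on {0..T} (\<lambda>t. Sobolev_norm s (u t))"
    unfolding continuous_on_def
  proof
    fix t assume t: "t \<in> {0..T}"
    have "((\<lambda>r. Sobolev_norm s (u r) - Sobolev_norm s (u t)) \<longlongrightarrow> 0) (at t within {0..T})"
    proof (rule Lim_null_comparison[OF _ lim[OF t]])
      show "\<forall>\<^sub>F r in at t within {0..T}. norm (Sobolev_norm s (u r) - Sobolev_norm s (u t)) \<le> Sobolev_norm s (\<lambda>k. u r k - u t k)"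
        using dist t by (auto simp: eventually_at_filter)
    qed
    then show "((\<lambda>r. Sobolev_norm s (u r)) \<longlongrightarrow> Sobolev_norm s (u t)) (at t within {0..T})"
      by (rule LIM_zero_cancel)
  qed
  then have "compact ((\<lambda>t. Sobolev_norm s (u t)) ` {0..T})"
    by (rule compact_continuous_image) simp
  then obtain M where M: "\<And>t. t \<in> {0..T} \<Longrightarrow> \<bar>Sobolev_norm s (u t)\<bar> \<le> M"
    using compact_imp_bounded bounded_iff by (metis imageI real_norm_def)
  show thesis
  proof
    fix t assume t: "t \<in> {0..T}"
    have "Sobolev_norm s (u t) \<le> M" using M[OF t] by simp
    with Sobolev_le_norm[OF mem[OF t]] show "Sobolev_le s M (u t)" by (rule Sobolev_le_mono)
  qed
qed

theorem theorem3p1: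
  fixes s T :: real and z0 z1 :: torus_dist and z zt u :: "real \<Rightarrow> torus_dist"
  assumes "s > 1 / 2"
    and "z0 \<in> Sobolev s" and "real_valued z0"
    and "z1 \<in> Sobolev (s - 1)" and "real_valued z1"
    and "T > 0" and "ereal T < max_existence_time s (first_order z0 z1)"
    and "wave_solution s T z0 z1 z zt"
    and u_def: "\<And>t. u t = first_order (z t) (zt t)"
  shows "\<exists>\<tau>\<^sub>0 > 0. \<exists>C\<^sub>T > 0. \<forall>\<tau> \<in> {0<..\<tau>\<^sub>0}. \<forall>n. real n * \<tau> \<le> T \<longrightarrow>
    (s \<in> {1/2<..5/6} \<longrightarrow>
       Sobolev_dist_le (1/2) (u (real n * \<tau>)) (lie_splitting \<tau> (first_order z0 z1) n)
         (C\<^sub>T * \<tau> powr (3 * s - 3/2))) \<and>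
    (s \<in> {1<..3/2} \<longrightarrow>
       Sobolev_dist_le (1/2) (u (real n * \<tau>)) (strang_splitting \<tau> (first_order z0 z1) n)
         (C\<^sub>T * \<tau> powr (s + 1/2)))"
proof -
  have mild: "mild_solution s T (first_order z0 z1) u"
    using assms(8) unfolding wave_solution_def u_def[symmetric] by blast
  have u0: "u 0 = first_order z0 z1"
    using assms(8) unfolding wave_solution_def u_def by simp
  obtain M where bound: "\<And>t. t \<in> {0..T} \<Longrightarrow> Sobolev_le s M (u t)"
    using continuous_into_Sobolev_bounded mild unfolding mild_solution_def by blast
  interpret bounded_mild_solution s T M "first_order z0 z1" u
    by unfold_locales (use assms(1) bound mild in \<open>auto simp: mild_solution_def\<close>)
  obtain C where C: "triple_bound (1/2) (1/2) (1/2) (-1/2) C" using triple_bound_critical by blast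
  define L where "L = 3 * C * (M + 1)\<^sup>2"
  have L: "0 \<le> L" using C by (simp add: L_def triple_bound_def)
  consider (lie) "s \<le> 5/6" | (strang) "1 < s" "s \<le> 3/2" | (other) "5/6 < s" "\<not> (1 < s \<and> s \<le> 3/2)"
    by linarith
  then show ?thesis
  proof cases
    case lie
    obtain K where K: "0 \<le> K" "\<And>t \<tau>. \<lbrakk>0 \<le> t; 0 < \<tau>; \<tau> \<le> 1; t + \<tau> \<le> T\<rbrakk> \<Longrightarrow> 
       Sobolev_le (1/2) (\<tau> * (K * \<tau> powr (3 * s - 3/2))) (\<lambda>k. u (t + \<tau>) k - lie_step \<tau> (u t) k)"
      using lie_local_error[OF lie] by blast
    have "\<exists>\<tau>\<^sub>0 > 0. \<exists>C > 0. \<forall>\<tau> \<in> {0<..\<tau>\<^sub>0}. \<forall>n. real n * \<tau> \<le> T \<longrightarrow>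
      Sobolev_le (1/2) (C * \<tau> powr (3 * s - 3/2)) (\<lambda>k. u (real n * \<tau>) k - (lie_step \<tau> ^^ n) (u 0) k)"
      by (rule error_propagation[OF assms(6) _ K(1) L bound_half K(2)])
         (use assms(1) lie_step_stability[OF _ C] in \<open>auto simp: L_def\<close>)
    then obtain \<tau>\<^sub>0 D where pos: "\<tau>\<^sub>0 > 0" "D > 0" and main: "\<And>\<tau> n. \<lbrakk>\<tau> \<in> {0<..\<tau>\<^sub>0}; real n * \<tau> \<le> T\<rbrakk> \<Longrightarrow>
      Sobolev_le (1/2) (D * \<tau> powr (3 * s - 3/2)) (\<lambda>k. u (real n * \<tau>) k - (lie_step \<tau> ^^ n) (u 0) k)"
      by blast
    show ?thesis
      unfolding Sobolev_dist_le_iff lie_splitting_funpow u0[symmetric]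
      by (rule exI[of _ \<tau>\<^sub>0], intro conjI pos(1), rule exI[of _ D], intro conjI pos(2) ballI allI impI) (use lie in \<open>auto intro: main\<close>)
  next
    case strang
    obtain K where K: "0 \<le> K" "\<And>t \<tau>. \<lbrakk>0 \<le> t; 0 < \<tau>; \<tau> \<le> 1; t + \<tau> \<le> T\<rbrakk> \<Longrightarrow> 
       Sobolev_le (1/2) (\<tau> * (K * \<tau> powr (s + 1/2))) (\<lambda>k. u (t + \<tau>) k - strang_step \<tau> (u t) k)"
      using strang_local_error[OF strang] by blast
    have "\<exists>\<tau>\<^sub>0 > 0. \<exists>C > 0. \<forall>\<tau> \<in> {0<..\<tau>\<^sub>0}. \<forall>n. real n * \<tau> \<le> T \<longrightarrow>
      Sobolev_le (1/2) (C * \<tau> powr (s + 1/2)) (\<lambda>k. u (real n * \<tau>) k - (strang_step \<tau> ^^ n) (u 0) k)"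
      by (rule error_propagation[OF assms(6) _ K(1) L bound_half K(2)])
         (use assms(1) strang_step_stability[OF _ C] in \<open>auto simp: L_def\<close>)
    then obtain \<tau>\<^sub>0 D where pos: "\<tau>\<^sub>0 > 0" "D > 0" and main: "\<And>\<tau> n. \<lbrakk>\<tau> \<in> {0<..\<tau>\<^sub>0}; real n * \<tau> \<le> T\<rbrakk> \<Longrightarrow>
      Sobolev_le (1/2) (D * \<tau> powr (s + 1/2)) (\<lambda>k. u (real n * \<tau>) k - (strang_step \<tau> ^^ n) (u 0) k)"
      by blast
    show ?thesis
      unfolding Sobolev_dist_le_iff strang_splitting_funpow u0[symmetric]
      by (rule exI[of _ \<tau>\<^sub>0], intro conjI pos(1), rule exI[of _ D], intro conjI pos(2) ballI allI impI) (use strang in \<open>auto intro: main\<close>)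
  next
    case other
    then show ?thesis by (intro exI[of _ 1] conjI) auto
  qed
qed

end
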